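(* Let $\beta>0$, $n\ge 1$, let $q\sim\mathbb P^{Coul}_\beta$ be a Coulomb gas at inverse temperature $\beta$ on the faces of $\Lambda_n$ (with free or Dirichlet boundary conditions), and let $g:F\to\mathbb R$ be a function on the faces. Then $$\operatorname{Var}^{Coul}_\beta\big[\langle \Delta^{-1}q,g\rangle\big]\ \ge\ \frac{M(\beta)}{(2\pi)^2\beta}\,\langle g,(-\Delta)^{-1}g\rangle .$$ Moreover, when $g$ is local the following strengthened bound holds: there is a function $r(\beta)$ with $r(\beta)=o(\beta)$ as $\beta\to\infty$ such that for all sufficiently large $\beta$ and every fixed function $g$ with finite support on the faces of $\mathbb Z^2$, there is $n_0=n_0(g,\beta)$ such that for all $n\ge n_0$ (with free or Dirichlet boundary conditions) $$\operatorname{Var}^{Coul}_\beta\big[\langle \Delta^{-1}q,g\rangle\big]\ \ge\ e^{-\pi^2\beta+r(\beta)}\,\langle g,(-\Delta)^{-1}g\rangle .$$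
   Context: Graphs. $\Lambda_n$ is one of two graphs embedded in the sphere. Free boundary conditions: $[-n,n]^2\cap\mathbb Z^2$ with nearest-neighbour edges; the marked face $f_0$ is the face containing the point at infinity. Zero (Dirichlet) boundary conditions: $([-n,n]^2\cap\mathbb Z^2)\cup\{\infty\}$ with nearest-neighbour edges and the vertices of $\partial[-n,n]^2$ connected to $\infty$ so that the graph is the planar dual of a square-grid box (one edge to $\infty$ for each non-corner boundary vertex, two parallel edges for each corner); the marked face $f_0$ is a face in the middle of the graph (a fixed unit square touching the origin). $E,F$ are the sets of edges and faces. 2-forms. Orienting all faces coherently (by the outer normal of the sphere), a 2-form is a function $g:F\to\mathbb R$ with $g(f_0)=0$; $\langle g_1,g_2\rangle=\sum_{f\in F}g_1(f)g_2(f)$. On 2-forms, $\Delta$ is the (negative definite, invertible) graph Laplacian of the dual graph with value $0$ imposed at $f_0$: $\langle g,(-\Delta)g\rangle=\sum_{e\in E}(g(f)-g(f'))^2$, where $f,f'$ are the two faces adjacent to $e$. For a general function $g$ on $F$, the value $g(f_0)$ is irrelevant (it is set to $0$) in $\langle\Delta^{-1}q,g\rangle$ and $\langle g,(-\Delta)^{-1}g\rangle$. Coulomb gas. $\mathbb P^{Coul}_\beta$ is the law of the random integer-valued 2-form $q$ with $\mathbb P^{Coul}_\beta(q)\propto\exp\big(-\tfrac{(2\pi)^2\beta}{2}\langle q,(-\Delta)^{-1}q\rangle\big)$. Error function. An integer-valued Gaussian with parameters $(a,\beta)$ is a $\mathbb Z$-valued $X$ with $\mathbb P^{IG}_{\beta,a}[X=k]\propto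 e^{-\frac\beta2(k-a)^2}$; $\operatorname{Var}^{IG}(a,\beta)$ is its variance. $M(\beta):=(2\pi)^2\beta\inf_{a\in[0,1/2]}\operatorname{Var}^{IG}(a,(2\pi)^2\beta)$. *)

theory Defs
  imports "HOL-Probability.Probability" "HOL-Library.Landau_Symbols"
begin

section \<open>The graphs $\Lambda_n$\<close>

text \<open>
  A unit square of the square lattice is named by its lower left corner, a lattice edge by its
  lower or left endpoint. The constructor \<open>Dirichlet s\<close> carries the unit square chosen as the
  marked face.
\<close>

type_synonym site = "int \<times> int"
type_synonym square = "int \<times> int"

datatype edge = Horizontal site | Vertical site
datatype face = Outer | Square square
datatype boundary = Free | Dirichlet square

definition sites :: "nat \<Rightarrow> site set" where
  "sites n = {- int n .. int n} \<times> {- int n .. int n}"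

fun ends :: "edge \<Rightarrow> site set" where
  "ends (Horizontal (x, y)) = {(x, y), (x + 1, y)}"
| "ends (Vertical (x, y)) = {(x, y), (x, y + 1)}"

fun corners :: "square \<Rightarrow> site set" where
  "corners (x, y) = {(x, y), (x + 1, y), (x, y + 1), (x + 1, y + 1)}"

fun sides :: "edge \<Rightarrow> square \<times> square" where
  "sides (Horizontal (x, y)) = ((x, y), (x, y - 1))"
| "sides (Vertical (x, y)) = ((x - 1, y), (x, y))"

text \<open>
  The Dirichlet graph is the square lattice with all sites outside the box collapsed to the vertex
  $\infty$ (and the resulting loops removed). Its edges are thus the lattice edges with an endpoint
  in the box: every non-corner boundary site has one edge to $\infty$, every corner has two. Its
  faces are the lattice squares with a corner in the box: the $(2n)^2$ unit squares of the box, the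
  triangle at each of the $8n$ boundary edges and the bigon at each of the four corners, which makes
  $(2n+2)^2$ faces forming a square grid, as it should be for the planar dual of a square-grid box.
  In the free graph all squares outside the box belong to the outer face.
\<close>

fun edges :: "boundary \<Rightarrow> nat \<Rightarrow> edge set" where
  "edges Free n = {e. ends e \<subseteq> sites n}"
| "edges (Dirichlet s) n = {e. ends e \<inter> sites n \<noteq> {}}"

fun faces :: "boundary \<Rightarrow> nat \<Rightarrow> face set" where
  "faces Free n = insert Outer (Square ` {t. corners t \<subseteq> sites n})"
| "faces (Dirichlet s) n = Square ` {t. corners t \<inter> sites n \<noteq> {}}"

fun marked_face :: "boundary \<Rightarrow> face" where
  "marked_face Free = Outer"
| "marked_face (Dirichlet s) = Square s"

definition face_at :: "boundary \<Rightarrow> nat \<Rightarrow> square \<Rightarrow> face" where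
  "face_at bc n t = (if Square t \<in> faces bc n then Square t else Outer)"

definition left_face :: "boundary \<Rightarrow> nat \<Rightarrow> edge \<Rightarrow> face" where
  "left_face bc n e = face_at bc n (fst (sides e))"

definition right_face :: "boundary \<Rightarrow> nat \<Rightarrow> edge \<Rightarrow> face" where
  "right_face bc n e = face_at bc n (snd (sides e))"


section \<open>2-forms and the Laplacian\<close>

text \<open>
  A function on the faces of $\Lambda_n$ is a function on the type \<^typ>\<open>face\<close> of which only the
  values on \<^term>\<open>faces bc n\<close> matter; a 2-form vanishes elsewhere, so that 2-forms are equal
  as soon as they agree on the faces.
\<close>

definition two_forms :: "boundary \<Rightarrow> nat \<Rightarrow> (face \<Rightarrow> 'a::zero) set" where
  "two_forms bc n = {g. g (marked_face bc) = 0 \<and> (\<forall>f. f \<notin> faces bc n \<longrightarrow> g f = 0)}"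

definition to_form :: "boundary \<Rightarrow> nat \<Rightarrow> (face \<Rightarrow> real) \<Rightarrow> face \<Rightarrow> real" where
  "to_form bc n g f = (if f \<in> faces bc n - {marked_face bc} then g f else 0)"

definition form_inner :: "boundary \<Rightarrow> nat \<Rightarrow> (face \<Rightarrow> real) \<Rightarrow> (face \<Rightarrow> real) \<Rightarrow> real" where
  "form_inner bc n g h = (\<Sum>f\<in>faces bc n. g f * h f)"

text \<open>Summing over edges rather than over adjacent faces counts parallel dual edges.\<close>

definition laplacian :: "boundary \<Rightarrow> nat \<Rightarrow> (face \<Rightarrow> real) \<Rightarrow> face \<Rightarrow> real" where
  "laplacian bc n g = to_form bc n (\<lambda>f.
     (\<Sum>e | e \<in> edges bc n \<and> left_face bc n e = f. g (right_face bc n e) - g f) +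
     (\<Sum>e | e \<in> edges bc n \<and> right_face bc n e = f. g (left_face bc n e) - g f))"

definition inv_laplacian :: "boundary \<Rightarrow> nat \<Rightarrow> (face \<Rightarrow> real) \<Rightarrow> face \<Rightarrow> real" where
  "inv_laplacian bc n g = the_inv_into (two_forms bc n) (laplacian bc n) (to_form bc n g)"

definition inv_neg_laplacian :: "boundary \<Rightarrow> nat \<Rightarrow> (face \<Rightarrow> real) \<Rightarrow> face \<Rightarrow> real" where
  "inv_neg_laplacian bc n g =
     the_inv_into (two_forms bc n) (\<lambda>u f. - laplacian bc n u f) (to_form bc n g)"

definition green_form :: "boundary \<Rightarrow> nat \<Rightarrow> (face \<Rightarrow> real) \<Rightarrow> real" where
  "green_form bc n g = form_inner bc n (to_form bc n g) (inv_neg_laplacian bc n g)"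

fun on_faces :: "(square \<Rightarrow> real) \<Rightarrow> face \<Rightarrow> real" where
  "on_faces g Outer = 0"
| "on_faces g (Square t) = g t"


section \<open>The Coulomb gas and the integer-valued Gaussian\<close>

definition normalized_pmf :: "('a \<Rightarrow> real) \<Rightarrow> 'a pmf" where
  "normalized_pmf w = embed_pmf (\<lambda>x. w x / (\<Sum>\<^sub>\<infinity>y. w y))"

definition coulomb_weight :: "boundary \<Rightarrow> nat \<Rightarrow> real \<Rightarrow> (face \<Rightarrow> int) \<Rightarrow> real" where
  "coulomb_weight bc n \<beta> q =
     (if q \<in> two_forms bc n
      then exp (- ((2 * pi)\<^sup>2 * \<beta> / 2) * green_form bc n (\<lambda>f. real_of_int (q f)))
      else 0)"

definition coulomb :: "boundary \<Rightarrow> nat \<Rightarrow> real \<Rightarrow> (face \<Rightarrow> int) pmf" where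
  "coulomb bc n \<beta> = normalized_pmf (coulomb_weight bc n \<beta>)"

definition coulomb_variance :: "boundary \<Rightarrow> nat \<Rightarrow> real \<Rightarrow> (face \<Rightarrow> real) \<Rightarrow> real" where
  "coulomb_variance bc n \<beta> g =
     measure_pmf.variance (coulomb bc n \<beta>)
       (\<lambda>q. form_inner bc n (inv_laplacian bc n (\<lambda>f. real_of_int (q f))) g)"

definition IG :: "real \<Rightarrow> real \<Rightarrow> int pmf" where
  "IG a \<beta> = normalized_pmf (\<lambda>k. exp (- (\<beta> / 2) * (real_of_int k - a)\<^sup>2))"

definition Var_IG :: "real \<Rightarrow> real \<Rightarrow> real" where
  "Var_IG a \<beta> = measure_pmf.variance (IG a \<beta>) real_of_int"

definition M :: "real \<Rightarrow> real" where
  "M \<beta> = (2 * pi)\<^sup>2 * \<beta> * (INF a\<in>{0..1/2}. Var_IG a ((2 * pi)\<^sup>2 * \<beta>))"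


section \<open>Well-definedness\<close>

text \<open>
  The facts below show that \<^const>\<open>laplacian\<close> is the operator of the Dirichlet form
  $\sum_{e\in E}(g(f)-g(f'))^2$, that it is a bijection of the 2-forms (so \<^const>\<open>the_inv_into\<close> is
  the genuine inverse), and that both families of weights are summable (so \<^const>\<open>embed_pmf\<close> yields
  the laws with these weights).
\<close>

lemma finite_sites: "finite (sites n)" by (simp add: sites_def)

lemma mem_sites: "(x, y) \<in> sites n \<longleftrightarrow> x \<in> {- int n .. int n} \<and> y \<in> {- int n .. int n}"
  by (simp add: sites_def)

lemma square_in_faces_Dirichlet:
  "Square (x, y) \<in> faces (Dirichlet s) n \<longleftrightarrow> x \<in> {- int n - 1 .. int n} \<and> y \<in> {- int n - 1 .. int n}"
  by (auto simp: inj_image_mem_iff inj_def Int_insert_left mem_sites)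

lemma finite_faces: "finite (faces bc n)"
proof (cases bc)
  case Free
  have "{t. corners t \<subseteq> sites n} \<subseteq> sites n" by (auto simp: sites_def)
  then show ?thesis using Free finite_sites by (auto intro: finite_subset)
next
  case (Dirichlet s)
  have "{t. corners t \<inter> sites n \<noteq> {}} \<subseteq> {- int n - 1 .. int n} \<times> {- int n - 1 .. int n}"
    by (auto simp: sites_def)
  then have "finite {t. corners t \<inter> sites n \<noteq> {}}" by (rule finite_subset) auto
  then show ?thesis using Dirichlet by simp
qed

lemma finite_edges: "finite (edges bc n)"
proof -
  let ?A = "{- int n - 1 .. int n} \<times> {- int n - 1 .. int n}"
  have "e \<in> Horizontal ` ?A \<union> Vertical ` ?A" if "ends e \<inter> sites n \<noteq> {}" for e
    using that by (cases e rule: ends.cases) (auto simp: sites_def)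
  moreover have "ends e \<inter> sites n \<noteq> {}" if "e \<in> edges bc n" for e
    using that by (cases bc; cases e rule: ends.cases) auto
  ultimately have "edges bc n \<subseteq> Horizontal ` ?A \<union> Vertical ` ?A" by blast
  then show ?thesis by (rule finite_subset) auto
qed

lemma sides_in_faces:
  assumes "e \<in> edges bc n"
  shows "left_face bc n e \<in> faces bc n" "right_face bc n e \<in> faces bc n"
  using assms
  by (cases bc; cases e rule: ends.cases;
      force simp: left_face_def right_face_def face_at_def)+

lemma laplacian_form:
  assumes "v \<in> two_forms bc n"
  shows "form_inner bc n v (\<lambda>f. - laplacian bc n u f) =
    (\<Sum>e\<in>edges bc n. (v (left_face bc n e) - v (right_face bc n e)) *
                      (u (left_face bc n e) - u (right_face bc n e)))"
proof -
  let ?l = "left_face bc n" and ?r = "right_face bc n" and ?E = "edges bc n" and ?F = "faces bc n"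
  have "form_inner bc n v (\<lambda>f. - laplacian bc n u f) =
     (\<Sum>f\<in>?F. (\<Sum>e | e \<in> ?E \<and> ?l e = f. v (?l e) * (u (?l e) - u (?r e))) +
              (\<Sum>e | e \<in> ?E \<and> ?r e = f. v (?r e) * (u (?r e) - u (?l e))))"
    unfolding form_inner_def
  proof (rule sum.cong[OF refl], goal_cases)
    case (1 f)
    have A: "v f * - a f = v f * (- b)" if "a f = (if f \<in> ?F - {marked_face bc} then b else 0)" for a b
      using that assms 1 by (auto simp: two_forms_def)
    show ?case
      unfolding A[where a = "laplacian bc n u", OF laplacian_def[THEN fun_cong, unfolded to_form_def]]
      by (auto simp: distrib_left sum_distrib_left sum_negf[symmetric] algebra_simps
               simp flip: sum_negf intro!: arg_cong2[where f = "(+)"] sum.cong)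
  qed
  also have "\<dots> = (\<Sum>e\<in>?E. v (?l e) * (u (?l e) - u (?r e))) + (\<Sum>e\<in>?E. v (?r e) * (u (?r e) - u (?l e)))"
    unfolding sum.distrib
    by (intro arg_cong2[where f = "(+)"] sum.group finite_edges finite_faces) (auto intro: sides_in_faces)
  also have "\<dots> = (\<Sum>e\<in>?E. (v (?l e) - v (?r e)) * (u (?l e) - u (?r e)))"
    by (simp add: sum.distrib[symmetric] algebra_simps)
  finally show ?thesis .
qed

lemma zero_of_energy_zero:
  assumes u: "u \<in> two_forms bc n" and m: "marked_face bc \<in> faces bc n"
    and eq: "\<And>e. e \<in> edges bc n \<Longrightarrow> u (left_face bc n e) = u (right_face bc n e)"
  shows "u f = (0::real)"
proof (cases bc)
  case Free
  define U where "U t = u (face_at bc n t)" for t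
  have out: "u Outer = 0" using u Free by (simp add: two_forms_def)
  have V: "U (x - 1, y) = U (x, y)" if "x \<in> {-int n..int n}" "y \<in> {-int n..int n - 1}" for x y
    using eq[of "Vertical (x, y)"] that Free
    by (auto simp: U_def left_face_def right_face_def sites_def)
  have "U (x, y) = 0" if "y \<in> {-int n..int n - 1}" "x \<ge> - int n - 1" "x \<le> int n" for x y
    using that(2,3)
  proof (induction x rule: int_ge_induct)
    case base
    show ?case using out Free by (auto simp: U_def face_at_def sites_def)
  next
    case (step i)
    then show ?case using V[of "i + 1" y] that(1) by auto
  qed
  note * = this
  show ?thesis
  proof (cases "f \<in> faces bc n")
    case True
    show ?thesis
    proof (cases f)
      case (Square t)
      obtain x y where t: "t = (x, y)" by (cases t)
      have "corners t \<subseteq> sites n" using True Square Free by auto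
      then have "U t = 0" unfolding t using * by (auto simp: sites_def)
      then show ?thesis using True Square by (simp add: U_def face_at_def)
    qed (use out in simp)
  qed (use u in \<open>simp add: two_forms_def\<close>)
next
  case (Dirichlet s)
  let ?I = "{-int n - 1..int n}"
  have mem: "Square (x, y) \<in> faces bc n \<longleftrightarrow> x \<in> ?I \<and> y \<in> ?I" for x y
    using Dirichlet square_in_faces_Dirichlet by simp
  define U where "U t = u (Square t)" for t
  have V: "U (x - 1, y) = U (x, y)" if "x \<in> {-int n..int n}" "y \<in> ?I" for x y
  proof -
    have "Vertical (x, y) \<in> edges bc n"
      using that Dirichlet by (auto simp: Int_insert_left mem_sites)
    from eq[OF this] show ?thesis
      using that by (simp add: U_def left_face_def right_face_def face_at_def mem del: faces.simps)
  qed
  have H: "U (x, y) = U (x, y - 1)" if "y \<in> {-int n..int n}" "x \<in> ?I" for x y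
  proof -
    have "Horizontal (x, y) \<in> edges bc n"
      using that Dirichlet by (auto simp: Int_insert_left mem_sites)
    from eq[OF this] show ?thesis
      using that by (simp add: U_def left_face_def right_face_def face_at_def mem del: faces.simps)
  qed
  have A: "U (x, y) = U (- int n - 1, y)" if "y \<in> ?I" "x \<ge> - int n - 1" "x \<le> int n" for x y
    using that(2,3)
  proof (induction x rule: int_ge_induct)
    case (step i)
    then show ?case using V[of "i + 1" y] that(1) by auto
  qed simp
  have B: "U (x, y) = U (x, - int n - 1)" if "x \<in> ?I" "y \<ge> - int n - 1" "y \<le> int n" for x y
    using that(2,3)
  proof (induction y rule: int_ge_induct)
    case (step i)
    then show ?case using H[of "i + 1" x] that(1) by auto
  qed simp
  have C: "U (x, y) = U (- int n - 1, - int n - 1)" if "x \<in> ?I" "y \<in> ?I" for x y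
    using A[of y x] B[of "- int n - 1" y] that by auto
  have "U s = 0" using u Dirichlet by (simp add: two_forms_def U_def)
  moreover have "U s = U (- int n - 1, - int n - 1)"
    using m Dirichlet C mem by (cases s) (metis marked_face.simps(2))
  ultimately have 0: "U (x, y) = 0" if "x \<in> ?I" "y \<in> ?I" for x y using C[OF that] by linarith
  show ?thesis
  proof (cases "f \<in> faces bc n")
    case True
    then obtain x y where f: "f = Square (x, y)" using Dirichlet by auto
    then show ?thesis using True mem 0[of x y] by (simp add: U_def del: faces.simps)
  qed (use u in \<open>simp add: two_forms_def\<close>)
qed

lemma positive_definite_solvable:
  fixes L :: "('a \<Rightarrow> real) \<Rightarrow> 'a \<Rightarrow> real"
  assumes "finite A"
    and lin: "\<And>u v c a. L (\<lambda>x. u x + c * v x) a = L u a + c * L v a"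
    and pd: "\<And>u. \<lbrakk>\<And>a. a \<notin> A \<Longrightarrow> u a = 0; (\<Sum>a\<in>A. u a * L u a) = 0\<rbrakk> \<Longrightarrow> u = (\<lambda>_. 0)"
  shows "\<exists>u. (\<forall>a. a \<notin> A \<longrightarrow> u a = 0) \<and> (\<forall>a\<in>A. L u a = h a)"
  using assms(1) pd
proof (induction A arbitrary: h rule: finite_induct)
  case empty
  show ?case by auto
next
  case (insert x A)
  have IH: "\<exists>u. (\<forall>a. a \<notin> A \<longrightarrow> u a = 0) \<and> (\<forall>a\<in>A. L u a = h a)" for h
  proof (rule insert.IH)
    fix u assume 1: "\<And>a. a \<notin> A \<Longrightarrow> u a = 0" "(\<Sum>a\<in>A. u a * L u a) = 0"
    have "(\<Sum>a\<in>insert x A. u a * L u a) = 0"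
      using 1 insert.hyps by simp
    then show "u = (\<lambda>_. 0)" using insert.prems[of u] 1(1) by blast
  qed
  define e :: "'a \<Rightarrow> real" where "e = (\<lambda>a. if a = x then 1 else 0)"
  obtain w where w: "\<And>a. a \<notin> A \<Longrightarrow> w a = 0" "\<And>a. a \<in> A \<Longrightarrow> L w a = L e a"
    using IH[of "L e"] by blast
  define p where "p = (\<lambda>a. e a + (-1) * w a)"
  have Lp: "L p a = L e a - L w a" for a unfolding p_def lin by simp
  have px: "p x = 1" using w(1)[of x] insert.hyps by (simp add: p_def e_def)
  have s: "L p x \<noteq> 0"
  proof
    assume "L p x = 0"
    then have "(\<Sum>a\<in>insert x A. p a * L p a) = 0"
      using w(2) by (intro sum.neutral) (auto simp: Lp)
    moreover have "p a = 0" if "a \<notin> insert x A" for a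
      using that w(1) by (simp add: p_def e_def)
    ultimately have "p = (\<lambda>_. 0)" using insert.prems[of p] by blast
    with px show False by simp
  qed
  obtain v where v: "\<And>a. a \<notin> A \<Longrightarrow> v a = 0" "\<And>a. a \<in> A \<Longrightarrow> L v a = h a"
    using IH[of h] by blast
  define u where "u = (\<lambda>a. v a + ((h x - L v x) / L p x) * p a)"
  have "L u a = h a" if "a \<in> insert x A" for a
    unfolding u_def lin using that s v(2) w(2) by (auto simp: Lp)
  moreover have "u a = 0" if "a \<notin> insert x A" for a
    using that v(1) w(1) by (simp add: u_def p_def e_def)
  ultimately show ?case by blast
qed

lemma laplacian_linear:
  "laplacian bc n (\<lambda>x. u x + c * v x) a = laplacian bc n u a + c * laplacian bc n v a"
proof -
  have *: "(u y + c * v y) - (u z + c * v z) = (u y - u z) + c * (v y - v z)" for y z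
    by (simp add: algebra_simps)
  have "(\<Sum>e\<in>X. (u (y e) + c * v (y e)) - (u a + c * v a)) =
      (\<Sum>e\<in>X. u (y e) - u a) + c * (\<Sum>e\<in>X. v (y e) - v a)" for X :: "edge set" and y
    unfolding * sum.distrib sum_distrib_left ..
  note ** = this
  have add4: "(A + c * A') + (B + c * B') = (A + B) + c * (A' + B')" for A A' B B' :: real
    by (simp add: distrib_left)
  show ?thesis
    unfolding laplacian_def to_form_def ** add4
    by (cases "a \<in> faces bc n - {marked_face bc}") (simp_all only: if_True if_False mult_zero_right add_0)
qed

lemma laplacian_pos_def:
  assumes u: "u \<in> two_forms bc n" and m: "marked_face bc \<in> faces bc n"
    and 0: "form_inner bc n u (\<lambda>f. - laplacian bc n u f) = 0"
  shows "u = (\<lambda>_. 0)"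
proof -
  have "\<forall>e\<in>edges bc n. (u (left_face bc n e) - u (right_face bc n e)) *
          (u (left_face bc n e) - u (right_face bc n e)) = 0"
    using 0 unfolding laplacian_form[OF u]
    by (subst (asm) sum_nonneg_eq_0_iff) (auto simp: finite_edges)
  then have "u (left_face bc n e) = u (right_face bc n e)" if "e \<in> edges bc n" for e
    using that by simp
  then show ?thesis using zero_of_energy_zero[OF u m] by blast
qed

lemma laplacian_bij:
  assumes m: "marked_face bc \<in> faces bc n"
  shows "bij_betw (laplacian bc n) (two_forms bc n) (two_forms bc n)"
proof -
  let ?A = "faces bc n - {marked_face bc}"
  have tf: "u \<in> two_forms bc n \<longleftrightarrow> (\<forall>a. a \<notin> ?A \<longrightarrow> u a = 0)" for u :: "face \<Rightarrow> real"
    by (auto simp: two_forms_def)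
  have into: "laplacian bc n u \<in> two_forms bc n" for u
    by (simp add: tf laplacian_def to_form_def)
  have inj: "inj_on (laplacian bc n) (two_forms bc n)"
  proof (rule inj_onI)
    fix u v assume uv: "u \<in> two_forms bc n" "v \<in> two_forms bc n" "laplacian bc n u = laplacian bc n v"
    let ?d = "\<lambda>x. u x + (-1) * v x"
    have "laplacian bc n ?d a = 0" for a
      unfolding laplacian_linear using uv by simp
    moreover have "?d \<in> two_forms bc n" using uv by (simp add: tf)
    ultimately have "?d = (\<lambda>_. 0)"
      by (intro laplacian_pos_def[OF _ m]) (simp_all add: form_inner_def)
    then show "u = v" by (simp add: fun_eq_iff)
  qed
  have "h \<in> laplacian bc n ` two_forms bc n" if h: "h \<in> two_forms bc n" for h
  proof -
    have "\<exists>u. (\<forall>a. a \<notin> ?A \<longrightarrow> u a = 0) \<and> (\<forall>a\<in>?A. laplacian bc n u a = h a)"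
    proof (rule positive_definite_solvable)
      fix u assume 1: "\<And>a. a \<notin> ?A \<Longrightarrow> u a = 0" "(\<Sum>a\<in>?A. u a * laplacian bc n u a) = 0"
      have u: "u \<in> two_forms bc n" using 1(1) tf by blast
      have "form_inner bc n u (\<lambda>f. - laplacian bc n u f) = - (\<Sum>a\<in>?A. u a * laplacian bc n u a)"
        unfolding form_inner_def sum_negf[symmetric]
        using 1(1) finite_faces by (intro sum.mono_neutral_cong_right) auto
      then show "u = (\<lambda>_. 0)"
        using 1(2) by (intro laplacian_pos_def[OF u m]) simp
    qed (simp_all add: finite_faces laplacian_linear)
    then obtain u where u: "\<And>a. a \<notin> ?A \<Longrightarrow> u a = 0" "\<And>a. a \<in> ?A \<Longrightarrow> laplacian bc n u a = h a" by blast
    have "laplacian bc n u a = h a" for a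
      using u(2) into[of u] h unfolding tf by (cases "a \<in> ?A") metis+
    then have "h = laplacian bc n u" by (intro ext) simp
    moreover have "u \<in> two_forms bc n" using u(1) tf by blast
    ultimately show ?thesis by (rule image_eqI)
  qed
  then have "laplacian bc n ` two_forms bc n = two_forms bc n" using into by blast
  then show ?thesis using inj by (simp add: bij_betw_def)
qed

lemma marked_face_in_faces:
  assumes "bc \<in> {Free, Dirichlet s}" "(0, 0) \<in> corners s"
  shows "marked_face bc \<in> faces bc n"
proof -
  have "(0, 0) \<in> sites n" by (simp add: mem_sites)
  then have "corners s \<inter> sites n \<noteq> {}" using assms(2) by blast
  then show ?thesis using assms(1) by (elim insertE) simp_all
qed

lemma pmf_normalized_pmf:
  assumes nn: "\<And>x. w x \<ge> 0" and sm: "w summable_on UNIV" and pos: "w z > 0"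
  shows "pmf (normalized_pmf w) x = w x / (\<Sum>\<^sub>\<infinity>y. w y)"
  unfolding normalized_pmf_def
proof (rule pmf_embed_pmf)
  let ?Z = "\<Sum>\<^sub>\<infinity>y. w y"
  have "w z = (\<Sum>\<^sub>\<infinity>y\<in>{z}. w y)" by simp
  also have "\<dots> \<le> ?Z"
    by (rule infsum_mono_neutral) (use nn sm in auto)
  finally have Z: "?Z > 0" using pos by simp
  show "0 \<le> w x / ?Z" for x using nn Z by simp
  have "(\<lambda>x. w x * (1 / ?Z)) summable_on UNIV" using sm by (rule summable_on_cmult_left)
  then have "Infinite_Sum.abs_summable_on (\<lambda>x. w x / ?Z) UNIV" using nn Z by simp
  then have a: "Infinite_Set_Sum.abs_summable_on (\<lambda>x. w x / ?Z) UNIV"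
    using abs_summable_equivalent by blast
  have "(\<integral>\<^sup>+x. ennreal (w x / ?Z) \<partial>count_space UNIV) = ennreal (infsetsum (\<lambda>x. w x / ?Z) UNIV)"
    by (rule nn_integral_conv_infsetsum[OF a]) (use nn Z in simp)
  also have "infsetsum (\<lambda>x. w x / ?Z) UNIV = (\<Sum>\<^sub>\<infinity>x. w x * (1 / ?Z))"
    by (simp add: infsetsum_infsum[OF a])
  also have "\<dots> = ?Z * (1 / ?Z)" using sm by (intro infsum_cmult_left) 
  finally show "(\<integral>\<^sup>+x. ennreal (w x / ?Z) \<partial>count_space UNIV) = 1" using Z by simp
qed

lemma summable_gaussian:
  fixes a c :: real
  assumes "c > 0"
  shows "(\<lambda>k::int. exp (- c * (real_of_int k - a)\<^sup>2)) summable_on UNIV"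
proof -
  let ?h = "\<lambda>k::int. exp (c * (\<bar>a\<bar> + 1)) * exp (- c) ^ nat \<bar>k\<bar>"
  have g: "(\<lambda>n::nat. exp (- c) ^ n) summable_on UNIV"
    using assms by (intro norm_summable_imp_summable_on) (simp add: summable_geometric)
  have 1: "(\<lambda>k::int. exp (- c) ^ nat \<bar>k\<bar>) summable_on {0..}"
    using g by (subst summable_on_reindex_bij_witness[of _ int nat UNIV "\<lambda>n. exp (- c) ^ n"]) auto
  have 2: "(\<lambda>k::int. exp (- c) ^ nat \<bar>k\<bar>) summable_on {..0}"
    using g by (subst summable_on_reindex_bij_witness[of _ "\<lambda>n. - int n" "\<lambda>k. nat (- k)" UNIV "\<lambda>n. exp (- c) ^ n"]) auto
  have "(\<lambda>k::int. exp (- c) ^ nat \<bar>k\<bar>) summable_on ({0..} \<union> ({..0} - {0}))"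
    by (rule summable_on_Un_disjoint[OF 1 summable_on_subset_banach[OF 2]]) auto
  moreover have "{0..} \<union> ({..0} - {0::int}) = UNIV" by auto
  ultimately have h: "?h summable_on UNIV" by (simp add: summable_on_cmult_right)
  show ?thesis
  proof (rule summable_on_comparison_test[OF h])
    fix k :: int
    let ?t = "\<bar>real_of_int k - a\<bar>"
    have "(?t - 1/2)\<^sup>2 = (real_of_int k - a)\<^sup>2 - ?t + 1/4"
      by (subst power2_diff) (simp add: power2_eq_square[of "1/2"])
    then have "(real_of_int k - a)\<^sup>2 \<ge> ?t - 1"
      using zero_le_power2[of "?t - 1/2"] by linarith
    moreover have "?t \<ge> \<bar>real_of_int k\<bar> - \<bar>a\<bar>" by linarith
    ultimately have "(real_of_int k - a)\<^sup>2 \<ge> \<bar>real_of_int k\<bar> - \<bar>a\<bar> - 1" by linarith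
    then have "c * (real_of_int k - a)\<^sup>2 \<ge> c * (\<bar>real_of_int k\<bar> - \<bar>a\<bar> - 1)"
      using assms by (intro mult_left_mono) auto
    then have "exp (- c * (real_of_int k - a)\<^sup>2) \<le> exp (c * (\<bar>a\<bar> + 1) + real (nat \<bar>k\<bar>) * (- c))"
      by (simp add: algebra_simps)
    then show "exp (- c * (real_of_int k - a)\<^sup>2) \<le> ?h k"
      by (simp only: exp_add exp_of_nat_mult)
  qed simp
qed

lemma pmf_IG:
  assumes "\<beta> > 0"
  shows "pmf (IG a \<beta>) k = exp (- (\<beta> / 2) * (real_of_int k - a)\<^sup>2) /
           (\<Sum>\<^sub>\<infinity>j. exp (- (\<beta> / 2) * (real_of_int j - a)\<^sup>2))"
  unfolding IG_def using summable_gaussian[of "\<beta> / 2" a] assms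
  by (intro pmf_normalized_pmf) auto

lemma summable_on_product_functions:
  fixes w :: "int \<Rightarrow> real"
  assumes "finite A" "w summable_on UNIV" "\<And>k. w k \<ge> 0"
  shows "(\<lambda>q. \<Prod>a\<in>A. w (q a)) summable_on {q. \<forall>a. a \<notin> A \<longrightarrow> q a = 0}"
  using assms(1)
proof (induction A rule: finite_induct)
  case empty
  have "{q :: 'a \<Rightarrow> int. \<forall>a. q a = 0} = {\<lambda>_. 0}" by auto
  then show ?case by simp
next
  case (insert x A)
  let ?S = "{q. \<forall>a. a \<notin> A \<longrightarrow> q a = 0}" and ?p = "\<lambda>q. \<Prod>a\<in>A. w (q a)"
  have "(\<lambda>(k, q). w k * ?p q) summable_on UNIV \<times> ?S"
  proof (rule summable_on_SigmaI)
    show "((\<lambda>q. case (k, q) of (k, q) \<Rightarrow> w k * ?p q) has_sum w k * infsum ?p ?S) ?S" for k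
      using insert.IH by (auto intro!: has_sum_cmult_right)
    show "(\<lambda>k. w k * infsum ?p ?S) summable_on UNIV"
      using assms(2) by (rule summable_on_cmult_left)
  qed (auto intro!: mult_nonneg_nonneg prod_nonneg assms)
  moreover have "(\<lambda>q. \<Prod>a\<in>insert x A. w (q a)) summable_on {q. \<forall>a. a \<notin> insert x A \<longrightarrow> q a = 0} \<longleftrightarrow>
      (\<lambda>(k, q). w k * ?p q) summable_on UNIV \<times> ?S"
    using insert.hyps
    by (intro summable_on_reindex_bij_witness[of _ "\<lambda>(k, q). q(x := k)" "\<lambda>q. (q x, q(x := 0))"])
       (auto simp: fun_eq_iff intro!: prod.cong)
  ultimately show ?case by simp
qed

lemma inv_neg_laplacian_works:
  assumes m: "marked_face bc \<in> faces bc n"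
  shows "inv_neg_laplacian bc n g \<in> two_forms bc n"
    "- laplacian bc n (inv_neg_laplacian bc n g) f = to_form bc n g f"
proof -
  have minus: "(\<lambda>f. - u f) \<in> two_forms bc n" if "u \<in> two_forms bc n" for u :: "face \<Rightarrow> real"
    using that by (simp add: two_forms_def)
  have neg: "bij_betw (\<lambda>u f. - u f) (two_forms bc n) (two_forms bc n :: (face \<Rightarrow> real) set)"
    by (rule bij_betw_byWitness[where f' = "\<lambda>u f. - u f"]) (use minus in \<open>simp_all add: image_subset_iff\<close>)
  have b: "bij_betw (\<lambda>u f. - laplacian bc n u f) (two_forms bc n) (two_forms bc n)"
    using bij_betw_trans[OF laplacian_bij[OF m] neg] unfolding comp_def .
  have g: "to_form bc n g \<in> two_forms bc n" by (simp add: two_forms_def to_form_def)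
  have the_inv: "(\<lambda>f. - laplacian bc n (the_inv_into (two_forms bc n) (\<lambda>u f. - laplacian bc n u f) (to_form bc n g)) f) =
      to_form bc n g"
    using f_the_inv_into_f_bij_betw[OF b, of "to_form bc n g"] g by blast
  show "inv_neg_laplacian bc n g \<in> two_forms bc n"
    unfolding inv_neg_laplacian_def
    using bij_betw_apply[OF bij_betw_the_inv_into[OF b] g] .
  show "- laplacian bc n (inv_neg_laplacian bc n g) f = to_form bc n g f"
    unfolding inv_neg_laplacian_def
    using fun_cong[OF the_inv] .
qed

lemma green_form_ge:
  assumes m: "marked_face bc \<in> faces bc n" and h: "h \<in> two_forms bc n"
  shows "(h f)\<^sup>2 \<le> 4 * real (card (edges bc n)) * green_form bc n h"
proof -
  let ?u = "inv_neg_laplacian bc n h" and ?E = "edges bc n"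
  let ?d = "\<lambda>e. ?u (left_face bc n e) - ?u (right_face bc n e)"
  have th: "to_form bc n h = h" by (rule ext) (use h in \<open>auto simp: to_form_def two_forms_def\<close>)
  have "green_form bc n h = form_inner bc n ?u (\<lambda>f. - laplacian bc n ?u f)"
    using inv_neg_laplacian_works(2)[OF m, of h]
    by (simp add: green_form_def form_inner_def mult.commute)
  then have G: "green_form bc n h = (\<Sum>e\<in>?E. (?d e)\<^sup>2)"
    by (simp add: laplacian_form[OF inv_neg_laplacian_works(1)[OF m]] power2_eq_square)
  have S: "\<bar>\<Sum>e | e \<in> ?E \<and> P e. k e\<bar> \<le> (\<Sum>e\<in>?E. \<bar>?d e\<bar>)" if "\<And>e. P e \<Longrightarrow> \<bar>k e\<bar> \<le> \<bar>?d e\<bar>" for P k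
    using that finite_edges
    by (intro order.trans[OF sum_abs] order.trans[OF sum_mono sum_mono2]) auto
  have "\<bar>h f\<bar> = \<bar>laplacian bc n ?u f\<bar>"
    using inv_neg_laplacian_works(2)[OF m, of h f] th by auto
  also have "\<dots> \<le> (\<Sum>e\<in>?E. \<bar>?d e\<bar>) + (\<Sum>e\<in>?E. \<bar>?d e\<bar>)"
  proof -
    have "\<bar>\<Sum>e | e \<in> ?E \<and> left_face bc n e = f. ?u (right_face bc n e) - ?u f\<bar> \<le> (\<Sum>e\<in>?E. \<bar>?d e\<bar>)"
      by (rule S) auto
    moreover have "\<bar>\<Sum>e | e \<in> ?E \<and> right_face bc n e = f. ?u (left_face bc n e) - ?u f\<bar> \<le> (\<Sum>e\<in>?E. \<bar>?d e\<bar>)"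
      by (rule S) auto
    ultimately show ?thesis unfolding laplacian_def to_form_def by (auto split: if_split)
  qed
  finally have "(h f)\<^sup>2 \<le> (2 * (\<Sum>e\<in>?E. \<bar>?d e\<bar>))\<^sup>2"
    by (intro power2_le_iff_abs_le[THEN iffD2]) (auto intro!: sum_nonneg)
  also have "\<dots> = 4 * (\<Sum>e\<in>?E. \<bar>?d e\<bar> * 1)\<^sup>2" by (simp add: power_mult_distrib)
  also have "\<dots> \<le> 4 * ((\<Sum>e\<in>?E. \<bar>?d e\<bar>\<^sup>2) * (\<Sum>e\<in>?E. 1\<^sup>2))"
    by (intro mult_left_mono Cauchy_Schwarz_ineq_sum) auto
  finally show ?thesis by (simp add: G algebra_simps)
qed

lemma summable_coulomb_weight:
  assumes m: "marked_face bc \<in> faces bc n" and "\<beta> > 0"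
  shows "coulomb_weight bc n \<beta> summable_on UNIV"
proof -
  let ?F = "faces bc n"
  let ?C = "4 * real (card (edges bc n)) * real (card ?F) + 1"
  let ?b = "(2 * pi)\<^sup>2 * \<beta> / 2"
  let ?w = "\<lambda>k::int. exp (- (?b / ?C) * (real_of_int k - 0)\<^sup>2)"
  have C: "?C > 0" by (intro add_nonneg_pos) auto
  have b: "?b > 0" using assms by simp
  have "(\<lambda>q. \<Prod>f\<in>?F. ?w (q f)) summable_on {q. \<forall>f. f \<notin> ?F \<longrightarrow> q f = 0}"
    using C b by (intro summable_on_product_functions summable_gaussian finite_faces divide_pos_pos) auto
  then have "(\<lambda>q. \<Prod>f\<in>?F. ?w (q f)) summable_on (two_forms bc n)"
    by (rule summable_on_subset_banach) (auto simp: two_forms_def)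
  then have "coulomb_weight bc n \<beta> summable_on (two_forms bc n)"
  proof (rule summable_on_comparison_test)
    fix q :: "face \<Rightarrow> int" assume q: "q \<in> two_forms bc n"
    let ?q = "\<lambda>f. real_of_int (q f)"
    let ?G = "green_form bc n ?q"
    have q': "?q \<in> two_forms bc n" using q by (simp add: two_forms_def)
    have "(\<Sum>f\<in>?F. (?q f)\<^sup>2) \<le> (\<Sum>f\<in>?F. 4 * real (card (edges bc n)) * ?G)"
      by (intro sum_mono green_form_ge m q')
    moreover have "?G \<ge> 0"
      using laplacian_form[OF inv_neg_laplacian_works(1)[OF m], of "?q" "inv_neg_laplacian bc n ?q"]
        inv_neg_laplacian_works(2)[OF m, of "?q"]
      by (simp add: green_form_def form_inner_def mult.commute sum_nonneg)
    ultimately have "(\<Sum>f\<in>?F. (?q f)\<^sup>2) \<le> ?C * ?G" by (simp add: algebra_simps)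
    then have "(\<Sum>f\<in>?F. (?q f)\<^sup>2) / ?C \<le> ?G" using C by (simp add: divide_le_eq mult.commute)
    then have "?b * ((\<Sum>f\<in>?F. (?q f)\<^sup>2) / ?C) \<le> ?b * ?G" using b by (intro mult_left_mono) auto
    moreover have "(\<Prod>f\<in>?F. ?w (q f)) = exp (- (?b * ((\<Sum>f\<in>?F. (?q f)\<^sup>2) / ?C)))"
      by (simp add: exp_sum[OF finite_faces, symmetric] sum_negf sum_distrib_left sum_divide_distrib)
    ultimately show "coulomb_weight bc n \<beta> q \<le> (\<Prod>f\<in>?F. ?w (q f))"
      using q by (simp add: coulomb_weight_def)
  qed (simp add: coulomb_weight_def)
  then show ?thesis
    by (rule summable_on_cong_neutral[THEN iffD1, rotated -1]) (auto simp: coulomb_weight_def)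
qed

lemma pmf_coulomb:
  assumes m: "marked_face bc \<in> faces bc n" and "\<beta> > 0"
  shows "pmf (coulomb bc n \<beta>) q = coulomb_weight bc n \<beta> q / (\<Sum>\<^sub>\<infinity>p. coulomb_weight bc n \<beta> p)"
  unfolding coulomb_def
  using summable_coulomb_weight[OF assms]
  by (intro pmf_normalized_pmf[where z = "\<lambda>_. 0"]) (auto simp: coulomb_weight_def two_forms_def)

end

theory Submission
  imports Defs "HOL-Real_Asymp.Real_Asymp"
begin

text \<open>
  Write a Gaussian free field on the vertices plus an independent Coulomb gas as the Villain model:
  angles \<open>\<theta>\<close> on the vertices and an integer 1-form \<open>m\<close> with weight
  $\prod_e \exp(-\frac b2 (d\theta(e) + m(e))^2)$, where $b = (2\pi)^2\beta$ and angles are measured in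
  turns. The charge (the curl) of \<open>m\<close> is a Coulomb gas, and given \<open>\<theta>\<close> the values of \<open>m\<close> are
  independent integer-valued Gaussians with means determined by \<open>d\<theta>\<close>. Since
  $\langle\Delta^{-1}q, g\rangle$ is linear in \<open>m\<close>, its variance is at least the expectation of its
  conditional variance, which is the sum over the edges of $(\nabla\Delta^{-1}g(e))^2$ times the expected
  variance of the integer-valued Gaussian at \<open>e\<close>. Bounding the latter by its infimum gives the first
  claim.

  For the second claim the fractional part of $d\theta(e)$ is within $1/b$ of $1/2$ with probability at
  least $e^{-\pi^2\beta - o(\beta)}$: one shifts the field by at most half a turn along a test function
  \<open>h\<close> with $dh(e) = 1$, which costs $e^{-b\,|dh|^2/8}$, and $|dh|^2$ can be brought arbitrarily close to
  2, the inverse of the effective resistance of an edge of $\mathbf Z^2$, by Foster's averaging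
  argument on a box. With Dirichlet conditions this needs edges away from the boundary; by
  monotonicity of the energy in the box, the energy near the boundary vanishes as the box grows.
\<close>

section \<open>Integer-valued Gaussians and Lebesgue measure on a product\<close>

text \<open>Field and gas decouple by unfolding: the angles live in a unit cube, and summing over
  integer gradients tiles the whole space by translates of that cube. A residue remains: in the
  sector of charge \<open>q\<close> the field is displaced by the real potential
  \<open>\<alpha> q\<close>. Hence the expected variance at an edge must be bounded below uniformly
  in an offset \<open>t\<close>, and for the worst offsets the mean is typically near an integer,
  where the integer-valued Gaussian is almost frozen. The gradient at an edge of effective
  resistance R has variance R/b, so moving it by 1/2 costs exp(-b/(8R)); R near 1/2 and b = (2 pi)^2
  beta give exp(-pi^2 beta). In place of \<open>Var_IG\<close> a measurable 1-periodic minorant is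
  integrated: a constant for the first claim, a bump near the half-integers for the second.
  Integrals are left unnormalised in the extended nonnegative reals, so that only positivity and
  finiteness of the total Gaussian mass are needed. The correction \<open>r\<close> is independent
  of \<open>g\<close> because the approximation of the resistance is tuned to \<open>\<beta>\<close>
  alone and the concentration of the energy loses only a factor 1/2.\<close>

lemma infsum_gaussian_pos:
  fixes a b :: real
  assumes "b > 0"
  shows "(\<Sum>\<^sub>\<infinity>j::int. exp (- (b / 2) * (real_of_int j - a)\<^sup>2)) > 0"
proof -
  let ?w = "\<lambda>j::int. exp (- (b / 2) * (real_of_int j - a)\<^sup>2)"
  have sm: "?w summable_on UNIV"
    using summable_gaussian[of "b / 2" a] assms by simp
  have "0 < ?w 0" by simp
  also have "\<dots> = (\<Sum>\<^sub>\<infinity>j\<in>{0}. ?w j)" by simp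
  also have "\<dots> \<le> (\<Sum>\<^sub>\<infinity>j. ?w j)"
    by (rule infsum_mono_neutral) (use sm in auto)
  finally show ?thesis .
qed

lemma integrable_measure_pmf_if_summable:
  fixes f :: "'a \<Rightarrow> real"
  assumes "(\<lambda>x. pmf p x * \<bar>f x\<bar>) summable_on UNIV"
  shows "integrable (measure_pmf p) f"
proof -
  have "Infinite_Sum.abs_summable_on (\<lambda>x. pmf p x *\<^sub>R f x) UNIV"
    using assms by (simp add: abs_mult)
  then have "Infinite_Set_Sum.abs_summable_on (\<lambda>x. pmf p x *\<^sub>R f x) UNIV"
    using abs_summable_equivalent by blast
  then have "integrable (density (count_space UNIV) (\<lambda>x. ennreal (pmf p x))) f"
    unfolding Infinite_Set_Sum.abs_summable_on_def
    by (subst integrable_density) auto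
  then show ?thesis by (simp flip: measure_pmf_eq_density)
qed

lemma le_two_exp_half: "x \<le> 2 * exp (x / 2)" for x :: real
  using exp_ge_add_one_self[of "x / 2"] by linarith

lemma integrable_square_IG:
  assumes b: "b > 0"
  shows "integrable (measure_pmf (IG a b)) (\<lambda>k. (real_of_int k)\<^sup>2)"
proof -
  let ?Z = "\<Sum>\<^sub>\<infinity>j::int. exp (- (b / 2) * (real_of_int j - a)\<^sup>2)"
  have Z: "?Z > 0" using b by (rule infsum_gaussian_pos)
  \<comment> \<open>Half of the Gaussian exponent pays for the square, by
    \<open>le_two_exp_half\<close>.\<close>
  let ?h = "\<lambda>k::int. (8 / b + 2 * a\<^sup>2) / ?Z * exp (- (b / 4) * (real_of_int k - a)\<^sup>2)"
  have "?h summable_on UNIV"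
    using summable_gaussian[of "b / 4" a] b by (intro summable_on_cmult_right) simp
  then have "(\<lambda>k. pmf (IG a b) k * \<bar>(real_of_int k)\<^sup>2\<bar>) summable_on UNIV"
  proof (rule summable_on_comparison_test)
    fix k :: int
    define y where "y = (real_of_int k - a)\<^sup>2"
    have y0: "y \<ge> 0" by (simp add: y_def)
    have k: "(real_of_int k)\<^sup>2 \<le> 2 * y + 2 * a\<^sup>2"
      using zero_le_power2[of "real_of_int k - 2 * a"]
      by (simp add: y_def power2_eq_square algebra_simps)
    have "b / 2 * y \<le> 2 * exp (b / 4 * y)"
      using le_two_exp_half[of "b / 2 * y"] by simp
    then have y: "2 * y \<le> 8 / b * exp (b / 4 * y)" using b by (simp add: field_simps)
    have "1 \<le> exp (b / 4 * y)" using b y0 by simp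
    then have "2 * a\<^sup>2 \<le> 2 * a\<^sup>2 * exp (b / 4 * y)"
      by (intro mult_le_cancel_left1[THEN iffD2]) auto
    with k y have "(real_of_int k)\<^sup>2 \<le> (8 / b + 2 * a\<^sup>2) * exp (b / 4 * y)"
      by (simp add: algebra_simps)
    then have "exp (- (b / 2) * y) * (real_of_int k)\<^sup>2 \<le>
        exp (- (b / 2) * y) * ((8 / b + 2 * a\<^sup>2) * exp (b / 4 * y))"
      by (intro mult_left_mono) auto
    also have "\<dots> = (8 / b + 2 * a\<^sup>2) * exp (- (b / 4) * y)"
      by (simp flip: exp_add add: field_simps)
    finally show "pmf (IG a b) k * \<bar>(real_of_int k)\<^sup>2\<bar> \<le> ?h k"
      using Z unfolding pmf_IG[OF b] by (simp add: y_def divide_right_mono)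
  qed auto
  then show ?thesis by (rule integrable_measure_pmf_if_summable)
qed

lemma integrable_of_square_pmf:
  fixes X :: "'a \<Rightarrow> real"
  assumes "integrable (measure_pmf p) (\<lambda>x. (X x)\<^sup>2)"
  shows "integrable (measure_pmf p) X"
  using assms by (rule measure_pmf.square_integrable_imp_integrable[rotated]) simp

text \<open>Bias-variance decomposition. The constant \<open>r\<close> carries the variance already
  collected when \<open>nn_integral_square_Pi_pmf\<close> integrates out one coordinate at a
  time.\<close>

lemma nn_integral_square_affine:
  fixes X :: "'a \<Rightarrow> real"
  assumes X: "integrable (measure_pmf p) (\<lambda>x. (X x)\<^sup>2)" and r: "r \<ge> 0"
  shows "(\<integral>\<^sup>+x. ennreal (r + (s * X x - c)\<^sup>2) \<partial>measure_pmf p) =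
    ennreal (r + s\<^sup>2 * measure_pmf.variance p X + (s * measure_pmf.expectation p X - c)\<^sup>2)"
proof -
  note X' = integrable_of_square_pmf[OF X]
  have eq: "(\<lambda>x. r + (s * X x - c)\<^sup>2) = (\<lambda>x. s\<^sup>2 * (X x)\<^sup>2 - (2 * s * c) * X x + (r + c\<^sup>2))"
    by (simp add: power2_eq_square algebra_simps)
  have i: "integrable (measure_pmf p) (\<lambda>x. r + (s * X x - c)\<^sup>2)"
    unfolding eq using X X' by (intro Bochner_Integration.integrable_add
        Bochner_Integration.integrable_diff integrable_mult_right) auto
  have "(\<integral>\<^sup>+x. ennreal (r + (s * X x - c)\<^sup>2) \<partial>measure_pmf p) =
      ennreal (measure_pmf.expectation p (\<lambda>x. r + (s * X x - c)\<^sup>2))"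
    using r by (intro nn_integral_eq_integral i) auto
  also have "measure_pmf.expectation p (\<lambda>x. r + (s * X x - c)\<^sup>2) =
      s\<^sup>2 * measure_pmf.expectation p (\<lambda>x. (X x)\<^sup>2) - (2 * s * c) * measure_pmf.expectation p X + (r + c\<^sup>2)"
    unfolding eq using X X' by (simp add: measure_pmf.prob_space)
  also have "\<dots> = r + s\<^sup>2 * measure_pmf.variance p X + (s * measure_pmf.expectation p X - c)\<^sup>2"
    unfolding measure_pmf.variance_eq[OF X' X] by (simp add: power2_eq_square algebra_simps)
  finally show ?thesis .
qed

text \<open>Independence makes the variances add. The offset \<open>t\<close> is generalised in the
  induction because fixing one coordinate moves its contribution into the offset.\<close>

lemma nn_integral_square_Pi_pmf:
  fixes p :: "'e \<Rightarrow> int pmf" and c :: "'e \<Rightarrow> real"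
  assumes "finite A" and X: "\<And>e. e \<in> A \<Longrightarrow> integrable (measure_pmf (p e)) (\<lambda>k. (real_of_int k)\<^sup>2)"
  shows "(\<integral>\<^sup>+m. ennreal (((\<Sum>e\<in>A. c e * real_of_int (m e)) - t)\<^sup>2) \<partial>measure_pmf (Pi_pmf A 0 p)) =
    ennreal ((\<Sum>e\<in>A. (c e)\<^sup>2 * measure_pmf.variance (p e) real_of_int) +
       ((\<Sum>e\<in>A. c e * measure_pmf.expectation (p e) real_of_int) - t)\<^sup>2)"
  using assms
proof (induction A arbitrary: t rule: finite_induct)
  case empty
  show ?case by simp
next
  case (insert x A)
  let ?S = "\<Sum>e\<in>A. (c e)\<^sup>2 * measure_pmf.variance (p e) real_of_int"
  let ?E = "\<Sum>e\<in>A. c e * measure_pmf.expectation (p e) real_of_int"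
  have S: "?S \<ge> 0" by (intro sum_nonneg mult_nonneg_nonneg measure_pmf.variance_positive) auto
  have s: "(\<Sum>e\<in>A. c e * real_of_int ((m(x := k)) e)) = (\<Sum>e\<in>A. c e * real_of_int (m e))" for m k
    using insert.hyps by (intro sum.cong) auto
  have t: "c x * real_of_int ((m(x := k)) x) + y - t = y - (t - c x * real_of_int k)" for m k y
    by simp
  have t': "?E - (t - y) = y - (t - ?E)" for y by simp
  have "(\<integral>\<^sup>+m. ennreal (((\<Sum>e\<in>insert x A. c e * real_of_int (m e)) - t)\<^sup>2) \<partial>measure_pmf (Pi_pmf (insert x A) 0 p)) =
     (\<integral>\<^sup>+k. \<integral>\<^sup>+m. ennreal (((\<Sum>e\<in>A. c e * real_of_int (m e)) - (t - c x * real_of_int k))\<^sup>2)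
        \<partial>measure_pmf (Pi_pmf A 0 p) \<partial>measure_pmf (p x))"
    using insert.hyps
    by (simp add: Pi_pmf_insert nn_integral_pair_pmf' case_prod_unfold s t del: fun_upd_apply)
  also have "\<dots> = (\<integral>\<^sup>+k. ennreal (?S + (c x * real_of_int k - (t - ?E))\<^sup>2) \<partial>measure_pmf (p x))"
    using insert.IH insert.prems by (intro nn_integral_cong) (simp add: t')
  also have "\<dots> = ennreal (?S + (c x)\<^sup>2 * measure_pmf.variance (p x) real_of_int +
      (c x * measure_pmf.expectation (p x) real_of_int - (t - ?E))\<^sup>2)"
    using insert.prems S by (intro nn_integral_square_affine) auto
  finally show ?case using insert.hyps by (simp add: add_ac diff_diff_eq2)
qed

lemma IG_affine:
  assumes b: "b > 0" and s: "s = 1 \<or> s = (- 1 :: int)"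
  shows "IG (real_of_int s * a + real_of_int t) b = map_pmf (\<lambda>k. s * k + t) (IG a b)"
proof (rule pmf_eqI)
  fix i
  let ?f = "\<lambda>k. s * k + t" and ?w = "\<lambda>a (k::int). exp (- (b / 2) * (real_of_int k - a)\<^sup>2)"
  have ss: "s * (s * x) = x" for x using s by auto
  have inj: "inj ?f" using s by (auto simp: inj_def)
  have bij: "bij ?f"
    by (rule bij_betw_byWitness[where f' = "\<lambda>k. s * (k - t)"])
       (simp_all add: ss)
  have w: "?w (real_of_int s * a + real_of_int t) (?f k) = ?w a k" for k
    using s by (auto simp: power2_eq_square algebra_simps)
  have Z: "(\<Sum>\<^sub>\<infinity>k. ?w (real_of_int s * a + real_of_int t) k) = (\<Sum>\<^sub>\<infinity>k. ?w a k)"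
    using infsum_reindex_bij_betw[OF bij, of "?w (real_of_int s * a + real_of_int t)"] unfolding w by simp
  obtain k where k: "i = ?f k" using bij_is_surj[OF bij] unfolding surj_def by blast
  show "pmf (IG (real_of_int s * a + real_of_int t) b) i = pmf (map_pmf ?f (IG a b)) i"
    unfolding k by (simp only: pmf_map_inj'[OF inj] pmf_IG[OF b] w Z)
qed

lemma Var_IG_affine:
  assumes b: "b > 0" and s: "s = 1 \<or> s = (- 1 :: int)"
  shows "Var_IG (real_of_int s * a + real_of_int t) b = Var_IG a b"
proof -
  note i = integrable_of_square_pmf[OF integrable_square_IG[OF b, of a]]
  have e: "measure_pmf.expectation (IG a b) (\<lambda>k. real_of_int (s * k + t)) =
     real_of_int s * measure_pmf.expectation (IG a b) real_of_int + real_of_int t"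
    using i by (simp add: measure_pmf.prob_space)
  have "real_of_int (s * k + t) - (real_of_int s * m + real_of_int t) = real_of_int s * (real_of_int k - m)" for k m
    by (simp add: algebra_simps)
  moreover have "(real_of_int s)\<^sup>2 = 1" using s by auto
  ultimately show ?thesis
    unfolding Var_IG_def IG_affine[OF assms] integral_map_pmf e
    by (simp add: power_mult_distrib del: of_int_add of_int_mult)
qed

lemma Var_IG_nonneg: "Var_IG a b \<ge> 0"
  unfolding Var_IG_def by (rule measure_pmf.variance_positive)

text \<open>\<open>Var_IG\<close> is even and 1-periodic in the mean, so rounding \<open>x\<close>
  and reflecting if necessary lands in [0, 1/2]: the infimum in \<open>M\<close> is an infimum over
  all real means.\<close>

lemma Var_IG_ge_INF:
  assumes b: "b > 0"
  shows "(INF a\<in>{0..1/2}. Var_IG a b) \<le> Var_IG x b"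
proof -
  define k where "k = round x"
  define s :: int where "s = (if x - real_of_int k \<ge> 0 then 1 else - 1)"
  have "\<bar>x - real_of_int k\<bar> \<le> 1/2"
    unfolding k_def using of_int_round_abs_le[of x] by (simp add: abs_minus_commute)
  then have "real_of_int s * x + real_of_int (- s * k) \<in> {0..1/2}"
    by (auto simp: s_def abs_if split: if_splits)
  then have "(INF a\<in>{0..1/2}. Var_IG a b) \<le> Var_IG (real_of_int s * x + real_of_int (- s * k)) b"
    by (intro cINF_lower bdd_belowI[of _ 0]) (auto simp: Var_IG_nonneg)
  then show ?thesis by (subst (asm) Var_IG_affine[OF b]) (auto simp: s_def)
qed

section \<open>Translation invariance on a product and sums over integer 1-forms\<close>

lemma distr_PiM_lborel_translate:
  assumes "finite V"
  shows "distr (Pi\<^sub>M V (\<lambda>_. lborel)) (Pi\<^sub>M V (\<lambda>_. lborel)) (\<lambda>x. \<lambda>v\<in>V. x v + t v) =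
    Pi\<^sub>M V (\<lambda>_. lborel :: real measure)"
proof -
  interpret product_sigma_finite "\<lambda>_::'a. lborel :: real measure" ..
  show ?thesis
  proof (rule PiM_eqI[OF assms])
    fix A :: "'a \<Rightarrow> real set" assume A: "\<And>i. i \<in> V \<Longrightarrow> A i \<in> sets lborel"
    let ?B = "\<lambda>i. (+) (t i) -` A i"
    have B: "?B i \<in> sets lborel" if "i \<in> V" for i
      using measurable_sets_borel[of "(+) (t i)" borel "A i"] A[OF that] by simp
    have e: "emeasure lborel (?B i) = emeasure lborel (A i)" if "i \<in> V" for i
    proof -
      have "emeasure lborel (A i) = emeasure (distr lborel borel ((+) (t i))) (A i)"
        by (simp add: lborel_distr_plus)
      also have "\<dots> = emeasure lborel (?B i)"
        using A[OF that] by (subst emeasure_distr) auto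
      finally show ?thesis by simp
    qed
    have "emeasure (distr (Pi\<^sub>M V (\<lambda>_. lborel)) (Pi\<^sub>M V (\<lambda>_. lborel)) (\<lambda>x. \<lambda>v\<in>V. x v + t v)) (Pi\<^sub>E V A) =
       emeasure (Pi\<^sub>M V (\<lambda>_. lborel)) (Pi\<^sub>E V ?B)"
      using A assms by (subst emeasure_distr)
        (auto simp: space_PiM PiE_iff add.commute intro!: arg_cong[where f = "emeasure _"] sets_PiM_I_finite)
    also have "\<dots> = (\<Prod>i\<in>V. emeasure lborel (A i))"
      using B assms e by (subst emeasure_PiM) auto
    finally show "emeasure (distr (Pi\<^sub>M V (\<lambda>_. lborel)) (Pi\<^sub>M V (\<lambda>_. lborel)) (\<lambda>x. \<lambda>v\<in>V. x v + t v)) (Pi\<^sub>E V A) =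
       (\<Prod>i\<in>V. emeasure lborel (A i))" .
  qed simp
qed

lemma nn_integral_PiM_lborel_translate:
  fixes f :: "('v \<Rightarrow> real) \<Rightarrow> ennreal"
  assumes "finite V" and [measurable]: "f \<in> borel_measurable (Pi\<^sub>M V (\<lambda>_. lborel))"
  shows "(\<integral>\<^sup>+x. f (\<lambda>v\<in>V. x v + t v) \<partial>Pi\<^sub>M V (\<lambda>_. lborel)) = (\<integral>\<^sup>+x. f x \<partial>Pi\<^sub>M V (\<lambda>_. lborel))"
  by (subst (2) distr_PiM_lborel_translate[OF assms(1), of t, symmetric], subst nn_integral_distr)
     simp_all

text \<open>Given the angles, the coordinates of the integer form are independent: the weight splits
  over the edges into partition functions times \<open>IG\<close> probabilities.\<close>

lemma nn_integral_gaussian_product: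
  fixes a :: "'e \<Rightarrow> real" and H :: "('e \<Rightarrow> int) \<Rightarrow> ennreal"
  assumes E: "finite E" and b: "b > 0"
  defines "Z \<equiv> \<lambda>a. \<Sum>\<^sub>\<infinity>j::int. exp (- (b / 2) * (real_of_int j - a)\<^sup>2)"
  shows "(\<integral>\<^sup>+m. ennreal (exp (- (b / 2) * (\<Sum>e\<in>E. (real_of_int (m e) - a e)\<^sup>2))) * H m
            \<partial>count_space {m. \<forall>e. e \<notin> E \<longrightarrow> m e = 0}) =
    ennreal (\<Prod>e\<in>E. Z (a e)) * (\<integral>\<^sup>+m. H m \<partial>measure_pmf (Pi_pmf E 0 (\<lambda>e. IG (a e) b)))"
proof -
  let ?P = "Pi_pmf E 0 (\<lambda>e. IG (a e) b)" and ?S = "{m. \<forall>e. e \<notin> E \<longrightarrow> m e = (0::int)}"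
  have Z: "Z a > 0" for a unfolding Z_def using b by (rule infsum_gaussian_pos)
  have P: "0 < (\<Prod>e\<in>E. Z (a e))" using Z by (intro prod_pos) auto
  have w: "ennreal (exp (- (b / 2) * (\<Sum>e\<in>E. (real_of_int (m e) - a e)\<^sup>2))) =
      ennreal (\<Prod>e\<in>E. Z (a e)) * ennreal (pmf ?P m)" if m: "m \<in> ?S" for m
  proof -
    have "pmf ?P m = (\<Prod>e\<in>E. exp (- (b / 2) * (real_of_int (m e) - a e)\<^sup>2)) / (\<Prod>e\<in>E. Z (a e))"
      using m by (subst pmf_Pi') (auto simp: E pmf_IG[OF b] Z_def prod_dividef)
    then have "exp (- (b / 2) * (\<Sum>e\<in>E. (real_of_int (m e) - a e)\<^sup>2)) = (\<Prod>e\<in>E. Z (a e)) * pmf ?P m"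
      using P by (simp add: exp_sum[OF E] sum_distrib_left sum_negf flip: sum_negf)
    then show ?thesis using P by (simp add: ennreal_mult)
  qed
  have "(\<integral>\<^sup>+m. ennreal (exp (- (b / 2) * (\<Sum>e\<in>E. (real_of_int (m e) - a e)\<^sup>2))) * H m \<partial>count_space ?S) =
      (\<integral>\<^sup>+m. ennreal (\<Prod>e\<in>E. Z (a e)) * (ennreal (pmf ?P m) * H m) \<partial>count_space ?S)"
    by (intro nn_integral_cong) (simp only: w space_count_space mult.assoc)
  also have "\<dots> = ennreal (\<Prod>e\<in>E. Z (a e)) * (\<integral>\<^sup>+m. ennreal (pmf ?P m) * H m \<partial>count_space ?S)"
    by (rule nn_integral_cmult) simp
  also have "(\<integral>\<^sup>+m. ennreal (pmf ?P m) * H m \<partial>count_space ?S) =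
      (\<integral>\<^sup>+m. ennreal (pmf ?P m) * H m \<partial>count_space UNIV)"
    using E by (intro nn_integral_count_space_eq) (auto simp: pmf_Pi_outside)
  also have "\<dots> = (\<integral>\<^sup>+m. H m \<partial>measure_pmf ?P)"
    by (simp add: nn_integral_measure_pmf)
  finally show ?thesis .
qed

text \<open>Moving the summation index by the floor of \<open>a\<close> reduces to an offset in [0,
  1), which half of the exponent absorbs. Uniformity in \<open>a\<close> is what
  \<open>gauss_one_finite\<close> needs.\<close>

lemma infsum_gaussian_le:
  fixes b :: real
  assumes b: "b > 0"
  shows "\<exists>C. \<forall>a. (\<Sum>\<^sub>\<infinity>j::int. exp (- (b / 2) * (real_of_int j - a)\<^sup>2)) \<le> C"
proof (intro exI allI)
  fix a :: real
  let ?w = "\<lambda>a (j::int). exp (- (b / 2) * (real_of_int j - a)\<^sup>2)"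
  have bij: "bij (\<lambda>j::int. j + \<lfloor>a\<rfloor>)"
    by (rule bij_betw_byWitness[where f' = "\<lambda>k. k - \<lfloor>a\<rfloor>"]) auto
  have "(\<Sum>\<^sub>\<infinity>j. ?w a j) = (\<Sum>\<^sub>\<infinity>j. ?w a (j + \<lfloor>a\<rfloor>))"
    by (rule infsum_reindex_bij_betw[OF bij, symmetric])
  also have "\<dots> = (\<Sum>\<^sub>\<infinity>j. ?w (frac a) j)"
    by (simp add: frac_def algebra_simps)
  also have "\<dots> \<le> (\<Sum>\<^sub>\<infinity>j::int. exp (b / 2) * exp (- (b / 4) * (real_of_int j - 0)\<^sup>2))"
  proof (rule infsum_mono)
    show "?w (frac a) summable_on UNIV"
      using summable_gaussian[of "b / 2" "frac a"] b by simp
    show "(\<lambda>j::int. exp (b / 2) * exp (- (b / 4) * (real_of_int j - 0)\<^sup>2)) summable_on UNIV"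
      using summable_gaussian[of "b / 4" 0] b by (intro summable_on_cmult_right) simp
    fix j :: int
    have "(frac a)\<^sup>2 \<le> 1" using frac_ge_0[of a] frac_lt_1[of a] by (simp add: power_le_one)
    moreover have "(real_of_int j)\<^sup>2 \<le> 2 * (real_of_int j - frac a)\<^sup>2 + 2 * (frac a)\<^sup>2"
      using zero_le_power2[of "real_of_int j - 2 * frac a"] by (simp add: power2_eq_square algebra_simps)
    ultimately have "(real_of_int j)\<^sup>2 - 2 \<le> 2 * (real_of_int j - frac a)\<^sup>2" by linarith
    then have "b / 4 * ((real_of_int j)\<^sup>2 - 2) \<le> b / 4 * (2 * (real_of_int j - frac a)\<^sup>2)"
      using b by (intro mult_left_mono) auto
    then show "?w (frac a) j \<le> exp (b / 2) * exp (- (b / 4) * (real_of_int j - 0)\<^sup>2)"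
      by (simp flip: exp_add add: algebra_simps)
  qed
  finally show "(\<Sum>\<^sub>\<infinity>j. ?w a j) \<le> (\<Sum>\<^sub>\<infinity>j::int. exp (b / 2) * exp (- (b / 4) * (real_of_int j - 0)\<^sup>2))" .
qed

section \<open>Gaussian fields and integer 1-forms\<close>

text \<open>The sum sees only \<open>V\<close>, so vertices outside \<open>V\<close> are grounded.
  The scalar type is generic because both integer and real potentials are differentiated.\<close>

definition grad :: "('e \<Rightarrow> 'v \<Rightarrow> int) \<Rightarrow> 'v set \<Rightarrow> ('v \<Rightarrow> 'a::comm_ring_1) \<Rightarrow> 'e \<Rightarrow> 'a" where
  "grad D V \<phi> e = (\<Sum>v\<in>V. of_int (D e v) * \<phi> v)"

lemma grad_cong: "(\<And>v. v \<in> V \<Longrightarrow> \<phi> v = \<psi> v) \<Longrightarrow> grad D V \<phi> e = grad D V \<psi> e"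
  unfolding grad_def by (intro sum.cong) auto

lemma grad_restrict [simp]: "grad D V (\<lambda>v\<in>V. \<phi> v) e = grad D V \<phi> e"
  by (rule grad_cong) simp

lemma grad_add: "grad D V (\<lambda>v. \<phi> v + \<psi> v) e = grad D V \<phi> e + grad D V \<psi> e"
  by (simp add: grad_def sum.distrib algebra_simps)

lemma grad_mult: "grad D V (\<lambda>v. c * \<phi> v) e = c * grad D V \<phi> e"
  by (simp add: grad_def sum_distrib_left algebra_simps)

lemma grad_uminus: "grad D V (\<lambda>v. - \<phi> v) e = - grad D V \<phi> e"
  by (simp add: grad_def sum_negf)

lemma grad_of_int: "grad D V (\<lambda>v. of_int (k v)) e = of_int (grad D V k e)"
  by (simp add: grad_def)

lemma countable_finite_support:
  assumes "finite A"
  shows "countable {m :: 'a \<Rightarrow> int. \<forall>x. x \<notin> A \<longrightarrow> m x = 0}" (is "countable ?S")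
proof (rule countable_image_inj_on)
  have "countable (Pi\<^sub>E A (\<lambda>_. UNIV :: int set))"
    using assms by (intro countable_PiE) auto
  then show "countable ((\<lambda>m. restrict m A) ` ?S)"
    by (rule countable_subset[rotated]) auto
  show "inj_on (\<lambda>m. restrict m A) ?S"
  proof (rule inj_onI, rule ext)
    fix m m' x assume m: "m \<in> ?S" "m' \<in> ?S" and eq: "restrict m A = restrict m' A"
    show "m x = m' x"
      using m fun_cong[OF eq, of x] by (cases "x \<in> A") auto
  qed
qed

lemma nn_integral_count_space_Times:
  assumes "countable A" "countable B"
  shows "(\<integral>\<^sup>+x. \<integral>\<^sup>+y. f (x, y) \<partial>count_space B \<partial>count_space A) = (\<integral>\<^sup>+z. f z \<partial>count_space (A \<times> B))"
proof -
  interpret sigma_finite_measure "count_space B"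
    using assms(2) by (rule sigma_finite_measure_count_space_countable)
  have eq: "count_space A \<Otimes>\<^sub>M count_space B = count_space (A \<times> B)"
    by (rule pair_measure_countable) (use assms in auto)
  show ?thesis
    using nn_integral_fst[of f "count_space A"] unfolding eq by simp
qed

locale gaussian_field =
  fixes V :: "'v set" and E :: "'e set" and D :: "'e \<Rightarrow> 'v \<Rightarrow> int" and b :: real
  assumes finV: "finite V" and finE: "finite E" and b_pos: "b > 0"
begin

abbreviation "leb \<equiv> Pi\<^sub>M V (\<lambda>_. lborel :: real measure)"

abbreviation "d \<phi> e \<equiv> grad D V \<phi> e"

definition boltzmann :: "('v \<Rightarrow> real) \<Rightarrow> ('e \<Rightarrow> real) \<Rightarrow> ennreal" where
  "boltzmann \<phi> a = ennreal (exp (- (b / 2) * (\<Sum>e\<in>E. (d \<phi> e + a e)\<^sup>2)))"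

text \<open>Unnormalised, and infinite as soon as the gradient has a kernel. Finiteness is obtained
  in \<open>charges\<close>, where the gradient is injective on integer potentials.\<close>

definition gauss :: "(('v \<Rightarrow> real) \<Rightarrow> ennreal) \<Rightarrow> ennreal" where
  "gauss f = (\<integral>\<^sup>+\<phi>. boltzmann \<phi> (\<lambda>_. 0) * f \<phi> \<partial>leb)"

lemma measurable_grad [measurable]: "(\<lambda>\<phi>. d \<phi> e) \<in> borel_measurable leb"
  unfolding grad_def by (intro borel_measurable_sum borel_measurable_times) auto

lemma measurable_boltzmann [measurable]: "(\<lambda>\<phi>. boltzmann \<phi> a) \<in> borel_measurable leb"
  unfolding boltzmann_def by measurable

lemma measurable_translate [measurable]: "(\<lambda>\<phi>. \<lambda>v\<in>V. \<phi> v + t v) \<in> measurable leb leb"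
  by (intro measurable_restrict) simp

lemma gauss_translate:
  assumes [measurable]: "f \<in> borel_measurable leb"
  shows "(\<integral>\<^sup>+\<phi>. boltzmann \<phi> a * f \<phi> \<partial>leb) =
    (\<integral>\<^sup>+\<phi>. boltzmann \<phi> (\<lambda>e. a e + d h e) * f (\<lambda>v\<in>V. \<phi> v + h v) \<partial>leb)"
proof -
  have "boltzmann (\<lambda>v\<in>V. \<phi> v + h v) a = boltzmann \<phi> (\<lambda>e. a e + d h e)" for \<phi>
    by (simp add: boltzmann_def grad_add add_ac)
  then show ?thesis
    using nn_integral_PiM_lborel_translate[OF finV, of "\<lambda>\<phi>. boltzmann \<phi> a * f \<phi>" h] by simp
qed

lemma gauss_mono: "(\<And>\<phi>. f \<phi> \<le> g \<phi>) \<Longrightarrow> gauss f \<le> gauss g"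
  unfolding gauss_def by (intro nn_integral_mono mult_left_mono) auto

lemma gauss_cmult:
  assumes [measurable]: "f \<in> borel_measurable leb"
  shows "gauss (\<lambda>\<phi>. c * f \<phi>) = c * gauss f"
proof -
  have "gauss (\<lambda>\<phi>. c * f \<phi>) = (\<integral>\<^sup>+\<phi>. c * (boltzmann \<phi> (\<lambda>_. 0) * f \<phi>) \<partial>leb)"
    unfolding gauss_def by (simp add: mult.left_commute)
  also have "\<dots> = c * gauss f" unfolding gauss_def by (rule nn_integral_cmult) measurable
  finally show ?thesis .
qed

lemma gauss_add:
  assumes [measurable]: "f \<in> borel_measurable leb" "g \<in> borel_measurable leb"
  shows "gauss (\<lambda>\<phi>. f \<phi> + g \<phi>) = gauss f + gauss g"
  unfolding gauss_def distrib_left by (rule nn_integral_add) measurable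

lemma gauss_sum:
  assumes [measurable]: "\<And>i. i \<in> I \<Longrightarrow> f i \<in> borel_measurable leb"
  shows "gauss (\<lambda>\<phi>. \<Sum>i\<in>I. f i \<phi>) = (\<Sum>i\<in>I. gauss (f i))"
  unfolding gauss_def sum_distrib_left by (rule nn_integral_sum) measurable

text \<open>The density is strictly positive, so a zero integral would force Lebesgue measure to
  vanish, but the unit cube has mass 1.\<close>

lemma gauss_one_pos: "gauss (\<lambda>_. 1) > 0"
proof (rule ccontr)
  assume "\<not> 0 < gauss (\<lambda>_. 1)"
  then have "gauss (\<lambda>_. 1) = 0" by simp
  then have "AE \<phi> in leb. boltzmann \<phi> (\<lambda>_. 0) * 1 = 0"
    unfolding gauss_def by (subst (asm) nn_integral_0_iff_AE) auto
  then have "AE \<phi> in leb. False" by (simp add: boltzmann_def)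
  then have "emeasure leb (space leb) = 0" by (simp add: AE_iff_null null_sets_def)
  moreover interpret product_sigma_finite "\<lambda>_::'v. lborel :: real measure" ..
  have "emeasure leb (Pi\<^sub>E V (\<lambda>_. {0..1})) = 1"
    using finV by (subst emeasure_PiM) auto
  moreover have "emeasure leb (Pi\<^sub>E V (\<lambda>_. {0..1})) \<le> emeasure leb (space leb)"
    using finV by (intro emeasure_mono) (auto simp: space_PiM)
  ultimately show False by simp
qed

end

text \<open>
  Every integer 1-form is uniquely a representative of its charge plus an integer gradient, and the
  representative of \<open>q\<close> differs by the real gradient of \<open>\<alpha> q\<close> from a form \<open>j q\<close>
  orthogonal to all gradients.
\<close>

locale charges = gaussian_field V E D b
  for V :: "'v set" and E :: "'e set" and D :: "'e \<Rightarrow> 'v \<Rightarrow> int" and b :: real +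
  fixes Q :: "'q set" and rep :: "'q \<Rightarrow> 'e \<Rightarrow> int" and \<alpha> :: "'q \<Rightarrow> 'v \<Rightarrow> real" and j :: "'q \<Rightarrow> 'e \<Rightarrow> real"
  assumes bij: "bij_betw (\<lambda>(q, k) e. if e \<in> E then rep q e + grad D V k e else 0)
      (Q \<times> {k. \<forall>v. v \<notin> V \<longrightarrow> k v = 0}) {m. \<forall>e. e \<notin> E \<longrightarrow> m e = 0}"
    and hodge: "\<And>q e. q \<in> Q \<Longrightarrow> e \<in> E \<Longrightarrow> real_of_int (rep q e) = grad D V (\<alpha> q) e + j q e"
    and coclosed: "\<And>q \<phi>. q \<in> Q \<Longrightarrow> (\<Sum>e\<in>E. grad D V \<phi> e * j q e) = 0"
begin

abbreviation "ZV \<equiv> {k :: 'v \<Rightarrow> int. \<forall>v. v \<notin> V \<longrightarrow> k v = 0}"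
abbreviation "ZE \<equiv> {m :: 'e \<Rightarrow> int. \<forall>e. e \<notin> E \<longrightarrow> m e = 0}"

definition "form q k = (\<lambda>e. if e \<in> E then rep q e + grad D V k e else 0)"

text \<open>On the graphs \<open>j q\<close> is the gradient of the potential of \<open>q\<close>,
  so this is the Coulomb weight.\<close>

definition weight :: "'q \<Rightarrow> ennreal" where
  "weight q = ennreal (exp (- (b / 2) * (\<Sum>e\<in>E. (j q e)\<^sup>2)))"

text \<open>A fundamental domain for angles modulo integers, half open so that its integer
  translates tile without overlap.\<close>

definition cube :: "('v \<Rightarrow> real) set" where "cube = Pi\<^sub>E V (\<lambda>_. {0..<1})"

lemma countable_ZV: "countable ZV" using finV by (rule countable_finite_support)

lemma bij_form: "bij_betw (\<lambda>(q, k). form q k) (Q \<times> ZV) ZE"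
  using bij by (simp only: form_def)

lemma countable_Q: "countable Q"
proof -
  have "countable ((\<lambda>(q, k). form q k) ` (Q \<times> ZV))"
    unfolding bij_betw_imp_surj_on[OF bij_form] by (rule countable_finite_support[OF finE])
  then have "countable (Q \<times> ZV)"
    by (rule countable_image_inj_on) (rule bij_betw_imp_inj_on[OF bij_form])
  then have "countable (fst ` (Q \<times> ZV))" by (rule countable_image)
  moreover have "(\<lambda>_. 0) \<in> ZV" by simp
  then have "fst ` (Q \<times> ZV) = Q" by force
  ultimately show ?thesis by simp
qed

lemma Q_nonempty: "Q \<noteq> {}"
proof -
  have "(\<lambda>_. 0) \<in> (\<lambda>(q, k). form q k) ` (Q \<times> ZV)"
    unfolding bij_betw_imp_surj_on[OF bij_form] by simp
  then show ?thesis by blast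
qed

lemma measurable_cube [measurable]: "cube \<in> sets leb"
  unfolding cube_def using finV by (intro sets_PiM_I_finite) auto

lemma emeasure_cube: "emeasure leb cube = 1"
proof -
  interpret product_sigma_finite "\<lambda>_::'v. lborel :: real measure" ..
  show ?thesis unfolding cube_def using finV by (subst emeasure_PiM) auto
qed

lemma sum_cube_translates:
  "(\<integral>\<^sup>+k. indicator cube (\<lambda>v\<in>V. \<phi> v - real_of_int (k v)) \<partial>count_space ZV) = 1"
proof -
  define k0 where "k0 = (\<lambda>v. if v \<in> V then \<lfloor>\<phi> v\<rfloor> else 0)"
  have *: "(\<lambda>v\<in>V. \<phi> v - real_of_int (k v)) \<in> cube \<longleftrightarrow> k = k0" if "k \<in> ZV" for k
  proof
    assume "(\<lambda>v\<in>V. \<phi> v - real_of_int (k v)) \<in> cube"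
    then have fr: "\<phi> v - real_of_int (k v) \<in> {0..<1}" if "v \<in> V" for v
      using PiE_mem[of "\<lambda>v\<in>V. \<phi> v - real_of_int (k v)" V "\<lambda>_. {0..<1}" v] that
      by (simp add: cube_def)
    have "\<lfloor>\<phi> v\<rfloor> = k v" if "v \<in> V" for v
      using fr[OF that] unfolding atLeastLessThan_iff by linarith
    then show "k = k0" using \<open>k \<in> ZV\<close> by (auto simp: k0_def fun_eq_iff)
  next
    assume "k = k0"
    then show "(\<lambda>v\<in>V. \<phi> v - real_of_int (k v)) \<in> cube"
      unfolding cube_def by (intro restrict_PiE_iff[THEN iffD2] ballI) (simp add: k0_def, linarith)
  qed
  have k0: "k0 \<in> ZV" by (auto simp: k0_def)
  have "(\<integral>\<^sup>+k. indicator cube (\<lambda>v\<in>V. \<phi> v - real_of_int (k v)) \<partial>count_space ZV) =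
      (\<integral>\<^sup>+k. indicator {k0} k \<partial>count_space ZV)"
    by (intro nn_integral_cong) (auto simp: * indicator_def)
  also have "\<dots> = 1" using k0 by (subst nn_integral_indicator) auto
  finally show ?thesis .
qed

text \<open>Translating the angles by an integer potential turns \<open>form q k\<close> back into
  \<open>rep q\<close> and leaves the periodic \<open>f\<close> alone, so the sum over
  \<open>k\<close> becomes an integral over the whole space. A further translation by
  \<open>\<alpha> q\<close> replaces \<open>rep q\<close> by \<open>j q\<close>, which is orthogonal
  to gradients, and the weight factors.\<close>

lemma unfold_torus:
  assumes f [measurable]: "f \<in> borel_measurable leb"
    and per: "\<And>\<phi> k. f (\<lambda>v\<in>V. \<phi> v + real_of_int (k v)) = f (\<lambda>v\<in>V. \<phi> v)"
    and q: "q \<in> Q"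
  shows "(\<integral>\<^sup>+k. \<integral>\<^sup>+\<phi>. indicator cube \<phi> * (boltzmann \<phi> (\<lambda>e. real_of_int (form q k e)) * f \<phi>) \<partial>leb \<partial>count_space ZV)
     = weight q * gauss (\<lambda>\<phi>. f (\<lambda>v\<in>V. \<phi> v - \<alpha> q v))"
proof -
  let ?g = "\<lambda>\<phi>. boltzmann \<phi> (\<lambda>e. real_of_int (rep q e)) * f \<phi>"
  have ind [measurable]: "(\<lambda>\<phi>. indicator cube (\<lambda>v\<in>V. \<phi> v - real_of_int (k v)) :: ennreal) \<in> borel_measurable leb" for k
    using measurable_compose[OF measurable_translate[of "\<lambda>v. - real_of_int (k v)"] borel_measurable_indicator[OF measurable_cube]]
    by simp
  have "(\<integral>\<^sup>+\<phi>. indicator cube \<phi> * (boltzmann \<phi> (\<lambda>e. real_of_int (form q k e)) * f \<phi>) \<partial>leb) =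
      (\<integral>\<^sup>+\<phi>. indicator cube (\<lambda>v\<in>V. \<phi> v - real_of_int (k v)) * ?g \<phi> \<partial>leb)" for k
  proof -
    have f': "f (\<lambda>v\<in>V. \<phi> v - real_of_int (k v)) = f \<phi>" if "\<phi> \<in> space leb" for \<phi>
    proof -
      have "(\<lambda>v\<in>V. \<phi> v) = \<phi>" using that by (simp add: space_PiM PiE_restrict)
      then show ?thesis using per[of \<phi> "\<lambda>v. - k v"] by simp
    qed
    have "(\<integral>\<^sup>+\<phi>. indicator cube \<phi> * (boltzmann \<phi> (\<lambda>e. real_of_int (form q k e)) * f \<phi>) \<partial>leb) =
       (\<integral>\<^sup>+\<phi>. boltzmann \<phi> (\<lambda>e. real_of_int (form q k e)) * (indicator cube \<phi> * f \<phi>) \<partial>leb)"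
      by (simp add: mult_ac)
    also have "\<dots> = (\<integral>\<^sup>+\<phi>. boltzmann \<phi> (\<lambda>e. real_of_int (form q k e) + d (\<lambda>v. - real_of_int (k v)) e) *
        (indicator cube (\<lambda>v\<in>V. \<phi> v - real_of_int (k v)) * f (\<lambda>v\<in>V. \<phi> v - real_of_int (k v))) \<partial>leb)"
      by (subst gauss_translate[where h = "\<lambda>v. - real_of_int (k v)"]) auto
    also have "\<dots> = (\<integral>\<^sup>+\<phi>. indicator cube (\<lambda>v\<in>V. \<phi> v - real_of_int (k v)) * ?g \<phi> \<partial>leb)"
    proof (rule nn_integral_cong)
      fix \<phi> assume "\<phi> \<in> space leb"
      moreover have "boltzmann \<phi> (\<lambda>e. real_of_int (form q k e) + d (\<lambda>v. - real_of_int (k v)) e) =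
          boltzmann \<phi> (\<lambda>e. real_of_int (rep q e))"
        unfolding boltzmann_def grad_uminus grad_of_int form_def
        by (intro arg_cong[where f = ennreal] arg_cong[where f = exp] arg_cong2[where f = "(*)"] refl sum.cong) auto
      ultimately show "boltzmann \<phi> (\<lambda>e. real_of_int (form q k e) + d (\<lambda>v. - real_of_int (k v)) e) *
        (indicator cube (\<lambda>v\<in>V. \<phi> v - real_of_int (k v)) * f (\<lambda>v\<in>V. \<phi> v - real_of_int (k v))) =
        indicator cube (\<lambda>v\<in>V. \<phi> v - real_of_int (k v)) * ?g \<phi>"
        by (simp add: f' mult_ac)
    qed
    finally show ?thesis .
  qed
  then have "(\<integral>\<^sup>+k. \<integral>\<^sup>+\<phi>. indicator cube \<phi> * (boltzmann \<phi> (\<lambda>e. real_of_int (form q k e)) * f \<phi>) \<partial>leb \<partial>count_space ZV)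
    = (\<integral>\<^sup>+k. \<integral>\<^sup>+\<phi>. indicator cube (\<lambda>v\<in>V. \<phi> v - real_of_int (k v)) * ?g \<phi> \<partial>leb \<partial>count_space ZV)"
    by simp
  \<comment> \<open>Tonelli over the countable \<open>ZV\<close>; the translated indicators then add
    up to 1.\<close>
  also have "\<dots> = (\<integral>\<^sup>+\<phi>. \<integral>\<^sup>+k. indicator cube (\<lambda>v\<in>V. \<phi> v - real_of_int (k v)) * ?g \<phi> \<partial>count_space ZV \<partial>leb)"
    by (rule nn_integral_count_space_nn_integral[symmetric]) (use countable_ZV in auto)
  also have "\<dots> = (\<integral>\<^sup>+\<phi>. ?g \<phi> \<partial>leb)"
    by (simp add: nn_integral_multc sum_cube_translates)
  \<comment> \<open>Completing the square: this translation is what displaces the argument of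
    \<open>f\<close> by \<open>\<alpha> q\<close>.\<close>
  also have "\<dots> = (\<integral>\<^sup>+\<phi>. boltzmann \<phi> (\<lambda>e. real_of_int (rep q e) + d (\<lambda>v. - \<alpha> q v) e) * f (\<lambda>v\<in>V. \<phi> v - \<alpha> q v) \<partial>leb)"
    by (subst gauss_translate[where h = "\<lambda>v. - \<alpha> q v"]) auto
  also have "\<dots> = (\<integral>\<^sup>+\<phi>. weight q * (boltzmann \<phi> (\<lambda>_. 0) * f (\<lambda>v\<in>V. \<phi> v - \<alpha> q v)) \<partial>leb)"
  proof (intro nn_integral_cong)
    fix \<phi> :: "'v \<Rightarrow> real"
    have "(\<Sum>e\<in>E. (d \<phi> e + (real_of_int (rep q e) + d (\<lambda>v. - \<alpha> q v) e))\<^sup>2) = (\<Sum>e\<in>E. (d \<phi> e + j q e)\<^sup>2)"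
      by (intro sum.cong) (auto simp: hodge[OF q] grad_uminus)
    also have "\<dots> = (\<Sum>e\<in>E. (d \<phi> e)\<^sup>2) + 2 * (\<Sum>e\<in>E. d \<phi> e * j q e) + (\<Sum>e\<in>E. (j q e)\<^sup>2)"
      by (simp add: power2_sum sum.distrib sum_distrib_left mult.assoc)
    finally have sq: "(\<Sum>e\<in>E. (d \<phi> e + (real_of_int (rep q e) + d (\<lambda>v. - \<alpha> q v) e))\<^sup>2) =
        (\<Sum>e\<in>E. (j q e)\<^sup>2) + (\<Sum>e\<in>E. (d \<phi> e)\<^sup>2)"
      by (simp add: coclosed[OF q])
    have "boltzmann \<phi> (\<lambda>e. real_of_int (rep q e) + d (\<lambda>v. - \<alpha> q v) e) = weight q * boltzmann \<phi> (\<lambda>_. 0)"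
      unfolding boltzmann_def weight_def sq distrib_left exp_add by (simp add: ennreal_mult)
    then show "boltzmann \<phi> (\<lambda>e. real_of_int (rep q e) + d (\<lambda>v. - \<alpha> q v) e) * f (\<lambda>v\<in>V. \<phi> v - \<alpha> q v) =
        weight q * (boltzmann \<phi> (\<lambda>_. 0) * f (\<lambda>v\<in>V. \<phi> v - \<alpha> q v))"
      by (simp only: mult.assoc)
  qed
  also have "\<dots> = weight q * gauss (\<lambda>\<phi>. f (\<lambda>v\<in>V. \<phi> v - \<alpha> q v))"
  proof -
    have [measurable]: "(\<lambda>\<phi>. f (\<lambda>v\<in>V. \<phi> v - \<alpha> q v)) \<in> borel_measurable leb"
      using measurable_compose[OF measurable_translate[of "\<lambda>v. - \<alpha> q v"] f] by simp
    show ?thesis unfolding gauss_def by (rule nn_integral_cmult) measurable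
  qed
  finally show ?thesis .
qed

text \<open>On the left the Villain model, on the right the gas times the Gaussian field.
  \<open>bij_form\<close> splits each integer form into its charge and an integer gradient; since
  \<open>H\<close> sees only the charge, the gradients can be unfolded charge by charge.\<close>

lemma villain_identity:
  assumes f [measurable]: "f \<in> borel_measurable leb"
    and per: "\<And>\<phi> k. f (\<lambda>v\<in>V. \<phi> v + real_of_int (k v)) = f (\<lambda>v\<in>V. \<phi> v)"
    and H: "\<And>q k. q \<in> Q \<Longrightarrow> k \<in> ZV \<Longrightarrow> H (form q k) = H' q"
  shows "(\<integral>\<^sup>+\<phi>. indicator cube \<phi> * ((\<integral>\<^sup>+m. boltzmann \<phi> (\<lambda>e. real_of_int (m e)) * H m \<partial>count_space ZE) * f \<phi>) \<partial>leb)
    = (\<integral>\<^sup>+q. H' q * (weight q * gauss (\<lambda>\<phi>. f (\<lambda>v\<in>V. \<phi> v - \<alpha> q v))) \<partial>count_space Q)"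
proof -
  let ?B = "\<lambda>\<phi> q k. indicator cube \<phi> * (boltzmann \<phi> (\<lambda>e. real_of_int (form q k e)) * f \<phi>)"
  have "indicator cube \<phi> * ((\<integral>\<^sup>+m. boltzmann \<phi> (\<lambda>e. real_of_int (m e)) * H m \<partial>count_space ZE) * f \<phi>) =
     (\<integral>\<^sup>+z. H' (fst z) * ?B \<phi> (fst z) (snd z) \<partial>count_space (Q \<times> ZV))" for \<phi>
  proof -
    have "(\<integral>\<^sup>+m. boltzmann \<phi> (\<lambda>e. real_of_int (m e)) * H m \<partial>count_space ZE) =
       (\<integral>\<^sup>+z. boltzmann \<phi> (\<lambda>e. real_of_int ((case z of (q, k) \<Rightarrow> form q k) e)) * H (case z of (q, k) \<Rightarrow> form q k) \<partial>count_space (Q \<times> ZV))"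
      by (rule nn_integral_bij_count_space[OF bij_form, symmetric])
    also have "\<dots> = (\<integral>\<^sup>+z. boltzmann \<phi> (\<lambda>e. real_of_int (form (fst z) (snd z) e)) * H' (fst z) \<partial>count_space (Q \<times> ZV))"
      by (intro nn_integral_cong) (auto simp: H)
    finally show ?thesis
      by (simp add: mult_ac flip: nn_integral_cmult)
  qed
  then have "(\<integral>\<^sup>+\<phi>. indicator cube \<phi> * ((\<integral>\<^sup>+m. boltzmann \<phi> (\<lambda>e. real_of_int (m e)) * H m \<partial>count_space ZE) * f \<phi>) \<partial>leb)
     = (\<integral>\<^sup>+\<phi>. \<integral>\<^sup>+z. H' (fst z) * ?B \<phi> (fst z) (snd z) \<partial>count_space (Q \<times> ZV) \<partial>leb)"
    by simp
  also have "\<dots> = (\<integral>\<^sup>+z. \<integral>\<^sup>+\<phi>. H' (fst z) * ?B \<phi> (fst z) (snd z) \<partial>leb \<partial>count_space (Q \<times> ZV))"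
    by (intro nn_integral_count_space_nn_integral countable_SIGMA countable_Q countable_ZV) measurable
  also have "\<dots> = (\<integral>\<^sup>+z. H' (fst z) * (\<integral>\<^sup>+\<phi>. ?B \<phi> (fst z) (snd z) \<partial>leb) \<partial>count_space (Q \<times> ZV))"
    by (intro nn_integral_cong nn_integral_cmult) measurable
  also have "\<dots> = (\<integral>\<^sup>+q. \<integral>\<^sup>+k. H' q * (\<integral>\<^sup>+\<phi>. ?B \<phi> q k \<partial>leb) \<partial>count_space ZV \<partial>count_space Q)"
    by (subst nn_integral_count_space_Times[OF countable_Q countable_ZV, symmetric]) simp
  also have "\<dots> = (\<integral>\<^sup>+q. H' q * (\<integral>\<^sup>+k. \<integral>\<^sup>+\<phi>. ?B \<phi> q k \<partial>leb \<partial>count_space ZV) \<partial>count_space Q)"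
    by (intro nn_integral_cong nn_integral_cmult) simp
  also have "\<dots> = (\<integral>\<^sup>+q. H' q * (weight q * gauss (\<lambda>\<phi>. f (\<lambda>v\<in>V. \<phi> v - \<alpha> q v))) \<partial>count_space Q)"
    by (intro nn_integral_cong) (simp only: unfold_torus[OF f per] space_count_space)
  finally show ?thesis .
qed

end

section \<open>Finiteness of the Gaussian mass and the conditional variance\<close>

context charges
begin

definition theta :: "real \<Rightarrow> real" where
  "theta a = (\<Sum>\<^sub>\<infinity>k::int. exp (- (b / 2) * (real_of_int k - a)\<^sup>2))"

lemma theta_pos: "theta a > 0"
  unfolding theta_def by (rule infsum_gaussian_pos[OF b_pos])

lemma sum_boltzmann:
  "(\<integral>\<^sup>+m. boltzmann \<phi> (\<lambda>e. real_of_int (m e)) * H m \<partial>count_space ZE) =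
    ennreal (\<Prod>e\<in>E. theta (- d \<phi> e)) * (\<integral>\<^sup>+m. H m \<partial>measure_pmf (Pi_pmf E 0 (\<lambda>e. IG (- d \<phi> e) b)))"
  using nn_integral_gaussian_product[OF finE b_pos, of "\<lambda>e. - d \<phi> e" H]
  by (simp add: theta_def boltzmann_def add.commute)

text \<open>No determinant is computed: a single charge sector contributes a positive multiple of
  the Gaussian mass to the Villain partition function, which is an integral of a bounded function
  over the unit cube.\<close>

lemma gauss_one_finite: "gauss (\<lambda>_. 1) < \<infinity>"
proof -
  obtain C where C: "theta a \<le> C" for a
    using infsum_gaussian_le[OF b_pos] unfolding theta_def by blast
  obtain q0 where q0: "q0 \<in> Q" using Q_nonempty by blast
  have "weight q0 * gauss (\<lambda>_. 1) = (\<integral>\<^sup>+q. weight q * gauss (\<lambda>_. 1) * indicator {q0} q \<partial>count_space Q)"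
    using q0 by (subst nn_integral_indicator_singleton) auto
  also have "\<dots> \<le> (\<integral>\<^sup>+q. 1 * (weight q * gauss (\<lambda>_. 1)) \<partial>count_space Q)"
    by (intro nn_integral_mono) (auto simp: indicator_def)
  also have "\<dots> = (\<integral>\<^sup>+\<phi>. indicator cube \<phi> * ((\<integral>\<^sup>+m. boltzmann \<phi> (\<lambda>e. real_of_int (m e)) * 1 \<partial>count_space ZE) * 1) \<partial>leb)"
    by (rule villain_identity[symmetric]) auto
  also have "\<dots> \<le> (\<integral>\<^sup>+\<phi>. ennreal (C ^ card E) * indicator cube \<phi> \<partial>leb)"
  proof (rule nn_integral_mono)
    fix \<phi> :: "'v \<Rightarrow> real"
    have "(\<Prod>e\<in>E. theta (- d \<phi> e)) \<le> (\<Prod>e\<in>E. C)"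
      using C theta_pos by (intro prod_mono) (auto intro: less_imp_le)
    then have "(\<integral>\<^sup>+m. boltzmann \<phi> (\<lambda>e. real_of_int (m e)) * 1 \<partial>count_space ZE) \<le> ennreal (C ^ card E)"
      unfolding sum_boltzmann by (simp add: ennreal_leI)
    then show "indicator cube \<phi> * ((\<integral>\<^sup>+m. boltzmann \<phi> (\<lambda>e. real_of_int (m e)) * 1 \<partial>count_space ZE) * 1) \<le>
        ennreal (C ^ card E) * indicator cube \<phi>"
      by (simp add: indicator_def)
  qed
  also have "\<dots> = ennreal (C ^ card E) * emeasure leb cube"
    by (rule nn_integral_cmult_indicator) simp
  also have "\<dots> < \<infinity>" by (simp add: emeasure_cube)
  finally show ?thesis
    by (auto simp: weight_def ennreal_mult_less_top top_unique)
qed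

text \<open>Law of total variance, conditioning on the angles. Since \<open>c\<close> is orthogonal
  to gradients, the linear statistic of the integer form depends on its charge only. The minorant
  \<open>v0\<close> has to be periodic in order to be a function on the torus of angles.\<close>

lemma variance_lower_bound:
  fixes c L :: "'e \<Rightarrow> real" and v0 :: "real \<Rightarrow> real"
  assumes c: "\<And>\<phi> :: 'v \<Rightarrow> real. (\<Sum>e\<in>E. c e * d \<phi> e) = 0"
    and v0_meas [measurable]: "v0 \<in> borel_measurable borel"
    and v0: "\<And>x. 0 \<le> v0 x" "\<And>x. v0 x \<le> Var_IG x b" "\<And>x k. v0 (x + real_of_int k) = v0 x"
    and L: "\<And>e. e \<in> E \<Longrightarrow> 0 \<le> L e"
      "\<And>e t. e \<in> E \<Longrightarrow> ennreal (L e) * gauss (\<lambda>_. 1) \<le> gauss (\<lambda>\<phi>. ennreal (v0 (t - d \<phi> e)))"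
  shows "ennreal (\<Sum>e\<in>E. (c e)\<^sup>2 * L e) * (\<integral>\<^sup>+q. weight q \<partial>count_space Q) \<le>
    (\<integral>\<^sup>+q. ennreal (((\<Sum>e\<in>E. c e * real_of_int (rep q e)) - \<mu>)\<^sup>2) * weight q \<partial>count_space Q)"
proof -
  let ?g = "gauss (\<lambda>_. 1)"
  define H :: "('e \<Rightarrow> int) \<Rightarrow> ennreal" where "H = (\<lambda>m. ennreal (((\<Sum>e\<in>E. c e * real_of_int (m e)) - \<mu>)\<^sup>2))"
  define f where "f = (\<lambda>\<phi>. ennreal (\<Sum>e\<in>E. (c e)\<^sup>2 * v0 (- d \<phi> e)))"
  have f_meas [measurable]: "f \<in> borel_measurable leb" unfolding f_def by measurable
  have per: "f (\<lambda>v\<in>V. \<phi> v + real_of_int (k v)) = f (\<lambda>v\<in>V. \<phi> v)" for \<phi> k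
  proof -
    have "v0 (- d (\<lambda>v. \<phi> v + real_of_int (k v)) e) = v0 (- d \<phi> e)" for e
      using v0(3)[of "- d \<phi> e" "- d k e"] by (simp add: grad_add grad_of_int)
    then show ?thesis by (simp add: f_def)
  qed
  have HH: "H (form q k) = H (rep q)" if "q \<in> Q" for q k
  proof -
    have "(\<Sum>e\<in>E. c e * real_of_int (form q k e)) =
        (\<Sum>e\<in>E. c e * real_of_int (rep q e)) + (\<Sum>e\<in>E. c e * d (\<lambda>v. real_of_int (k v)) e)"
      by (simp add: form_def grad_of_int distrib_left flip: sum.distrib)
    then show ?thesis by (simp add: H_def c)
  qed
  \<comment> \<open>Pointwise in the angles: the second moment about \<open>\<mu>\<close> is at
    least the conditional variance, as the squared bias is nonnegative.\<close>
  have fibre: "(\<integral>\<^sup>+m. boltzmann \<phi> (\<lambda>e. real_of_int (m e)) * 1 \<partial>count_space ZE) * f \<phi> \<le>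
      (\<integral>\<^sup>+m. boltzmann \<phi> (\<lambda>e. real_of_int (m e)) * H m \<partial>count_space ZE)" for \<phi>
  proof -
    have "f \<phi> \<le> ennreal ((\<Sum>e\<in>E. (c e)\<^sup>2 * measure_pmf.variance (IG (- d \<phi> e) b) real_of_int) +
        ((\<Sum>e\<in>E. c e * measure_pmf.expectation (IG (- d \<phi> e) b) real_of_int) - \<mu>)\<^sup>2)"
      unfolding f_def using v0(2)[unfolded Var_IG_def]
      by (intro ennreal_leI add_increasing2 sum_mono mult_left_mono) auto
    also have "\<dots> = (\<integral>\<^sup>+m. H m \<partial>measure_pmf (Pi_pmf E 0 (\<lambda>e. IG (- d \<phi> e) b)))"
      unfolding H_def by (rule nn_integral_square_Pi_pmf[OF finE integrable_square_IG[OF b_pos], symmetric])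
    finally show ?thesis
      unfolding sum_boltzmann by (intro mult_mono) auto
  qed
  \<comment> \<open>The gradient of \<open>\<alpha> q\<close> plays the role of the offset
    \<open>t\<close> in the hypothesis on \<open>L\<close>.\<close>
  have mean: "ennreal (\<Sum>e\<in>E. (c e)\<^sup>2 * L e) * ?g \<le> gauss (\<lambda>\<phi>. f (\<lambda>v\<in>V. \<phi> v - \<alpha> q v))" for q
  proof -
    have "ennreal (\<Sum>e\<in>E. (c e)\<^sup>2 * L e) * ?g = (\<Sum>e\<in>E. ennreal ((c e)\<^sup>2) * (ennreal (L e) * ?g))"
      using L(1) by (simp add: sum_distrib_right ennreal_mult mult.assoc flip: sum_ennreal)
    also have "\<dots> \<le> (\<Sum>e\<in>E. ennreal ((c e)\<^sup>2) * gauss (\<lambda>\<phi>. ennreal (v0 (d (\<alpha> q) e - d \<phi> e))))"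
      using L(2) by (intro sum_mono mult_left_mono) auto
    also have "\<dots> = gauss (\<lambda>\<phi>. \<Sum>e\<in>E. ennreal ((c e)\<^sup>2) * ennreal (v0 (d (\<alpha> q) e - d \<phi> e)))"
      by (simp add: gauss_sum gauss_cmult)
    also have "(\<lambda>\<phi>. \<Sum>e\<in>E. ennreal ((c e)\<^sup>2) * ennreal (v0 (d (\<alpha> q) e - d \<phi> e))) =
        (\<lambda>\<phi>. f (\<lambda>v\<in>V. \<phi> v - \<alpha> q v))"
    proof
      fix \<phi>
      have "d (\<lambda>v. \<phi> v - \<alpha> q v) e = d \<phi> e - d (\<alpha> q) e" for e
        using grad_add[of D V \<phi> "\<lambda>v. - \<alpha> q v" e] by (simp add: grad_uminus)
      then show "(\<Sum>e\<in>E. ennreal ((c e)\<^sup>2) * ennreal (v0 (d (\<alpha> q) e - d \<phi> e))) = f (\<lambda>v\<in>V. \<phi> v - \<alpha> q v)"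
        using v0(1) by (simp add: f_def ennreal_mult flip: sum_ennreal)
    qed
    finally show ?thesis .
  qed
  have "ennreal (\<Sum>e\<in>E. (c e)\<^sup>2 * L e) * (\<integral>\<^sup>+q. weight q \<partial>count_space Q) * ?g =
      (\<integral>\<^sup>+q. weight q * (ennreal (\<Sum>e\<in>E. (c e)\<^sup>2 * L e) * ?g) \<partial>count_space Q)"
    by (subst nn_integral_multc) (auto simp: mult_ac)
  also have "\<dots> \<le> (\<integral>\<^sup>+q. 1 * (weight q * gauss (\<lambda>\<phi>. f (\<lambda>v\<in>V. \<phi> v - \<alpha> q v))) \<partial>count_space Q)"
    unfolding mult_1 by (intro nn_integral_mono mult_left_mono mean) auto
  also have "\<dots> = (\<integral>\<^sup>+\<phi>. indicator cube \<phi> * ((\<integral>\<^sup>+m. boltzmann \<phi> (\<lambda>e. real_of_int (m e)) * 1 \<partial>count_space ZE) * f \<phi>) \<partial>leb)"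
    by (rule villain_identity[symmetric, OF f_meas per]) auto
  also have "\<dots> \<le> (\<integral>\<^sup>+\<phi>. indicator cube \<phi> * ((\<integral>\<^sup>+m. boltzmann \<phi> (\<lambda>e. real_of_int (m e)) * H m \<partial>count_space ZE) * 1) \<partial>leb)"
    unfolding mult_1_right[of "nn_integral _ _"] by (intro nn_integral_mono mult_left_mono fibre) auto
  also have "\<dots> = (\<integral>\<^sup>+q. H (rep q) * (weight q * ?g) \<partial>count_space Q)"
    by (rule villain_identity) (auto simp: HH)
  also have "\<dots> = (\<integral>\<^sup>+q. H (rep q) * weight q \<partial>count_space Q) * ?g"
    unfolding mult.assoc[symmetric] by (rule nn_integral_multc) simp
  finally have "?g * (ennreal (\<Sum>e\<in>E. (c e)\<^sup>2 * L e) * (\<integral>\<^sup>+q. weight q \<partial>count_space Q)) \<le>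
      ?g * (\<integral>\<^sup>+q. H (rep q) * weight q \<partial>count_space Q)"
    by (simp only: mult.commute)
  then show ?thesis
    using gauss_one_pos gauss_one_finite
    by (subst (asm) ennreal_mult_le_mult_iff) (auto simp: H_def)
qed

end

text \<open>Makes the two exponential tails in \<open>gauss_exp_abs\<close>, together 2 exp(-3/2)
  times the mass, at most half of the mass.\<close>

lemma exp_three_halves: "4 \<le> exp (3 / 2 :: real)"
proof -
  have "13 / 8 \<le> exp (1 / 2 :: real)"
    using exp_lower_Taylor_quadratic[of "1 / 2 :: real"] by (simp add: power2_eq_square)
  then have "(13 / 8) ^ 3 \<le> exp (1 / 2 :: real) ^ 3" by (intro power_mono) auto
  also have "\<dots> = exp (3 / 2)" by (simp flip: exp_of_nat_mult)
  finally show ?thesis by (simp add: power3_eq_cube)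
qed

section \<open>The cost of shifting the field along a test function\<close>

context gaussian_field
begin

text \<open>The Cameron-Martin density of the shift by \<open>x h\<close>.\<close>

lemma boltzmann_shift:
  "boltzmann \<phi> (\<lambda>e. x * d h e) = boltzmann \<phi> (\<lambda>_. 0) *
     ennreal (exp (- b * x * (\<Sum>e\<in>E. d \<phi> e * d h e) - b / 2 * x\<^sup>2 * (\<Sum>e\<in>E. (d h e)\<^sup>2)))"
proof -
  have "(\<Sum>e\<in>E. (d \<phi> e + x * d h e)\<^sup>2) =
      (\<Sum>e\<in>E. (d \<phi> e)\<^sup>2) + 2 * x * (\<Sum>e\<in>E. d \<phi> e * d h e) + x\<^sup>2 * (\<Sum>e\<in>E. (d h e)\<^sup>2)"
    by (simp add: power2_eq_square sum_distrib_left algebra_simps flip: sum.distrib)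
  then have "- (b / 2) * (\<Sum>e\<in>E. (d \<phi> e + x * d h e)\<^sup>2) = - (b / 2) * (\<Sum>e\<in>E. (d \<phi> e + 0)\<^sup>2) +
      (- b * x * (\<Sum>e\<in>E. d \<phi> e * d h e) - b / 2 * x\<^sup>2 * (\<Sum>e\<in>E. (d h e)\<^sup>2))"
    by (simp add: algebra_simps)
  then show ?thesis unfolding boltzmann_def by (simp only: exp_add ennreal_mult[OF exp_ge_zero exp_ge_zero])
qed

text \<open>The moment generating function of a linear functional of the field, read off from
  translation invariance instead of a covariance: up to a constant the exponential is the
  Cameron-Martin density.\<close>

lemma gauss_exp_linear:
  "gauss (\<lambda>\<phi>. ennreal (exp (- b * x * (\<Sum>e\<in>E. d \<phi> e * d h e)))) =
    ennreal (exp (b / 2 * x\<^sup>2 * (\<Sum>e\<in>E. (d h e)\<^sup>2))) * gauss (\<lambda>_. 1)" (is "gauss ?F = ?c * _")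
proof -
  have [measurable]: "?F \<in> borel_measurable leb" by measurable
  have 1: "?c * ennreal (exp (- b * x * Y - b / 2 * x\<^sup>2 * (\<Sum>e\<in>E. (d h e)\<^sup>2))) = ennreal (exp (- b * x * Y))" for Y
    by (subst ennreal_mult[symmetric]) (simp_all flip: exp_add)
  have "gauss (\<lambda>_. 1) = (\<integral>\<^sup>+\<phi>. boltzmann \<phi> (\<lambda>e. x * d h e) * 1 \<partial>leb)"
    unfolding gauss_def
    using gauss_translate[of "\<lambda>_. 1" "\<lambda>_. 0" "\<lambda>v. x * h v"] by (simp add: grad_mult)
  then have "?c * gauss (\<lambda>_. 1) = (\<integral>\<^sup>+\<phi>. ?c * boltzmann \<phi> (\<lambda>e. x * d h e) \<partial>leb)"
    by (simp add: nn_integral_cmult)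
  also have "\<dots> = gauss ?F"
    unfolding gauss_def boltzmann_shift 1[symmetric] by (intro nn_integral_cong mult.left_commute)
  finally show ?thesis by simp
qed

text \<open>The linear functional has variance at most 3/b, so with probability at least 1/2 it is
  of order 1/sqrt(b), and there the exponent is only of order sqrt(b), which is o(b).\<close>

lemma gauss_exp_abs:
  fixes h :: "'v \<Rightarrow> real"
  assumes fin: "gauss (\<lambda>_. 1) < \<infinity>" and S: "(\<Sum>e\<in>E. (d h e)\<^sup>2) \<le> 3"
  shows "ennreal (exp (- sqrt (3 * b)) / 2) * gauss (\<lambda>_. 1) \<le>
    gauss (\<lambda>\<phi>. ennreal (exp (- (b / 2) * \<bar>\<Sum>e\<in>E. d \<phi> e * d h e\<bar>)))"
proof -
  define Y where "Y = (\<lambda>\<phi>. \<Sum>e\<in>E. d \<phi> e * d h e)"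
  define S' where "S' = (\<Sum>e\<in>E. (d h e)\<^sup>2)"
  define l where "l = 1 / sqrt (3 * b)"
  have [measurable]: "Y \<in> borel_measurable leb" unfolding Y_def by measurable
  have lam: "l > 0" "b * l\<^sup>2 = 1 / 3" using b_pos by (auto simp: l_def power_divide)
  let ?X = "gauss (\<lambda>\<phi>. ennreal (exp (- (b / 2) * \<bar>Y \<phi>\<bar>)))" and ?g = "gauss (\<lambda>_. 1)"
  have K: "gauss (\<lambda>\<phi>. ennreal (exp (- b * x * Y \<phi>))) \<le> ennreal (exp (1 / 2)) * ?g"
    if "x = l \<or> x = - l" for x
  proof -
    have "b / 2 * x\<^sup>2 * S' \<le> b / 2 * l\<^sup>2 * 3"
      using that b_pos S by (intro mult_mono) (auto simp: S'_def sum_nonneg)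
    also have "\<dots> = 1 / 2" using lam(2) by simp
    finally have "b / 2 * x\<^sup>2 * S' \<le> 1 / 2" .
    then show ?thesis unfolding Y_def gauss_exp_linear
      by (intro mult_right_mono ennreal_leI) (auto simp: S'_def)
  qed
  \<comment> \<open>The threshold is two standard deviations for the largest energy 3. Beyond it
    \<open>b * l * \<bar>y\<bar>\<close> exceeds 2, so the Chernoff terms alone are at least
    1.\<close>
  have pt: "1 \<le> exp (sqrt (3 * b)) * exp (- (b / 2) * \<bar>y\<bar>) +
      exp (- 2) * (exp (- b * l * y) + exp (- b * (- l) * y))" for y
  proof (cases "(b / 2) * \<bar>y\<bar> \<le> sqrt (3 * b)")
    case True
    then have "1 \<le> exp (sqrt (3 * b)) * exp (- (b / 2) * \<bar>y\<bar>)"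
      by (simp flip: exp_add)
    moreover have "0 \<le> exp (- 2) * (exp (- b * l * y) + exp (- b * (- l) * y))" by simp
    ultimately show ?thesis by linarith
  next
    case False
    then have "2 < b * l * \<bar>y\<bar>" using b_pos by (simp add: l_def field_simps)
    then have "1 \<le> exp (- 2) * exp (b * l * \<bar>y\<bar>)" by (simp flip: exp_add)
    also have "\<dots> \<le> exp (- 2) * (exp (- b * l * y) + exp (- b * (- l) * y))"
      by (intro mult_left_mono) (auto simp: abs_if)
    finally show ?thesis by (simp add: add_increasing)
  qed
  have "?g \<le> gauss (\<lambda>\<phi>. ennreal (exp (sqrt (3 * b))) * ennreal (exp (- (b / 2) * \<bar>Y \<phi>\<bar>)) +
      ennreal (exp (- 2)) * (ennreal (exp (- b * l * Y \<phi>)) + ennreal (exp (- b * (- l) * Y \<phi>))))"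
    using pt by (intro gauss_mono) (simp flip: ennreal_mult ennreal_plus add: ennreal_leI flip: ennreal_1)
  also have "\<dots> = ennreal (exp (sqrt (3 * b))) * ?X +
      ennreal (exp (- 2)) * (gauss (\<lambda>\<phi>. ennreal (exp (- b * l * Y \<phi>))) + gauss (\<lambda>\<phi>. ennreal (exp (- b * (- l) * Y \<phi>))))"
    by (simp add: gauss_add gauss_cmult)
  also have "\<dots> \<le> ennreal (exp (sqrt (3 * b))) * ?X +
      ennreal (exp (- 2)) * (ennreal (exp (1 / 2)) * ?g + ennreal (exp (1 / 2)) * ?g)"
    by (intro add_mono mult_left_mono K) auto
  finally have main: "?g \<le> ennreal (exp (sqrt (3 * b))) * ?X +
      ennreal (exp (- 2)) * (ennreal (exp (1 / 2)) * ?g + ennreal (exp (1 / 2)) * ?g)" .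
  \<comment> \<open>Needed so that the inequality can be rearranged with real numbers.\<close>
  have X: "?X \<le> ?g" using b_pos by (intro gauss_mono) (simp add: ennreal_le_1)
  obtain r where r: "?g = ennreal r" "r \<ge> 0" using fin by (cases ?g) auto
  obtain x where x: "?X = ennreal x" "x \<ge> 0" using fin X by (cases ?X) (auto simp: top_unique)
  have "r \<le> exp (sqrt (3 * b)) * x + exp (- 2) * (exp (1 / 2) * r + exp (1 / 2) * r)"
    using main r(2) x(2) unfolding r(1) x(1) by (simp flip: ennreal_mult ennreal_plus)
  also have "exp (- 2) * (exp (1 / 2) * r + exp (1 / 2) * r) = 2 * r / exp (3 / 2)"
    by (simp add: exp_minus field_simps flip: exp_add)
  also have "\<dots> \<le> 2 * r / 4" using exp_three_halves r(2) by (intro divide_left_mono) auto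
  finally have "r / 2 \<le> exp (sqrt (3 * b)) * x" by simp
  then have "exp (- sqrt (3 * b)) * (r / 2) \<le> exp (- sqrt (3 * b)) * (exp (sqrt (3 * b)) * x)"
    by (intro mult_left_mono) auto
  then have "exp (- sqrt (3 * b)) / 2 * r \<le> x" by (simp flip: exp_add mult.assoc)
  then have "ennreal (exp (- sqrt (3 * b)) / 2) * ?g \<le> ?X" using r(2) unfolding x(1) r(1)
    by (simp flip: ennreal_mult add: ennreal_leI)
  then show ?thesis unfolding Y_def .
qed

text \<open>
  Shifting the field by \<open>x h\<close> with \<open>\<bar>x\<bar> \<le> 1/2\<close> costs at most a factor
  \<open>exp (- b s / 8 - b \<bar>Y\<bar> / 2)\<close> and averaging over \<open>x\<close> makes the fractional part of
  \<open>d \<phi> e\<close> uniform.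
\<close>

lemma gauss_periodic_ge:
  fixes h :: "'v \<Rightarrow> real" and v0 :: "real \<Rightarrow> real"
  assumes fin: "gauss (\<lambda>_. 1) < \<infinity>"
    and h: "d h e = 1" and S: "(\<Sum>e\<in>E. (d h e)\<^sup>2) \<le> s" "s \<le> 3"
    and v0_meas [measurable]: "v0 \<in> borel_measurable borel" and w: "w \<ge> 0"
      "\<And>y. ennreal w \<le> (\<integral>\<^sup>+x. indicator {- 1/2..1/2} x * ennreal (v0 (y - x)) \<partial>lborel)"
  shows "ennreal (exp (- sqrt (3 * b)) / 2 * exp (- b * s / 8) * w) * gauss (\<lambda>_. 1) \<le>
    gauss (\<lambda>\<phi>. ennreal (v0 (t - d \<phi> e)))"
proof -
  define Y where "Y = (\<lambda>\<phi>. \<Sum>e\<in>E. d \<phi> e * d h e)"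
  have Y_meas [measurable]: "Y \<in> borel_measurable leb" unfolding Y_def by measurable
  let ?I = "indicator {- 1/2..1/2} :: real \<Rightarrow> ennreal"
  let ?c = "\<lambda>\<phi>. boltzmann \<phi> (\<lambda>_. 0) * ennreal (exp (- (b / 2) * \<bar>Y \<phi>\<bar>) * exp (- b * s / 8))"
  let ?G = "gauss (\<lambda>\<phi>. ennreal (v0 (t - d \<phi> e)))"
  interpret L: sigma_finite_measure leb
  proof -
    interpret product_sigma_finite "\<lambda>_::'v. lborel :: real measure" ..
    show "sigma_finite_measure leb" using finV by (rule sigma_finite)
  qed
  interpret pair_sigma_finite "lborel :: real measure" leb ..
  have shift: "(\<integral>\<^sup>+\<phi>. ?c \<phi> * ennreal (v0 (t - d \<phi> e - x)) \<partial>leb) \<le> ?G" if x: "x \<in> {- 1/2..1/2}" for x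
  proof -
    have "?G = (\<integral>\<^sup>+\<phi>. boltzmann \<phi> (\<lambda>e. x * d h e) * ennreal (v0 (t - d \<phi> e - x)) \<partial>leb)"
      unfolding gauss_def
      using gauss_translate[of "\<lambda>\<phi>. ennreal (v0 (t - d \<phi> e))" "\<lambda>_. 0" "\<lambda>v. x * h v"]
      by (simp add: grad_mult grad_add h diff_diff_eq)
    also have "\<dots> \<ge> (\<integral>\<^sup>+\<phi>. ?c \<phi> * ennreal (v0 (t - d \<phi> e - x)) \<partial>leb)"
    proof (intro nn_integral_mono mult_right_mono)
      fix \<phi>
      have x': "\<bar>x\<bar> \<le> 1 / 2" using x by auto
      then have "x\<^sup>2 \<le> (1 / 2)\<^sup>2" by (rule power2_le_iff_abs_le[THEN iffD2, rotated]) simp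
      then have "x\<^sup>2 * (\<Sum>e\<in>E. (d h e)\<^sup>2) \<le> 1 / 4 * s"
        using S by (intro mult_mono) (auto simp: power2_eq_square sum_nonneg)
      then have 1: "b / 2 * (x\<^sup>2 * (\<Sum>e\<in>E. (d h e)\<^sup>2)) \<le> b / 2 * (1 / 4 * s)"
        using b_pos by (intro mult_left_mono) auto
      have "x * Y \<phi> \<le> \<bar>x\<bar> * \<bar>Y \<phi>\<bar>" by (metis abs_ge_self abs_mult)
      also have "\<dots> \<le> 1 / 2 * \<bar>Y \<phi>\<bar>" using x' by (intro mult_right_mono) auto
      finally have "b * (x * Y \<phi>) \<le> b * (1 / 2 * \<bar>Y \<phi>\<bar>)"
        using b_pos by (intro mult_left_mono) auto
      with 1 have "- (b / 2) * \<bar>Y \<phi>\<bar> + - b * s / 8 \<le> - b * x * Y \<phi> - b / 2 * x\<^sup>2 * (\<Sum>e\<in>E. (d h e)\<^sup>2)"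
        by (simp add: mult.assoc)
      then show "?c \<phi> \<le> boltzmann \<phi> (\<lambda>e. x * d h e)"
        unfolding boltzmann_shift Y_def
        by (intro mult_left_mono ennreal_leI) (simp_all flip: exp_add)
    qed auto
    finally show ?thesis .
  qed
  have "exp (- sqrt (3 * b)) / 2 * exp (- b * s / 8) * w =
      (exp (- b * s / 8) * w) * (exp (- sqrt (3 * b)) / 2)" by simp
  then have "ennreal (exp (- sqrt (3 * b)) / 2 * exp (- b * s / 8) * w) =
      ennreal (exp (- b * s / 8) * w) * ennreal (exp (- sqrt (3 * b)) / 2)"
    using w(1) by (simp only: ennreal_mult mult_nonneg_nonneg exp_ge_zero divide_nonneg_nonneg zero_le_numeral)
  then have "ennreal (exp (- sqrt (3 * b)) / 2 * exp (- b * s / 8) * w) * gauss (\<lambda>_. 1) =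
      ennreal (exp (- b * s / 8) * w) * (ennreal (exp (- sqrt (3 * b)) / 2) * gauss (\<lambda>_. 1))"
    by (simp only: mult.assoc)
  also have "\<dots> \<le> ennreal (exp (- b * s / 8) * w) * gauss (\<lambda>\<phi>. ennreal (exp (- (b / 2) * \<bar>Y \<phi>\<bar>)))"
    unfolding Y_def using S by (intro mult_left_mono gauss_exp_abs fin) auto
  also have "\<dots> = gauss (\<lambda>\<phi>. ennreal (exp (- b * s / 8) * w) * ennreal (exp (- (b / 2) * \<bar>Y \<phi>\<bar>)))"
    by (rule gauss_cmult[symmetric]) measurable
  also have "\<dots> = (\<integral>\<^sup>+\<phi>. ?c \<phi> * ennreal w \<partial>leb)"
    unfolding gauss_def using w(1) by (intro nn_integral_cong) (simp add: ennreal_mult mult_ac)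
  \<comment> \<open>The bound by \<open>w\<close> holds for every \<open>y\<close>, hence whatever
    the values of \<open>t\<close> and \<open>d \<phi> e\<close> are.\<close>
  also have "\<dots> \<le> (\<integral>\<^sup>+\<phi>. ?c \<phi> * (\<integral>\<^sup>+x. ?I x * ennreal (v0 (t - d \<phi> e - x)) \<partial>lborel) \<partial>leb)"
    by (intro nn_integral_mono mult_left_mono w) auto
  also have "\<dots> = (\<integral>\<^sup>+\<phi>. \<integral>\<^sup>+x. ?c \<phi> * (?I x * ennreal (v0 (t - d \<phi> e - x))) \<partial>lborel \<partial>leb)"
    by (intro nn_integral_cong nn_integral_cmult[symmetric]) measurable
  also have "\<dots> = (\<integral>\<^sup>+x. \<integral>\<^sup>+\<phi>. ?c \<phi> * (?I x * ennreal (v0 (t - d \<phi> e - x))) \<partial>leb \<partial>lborel)"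
  proof (rule Fubini')
    have [measurable]: "(\<lambda>p. d (snd p) e) \<in> borel_measurable (lborel \<Otimes>\<^sub>M leb)"
      "(\<lambda>p. Y (snd p)) \<in> borel_measurable (lborel \<Otimes>\<^sub>M leb)"
      "(\<lambda>p. boltzmann (snd p) (\<lambda>_. 0)) \<in> borel_measurable (lborel \<Otimes>\<^sub>M leb)"
      by (rule measurable_compose[OF measurable_snd], measurable)+
    show "(\<lambda>(x, \<phi>). ?c \<phi> * (?I x * ennreal (v0 (t - d \<phi> e - x)))) \<in> borel_measurable (lborel \<Otimes>\<^sub>M leb)"
      unfolding case_prod_unfold by measurable
  qed
  also have "\<dots> \<le> (\<integral>\<^sup>+x. ?G * ?I x \<partial>lborel)"
  proof (rule nn_integral_mono)
    fix x :: real
    show "(\<integral>\<^sup>+\<phi>. ?c \<phi> * (?I x * ennreal (v0 (t - d \<phi> e - x))) \<partial>leb) \<le> ?G * ?I x"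
      using shift[of x] by (cases "x \<in> {- 1/2..1/2}") auto
  qed
  also have "\<dots> = ?G * emeasure lborel {- 1/2..1/2 :: real}"
    by (rule nn_integral_cmult_indicator) simp
  also have "\<dots> = ?G" by simp
  finally show ?thesis .
qed

end

section \<open>Integer-valued Gaussians with mean near a half-integer\<close>

lemma variance_ge_two_atoms:
  fixes p :: "int pmf"
  assumes X: "integrable (measure_pmf p) (\<lambda>k. (real_of_int k)\<^sup>2)"
    and c: "c \<le> pmf p 0" "c \<le> pmf p 1" "0 \<le> c"
  shows "c / 2 \<le> measure_pmf.variance p real_of_int"
proof -
  define m where "m = measure_pmf.expectation p real_of_int"
  note X' = integrable_of_square_pmf[OF X]
  have i: "integrable (measure_pmf p) (\<lambda>k. (real_of_int k - m)\<^sup>2)"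
    using X X' unfolding power2_diff by (intro Bochner_Integration.integrable_add Bochner_Integration.integrable_diff) auto
  have ind: "integrable (measure_pmf p) (indicator A :: int \<Rightarrow> real)" for A
    by (intro measure_pmf.integrable_const_bound[where B = 1]) auto
  \<comment> \<open>Wherever the mean \<open>m\<close> lies, the points 0 and 1 cannot both be close
    to it.\<close>
  have "(2 * m - 1)\<^sup>2 \<ge> 0" by simp
  then have "1 / 2 \<le> m\<^sup>2 + (1 - m)\<^sup>2" by (simp add: power2_eq_square algebra_simps)
  then have "c * (1 / 2) \<le> c * (m\<^sup>2 + (1 - m)\<^sup>2)" using c by (intro mult_left_mono)
  also have "\<dots> = m\<^sup>2 * c + (1 - m)\<^sup>2 * c" by (simp add: algebra_simps)
  also have "\<dots> \<le> m\<^sup>2 * pmf p 0 + (1 - m)\<^sup>2 * pmf p 1"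
    using c by (intro add_mono mult_left_mono) auto
  also have "\<dots> = measure_pmf.expectation p (\<lambda>k. m\<^sup>2 * indicator {0} k + (1 - m)\<^sup>2 * indicator {1} k)"
    by (simp only: Bochner_Integration.integral_add[OF integrable_mult_right[OF ind] integrable_mult_right[OF ind]]
        integral_mult_right_zero Bochner_Integration.integral_indicator space_measure_pmf Int_UNIV_right measure_pmf_single)
  also have "\<dots> \<le> measure_pmf.expectation p (\<lambda>k. (real_of_int k - m)\<^sup>2)"
    by (intro integral_mono i Bochner_Integration.integrable_add integrable_mult_right ind)
       (auto simp: indicator_def)
  finally show ?thesis by (simp add: m_def)
qed

text \<open>At mean 1/2 the points 0 and 1 are equally likely. Moving the mean by at most 1/b keeps
  their weights above exp(-1) times the largest weight considered, while the remaining points stay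
  summable uniformly in \<open>b\<close>; so both atoms have mass bounded below independently of
  \<open>b\<close>.\<close>

lemma Var_IG_near_half:
  "\<exists>\<kappa>>0. \<forall>b\<ge>4. \<forall>a. \<bar>a - 1 / 2\<bar> \<le> 1 / b \<longrightarrow> \<kappa> \<le> Var_IG a b"
proof -
  define C where "C = (\<Sum>\<^sub>\<infinity>j::int. exp (- (1 / 2) * (real_of_int j)\<^sup>2))"
  have smC: "(\<lambda>j::int. exp (- (1 / 2) * (real_of_int j)\<^sup>2)) summable_on UNIV"
    using summable_gaussian[of "1 / 2" 0] by simp
  have C: "C > 0" using infsum_gaussian_pos[of 1 0] by (simp add: C_def)
  have "exp (- 1) / (4 * C) \<le> Var_IG a b" if b: "b \<ge> 4" and a: "\<bar>a - 1 / 2\<bar> \<le> 1 / b" for a b :: real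
  proof -
    let ?w = "\<lambda>k::int. exp (- (b / 2) * (real_of_int k - a)\<^sup>2)"
    let ?Z = "\<Sum>\<^sub>\<infinity>k. ?w k"
    define t where "t = 1 / b"
    have t: "0 < t" "t \<le> 1 / 4" "b * t = 1" using b by (auto simp: t_def field_simps)
    have Z: "?Z > 0" using b by (intro infsum_gaussian_pos) simp
    let ?f = "exp (- (b / 2) * (1 / 2 - t)\<^sup>2)"
    let ?g = "\<lambda>k::int. exp (- (1 / 2) * (real_of_int k)\<^sup>2)"
    have a': "1 / 2 - t \<le> a" "a \<le> 1 / 2 + t" using a unfolding abs_le_iff by (auto simp: t_def)
    \<comment> \<open>Every weight is at most the reference weight \<open>?f\<close> times a
      Gaussian free of \<open>b\<close>, centred at 0 or 1, whichever is on the side of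
      \<open>k\<close>.\<close>
    have le: "?w k \<le> ?f * (?g k + ?g (k - 1))" for k
    proof -
      have sq: "exp (- (b / 2) * y\<^sup>2) \<le> ?f * ?g i" if "\<bar>y\<bar> \<ge> 1 / 2 - t + \<bar>real_of_int i\<bar>" for y i
      proof -
        have "0 \<le> (1 - 2 * t) * \<bar>real_of_int i\<bar>" using t by (intro mult_nonneg_nonneg) auto
        then have "(1 / 2 - t)\<^sup>2 + (real_of_int i)\<^sup>2 \<le> (1 / 2 - t + \<bar>real_of_int i\<bar>)\<^sup>2"
          by (simp add: power2_sum)
        also have "\<dots> \<le> \<bar>y\<bar>\<^sup>2" using that t by (intro power_mono) auto
        finally have "b / 2 * ((1 / 2 - t)\<^sup>2 + (real_of_int i)\<^sup>2) \<le> b / 2 * y\<^sup>2"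
          using b by (intro mult_left_mono) auto
        moreover have "1 / 2 * (real_of_int i)\<^sup>2 \<le> b / 2 * (real_of_int i)\<^sup>2"
          using b by (intro mult_right_mono) auto
        ultimately have "- (b / 2) * y\<^sup>2 \<le> - (b / 2) * (1 / 2 - t)\<^sup>2 + - (1 / 2) * (real_of_int i)\<^sup>2"
          unfolding distrib_left by linarith
        then show ?thesis unfolding exp_add[symmetric] by simp
      qed
      show ?thesis
      proof (cases "k \<ge> 1")
        case True
        have "?w k \<le> ?f * ?g (k - 1)" by (rule sq) (use True a' in auto)
        then show ?thesis unfolding distrib_left by (simp add: add_increasing)
      next
        case False
        have "?w k \<le> ?f * ?g k" by (rule sq) (use False a' t in auto)
        then show ?thesis unfolding distrib_left by (simp add: add_increasing2)
      qed
    qed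
    have bij: "bij (\<lambda>k::int. k - 1)"
      by (rule bij_betw_byWitness[where f' = "\<lambda>k. k + 1"]) auto
    have smC': "(\<lambda>k. ?g (k - 1)) summable_on UNIV"
      using summable_on_reindex_bij_betw[OF bij, of ?g] smC by simp
    have "(\<Sum>\<^sub>\<infinity>k. ?g (k - 1)) = C" unfolding C_def by (rule infsum_reindex_bij_betw[OF bij])
    then have "(\<Sum>\<^sub>\<infinity>k. ?f * (?g k + ?g (k - 1))) = ?f * (2 * C)"
      using infsum_add[OF smC smC'] by (simp add: infsum_cmult_right' C_def)
    moreover have "?Z \<le> (\<Sum>\<^sub>\<infinity>k. ?f * (?g k + ?g (k - 1)))"
      using summable_gaussian[of "b / 2" a] b
      by (intro infsum_mono summable_on_cmult_right summable_on_add smC smC' le) auto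
    ultimately have Zle: "?Z \<le> ?f * (2 * C)" by simp
    have atom: "exp (- 1) / (2 * C) \<le> pmf (IG a b) k" if "\<bar>real_of_int k - a\<bar> \<le> 1 / 2 + t" for k
    proof -
      have "\<bar>real_of_int k - a\<bar>\<^sup>2 \<le> (1 / 2 + t)\<^sup>2" using that by (intro power_mono) auto
      \<comment> \<open>The nearest and the farthest admissible distances differ by
        \<open>2 * t\<close> in square, hence by exactly 1 in the exponent.\<close>
      also have "\<dots> = (1 / 2 - t)\<^sup>2 + 2 * t" by (simp add: power2_eq_square algebra_simps)
      finally have "b / 2 * (real_of_int k - a)\<^sup>2 \<le> b / 2 * ((1 / 2 - t)\<^sup>2 + 2 * t)"
        using b by (intro mult_left_mono) auto
      also have "\<dots> = b / 2 * (1 / 2 - t)\<^sup>2 + 1" using t(3) by (simp add: algebra_simps)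
      finally have w: "exp (- 1) * ?f \<le> ?w k" unfolding exp_add[symmetric] by simp
      have "exp (- 1) / (2 * C) = exp (- 1) * ?f / (?f * (2 * C))" by simp
      also have "\<dots> \<le> ?w k / ?Z" using w Zle Z C by (intro frac_le) auto
      also have "\<dots> = pmf (IG a b) k" using b by (subst pmf_IG) auto
      finally show ?thesis .
    qed
    have "exp (- 1) / (2 * C) / 2 \<le> measure_pmf.variance (IG a b) real_of_int"
      using b C a' t by (intro variance_ge_two_atoms integrable_square_IG atom) auto
    then show ?thesis by (simp add: Var_IG_def)
  qed
  then show ?thesis using C by (intro exI[of _ "exp (- 1) / (4 * C)"]) auto
qed

text \<open>The minorant is \<open>\<kappa>\<close> on windows of half-width 1/b around the
  half-integers. Its mass per period decays only like 1/b, which is logarithmic in the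
  exponent.\<close>

lemma IG_bump:
  "\<exists>\<kappa>>0. \<forall>b\<ge>4. \<exists>v0. v0 \<in> borel_measurable borel \<and> (\<forall>x. 0 \<le> v0 x \<and> v0 x \<le> Var_IG x b) \<and>
     (\<forall>x k. v0 (x + real_of_int k) = v0 x) \<and>
     (\<forall>y. ennreal (\<kappa> / b) \<le> (\<integral>\<^sup>+x. indicator {- 1/2..1/2} x * ennreal (v0 (y - x)) \<partial>lborel))"
proof -
  obtain \<kappa> where \<kappa>: "\<kappa> > 0"
    and V: "\<And>b a. b \<ge> 4 \<Longrightarrow> \<bar>a - 1 / 2\<bar> \<le> 1 / b \<Longrightarrow> \<kappa> \<le> Var_IG a b"
    using Var_IG_near_half by blast
  show ?thesis
  proof (intro exI[of _ \<kappa>] conjI \<kappa> allI impI)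
    fix b :: real assume b: "b \<ge> 4"
    define t where "t = 1 / b"
    have t: "0 < t" "t \<le> 1 / 4" using b by (auto simp: t_def field_simps)
    define v0 where "v0 x = (if \<bar>x - real_of_int \<lfloor>x\<rfloor> - 1 / 2\<bar> \<le> t then \<kappa> else 0)" for x
    have [measurable]: "v0 \<in> borel_measurable borel" unfolding v0_def by measurable
    have le: "v0 x \<le> Var_IG x b" for x
    proof (cases "\<bar>x - real_of_int \<lfloor>x\<rfloor> - 1 / 2\<bar> \<le> t")
      case True
      have "\<kappa> \<le> Var_IG (x - real_of_int \<lfloor>x\<rfloor>) b" using True b by (intro V) (auto simp: t_def)
      also have "\<dots> = Var_IG x b" using Var_IG_affine[of b 1 x "- \<lfloor>x\<rfloor>"] b by simp
      finally show ?thesis by (simp add: v0_def True)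
    qed (simp add: v0_def Var_IG_nonneg)
    have mass: "ennreal (\<kappa> / b) \<le> (\<integral>\<^sup>+x. indicator {- 1/2..1/2} x * ennreal (v0 (y - x)) \<partial>lborel)" for y
    proof -
      define z where "z = y - real_of_int \<lfloor>y\<rfloor> - 1 / 2"
      have z: "- 1 / 2 \<le> z" "z < 1 / 2" unfolding z_def by linarith+
      \<comment> \<open>Half of the window around \<open>z\<close>, taken on the side facing 0, so
        that it stays inside the interval of allowed shifts.\<close>
      define l where "l = (if z \<le> 0 then z else z - t)"
      have sub: "indicator {l..l + t} x * ennreal \<kappa> \<le> indicator {- 1/2..1/2} x * ennreal (v0 (y - x))" for x
      proof (cases "x \<in> {l..l + t}")
        case True
        then have x: "\<bar>z - x\<bar> \<le> t" "x \<in> {- 1/2..1/2}"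
          using z t unfolding l_def by (auto split: if_splits)
        have fl: "\<lfloor>y - x\<rfloor> = \<lfloor>y\<rfloor>" using x(1) t unfolding z_def by linarith
        have "v0 (y - x) = \<kappa>" using x(1) unfolding v0_def fl z_def by (simp add: algebra_simps)
        then show ?thesis using True x by simp
      qed simp
      have "ennreal (\<kappa> / b) = emeasure lborel {l..l + t} * ennreal \<kappa>"
        using t \<kappa> by (simp add: t_def flip: ennreal_mult)
      also have "\<dots> = (\<integral>\<^sup>+x. indicator {l..l + t} x * ennreal \<kappa> \<partial>lborel)"
        by (simp add: nn_integral_multc)
      also have "\<dots> \<le> (\<integral>\<^sup>+x. indicator {- 1/2..1/2} x * ennreal (v0 (y - x)) \<partial>lborel)"
        by (intro nn_integral_mono sub)
      finally show ?thesis .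
    qed
    show "\<exists>v0. v0 \<in> borel_measurable borel \<and> (\<forall>x. 0 \<le> v0 x \<and> v0 x \<le> Var_IG x b) \<and>
       (\<forall>x k. v0 (x + real_of_int k) = v0 x) \<and>
       (\<forall>y. ennreal (\<kappa> / b) \<le> (\<integral>\<^sup>+x. indicator {- 1/2..1/2} x * ennreal (v0 (y - x)) \<partial>lborel))"
      using \<kappa> le mass by (intro exI[of _ v0] conjI allI) (auto simp: v0_def)
  qed
qed

section \<open>Forms on the graphs\<close>

text \<open>Edges point right and up, in agreement with \<open>sides\<close>, whose first component
  is the square to the left of the edge.\<close>

fun tail_site :: "edge \<Rightarrow> site" where
  "tail_site (Horizontal v) = v"
| "tail_site (Vertical v) = v"

fun head_site :: "edge \<Rightarrow> site" where
  "head_site (Horizontal (x, y)) = (x + 1, y)"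
| "head_site (Vertical (x, y)) = (x, y + 1)"

definition incidence :: "edge \<Rightarrow> site \<Rightarrow> int" where
  "incidence e v = (if v = head_site e then 1 else 0) - (if v = tail_site e then 1 else 0)"

text \<open>The gradient determines a potential only up to a constant. With Dirichlet conditions the
  vertex at infinity is grounded; in the free graph the origin is grounded instead.\<close>

fun free_sites :: "boundary \<Rightarrow> nat \<Rightarrow> site set" where
  "free_sites Free n = sites n - {(0, 0)}"
| "free_sites (Dirichlet s) n = sites n"

abbreviation site_grad :: "boundary \<Rightarrow> nat \<Rightarrow> (site \<Rightarrow> 'a::comm_ring_1) \<Rightarrow> edge \<Rightarrow> 'a" where
  "site_grad bc n \<equiv> grad incidence (free_sites bc n)"

lemma finite_free_sites: "finite (free_sites bc n)"
  by (cases bc) (auto simp: finite_sites)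

lemma free_sites_subset: "free_sites bc n \<subseteq> sites n"
  by (cases bc) auto

lemma grad_incidence:
  assumes "finite V"
  shows "grad incidence V \<phi> e = (if head_site e \<in> V then \<phi> (head_site e) else 0) -
    (if tail_site e \<in> V then \<phi> (tail_site e) else (0::'a::comm_ring_1))"
proof -
  have "grad incidence V \<phi> e = (\<Sum>v\<in>V. (if v = head_site e then \<phi> v else 0) - (if v = tail_site e then \<phi> v else 0))"
    unfolding grad_def by (intro sum.cong) (auto simp: incidence_def)
  then show ?thesis using assms by (simp add: sum_subtractf)
qed

lemma grad_incidence_supported:
  assumes "finite V" "\<And>v. v \<notin> V \<Longrightarrow> \<phi> v = 0"
  shows "grad incidence V \<phi> e = \<phi> (head_site e) - (\<phi> (tail_site e) :: 'a::comm_ring_1)"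
  using assms by (simp add: grad_incidence)

lemma square_in_faces_Free:
  "Square (x, y) \<in> faces Free n \<longleftrightarrow> x \<in> {- int n .. int n - 1} \<and> y \<in> {- int n .. int n - 1}"
  by (auto simp: inj_image_mem_iff inj_def mem_sites)

lemma Horizontal_in_edges_Free:
  "Horizontal (x, y) \<in> edges Free n \<longleftrightarrow> x \<in> {- int n .. int n - 1} \<and> y \<in> {- int n .. int n}"
  by (auto simp: mem_sites)

lemma Vertical_in_edges_Free:
  "Vertical (x, y) \<in> edges Free n \<longleftrightarrow> x \<in> {- int n .. int n} \<and> y \<in> {- int n .. int n - 1}"
  by (auto simp: mem_sites)

lemma Horizontal_in_edges_Dirichlet:
  "Horizontal (x, y) \<in> edges (Dirichlet s) n \<longleftrightarrow> x \<in> {- int n - 1 .. int n} \<and> y \<in> {- int n .. int n}"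
  by (auto simp: mem_sites Int_insert_left)

lemma Vertical_in_edges_Dirichlet:
  "Vertical (x, y) \<in> edges (Dirichlet s) n \<longleftrightarrow> x \<in> {- int n .. int n} \<and> y \<in> {- int n - 1 .. int n}"
  by (auto simp: mem_sites Int_insert_left)

lemmas in_graph = square_in_faces_Free square_in_faces_Dirichlet Horizontal_in_edges_Free
  Vertical_in_edges_Free Horizontal_in_edges_Dirichlet Vertical_in_edges_Dirichlet

text \<open>The discrete curl: for a unit square the counterclockwise circulation of
  \<open>m\<close> around it.\<close>

definition charge :: "boundary \<Rightarrow> nat \<Rightarrow> (edge \<Rightarrow> 'a::ab_group_add) \<Rightarrow> face \<Rightarrow> 'a" where
  "charge bc n m f = (\<Sum>e | e \<in> edges bc n \<and> left_face bc n e = f. m e) -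
     (\<Sum>e | e \<in> edges bc n \<and> right_face bc n e = f. m e)"

definition on_edges :: "boundary \<Rightarrow> nat \<Rightarrow> (edge \<Rightarrow> 'a::zero) \<Rightarrow> edge \<Rightarrow> 'a" where
  "on_edges bc n m e = (if e \<in> edges bc n then m e else 0)"

text \<open>Summation by parts: the curl is the adjoint of the jump of a face function across
  edges.\<close>

lemma sum_charge:
  fixes v m :: "_ \<Rightarrow> 'a::comm_ring_1"
  shows "(\<Sum>f\<in>faces bc n. v f * charge bc n m f) =
    (\<Sum>e\<in>edges bc n. (v (left_face bc n e) - v (right_face bc n e)) * m e)"
proof -
  have "(\<Sum>f\<in>faces bc n. v f * charge bc n m f) =
      (\<Sum>f\<in>faces bc n. \<Sum>e | e \<in> edges bc n \<and> left_face bc n e = f. v (left_face bc n e) * m e) -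
      (\<Sum>f\<in>faces bc n. \<Sum>e | e \<in> edges bc n \<and> right_face bc n e = f. v (right_face bc n e) * m e)"
    unfolding charge_def right_diff_distrib sum_subtractf sum_distrib_left
    by (intro arg_cong2[where f = "(-)"] sum.cong) auto
  also have "\<dots> = (\<Sum>e\<in>edges bc n. v (left_face bc n e) * m e) - (\<Sum>e\<in>edges bc n. v (right_face bc n e) * m e)"
    by (intro arg_cong2[where f = "(-)"] sum.group finite_edges finite_faces) (auto intro: sides_in_faces)
  finally show ?thesis by (simp add: left_diff_distrib sum_subtractf)
qed

lemma face_at_eq_Square:
  assumes "Square t \<in> faces bc n"
  shows "face_at bc n t' = Square t \<longleftrightarrow> t' = t"
  using assms by (auto simp: face_at_def)

lemma side_eq_Square:
  assumes "Square (x, y) \<in> faces bc n"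
  shows "left_face bc n e = Square (x, y) \<longleftrightarrow> e \<in> {Horizontal (x, y), Vertical (x + 1, y)}"
    "right_face bc n e = Square (x, y) \<longleftrightarrow> e \<in> {Horizontal (x, y + 1), Vertical (x, y)}"
  unfolding left_face_def right_face_def face_at_eq_Square[OF assms]
  by (cases e rule: sides.cases; auto)+

lemma charge_Square:
  assumes "Square (x, y) \<in> faces bc n"
  shows "charge bc n m (Square (x, y)) =
    on_edges bc n m (Horizontal (x, y)) + on_edges bc n m (Vertical (x + 1, y)) -
    on_edges bc n m (Horizontal (x, y + 1)) - on_edges bc n m (Vertical (x, y))"
proof -
  have S: "(\<Sum>e | e \<in> edges bc n \<and> e \<in> {a, c}. m e) = on_edges bc n m a + on_edges bc n m c" if "a \<noteq> c" for a c
  proof -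
    have "(\<Sum>e | e \<in> edges bc n \<and> e \<in> {a, c}. m e) = (\<Sum>e\<in>{a, c}. on_edges bc n m e)"
      by (rule sum.mono_neutral_cong_left) (auto simp: on_edges_def)
    then show ?thesis using that by simp
  qed
  show ?thesis unfolding charge_def side_eq_Square[OF assms] by (subst (1 2) S) (auto simp: algebra_simps)
qed

text \<open>Summation along the path from the lower left corner, first horizontally, then vertically.\<close>

lemma closed_imp_exact_box:
  fixes m :: "edge \<Rightarrow> 'a::ab_group_add" and N :: int
  assumes closed: "\<forall>x\<in>{- N..<N}. \<forall>y\<in>{- N..<N}.
      m (Horizontal (x, y)) + m (Vertical (x + 1, y)) - m (Horizontal (x, y + 1)) - m (Vertical (x, y)) = 0"
  shows "\<exists>k. k (- N, - N) = 0 \<and>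
    (\<forall>x\<in>{- N..<N}. \<forall>y\<in>{- N..N}. m (Horizontal (x, y)) = k (x + 1, y) - k (x, y)) \<and>
    (\<forall>x\<in>{- N..N}. \<forall>y\<in>{- N..<N}. m (Vertical (x, y)) = k (x, y + 1) - k (x, y))"
proof -
  define k where "k = (\<lambda>(x, y). (\<Sum>i\<in>{- N..<x}. m (Horizontal (i, - N))) + (\<Sum>j\<in>{- N..<y}. m (Vertical (x, j))))"
  have ins: "{- N..<x + 1} = insert x {- N..<x}" if "x \<ge> - N" for x using that by auto
  have v: "m (Vertical (x, y)) = k (x, y + 1) - k (x, y)" if "y \<ge> - N" for x y
    using that by (simp add: k_def ins)
  have h: "m (Horizontal (x, y)) = k (x + 1, y) - k (x, y)" if "x \<in> {- N..<N}" "- N \<le> y" "y \<le> N" for x y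
    using that(2,3)
  proof (induction y rule: int_ge_induct)
    case base
    then show ?case using that(1) by (simp add: k_def ins)
  next
    case (step y)
    then have "y \<in> {- N..<N}" by auto
    then have "m (Horizontal (x, y)) + m (Vertical (x + 1, y)) - m (Horizontal (x, y + 1)) - m (Vertical (x, y)) = 0"
      using that(1) closed by blast
    moreover have "m (Horizontal (x, y)) = k (x + 1, y) - k (x, y)" using step by simp
    ultimately show ?case using v[OF step(1), of x] v[OF step(1), of "x + 1"]
      by (simp add: algebra_simps)
  qed
  have "k (- N, - N) = 0" by (simp add: k_def)
  then show ?thesis using h v by (intro exI[of _ k] conjI ballI) auto
qed

section \<open>Exactness, coclosedness and existence of representatives of charges\<close>

lemma sum_charge_faces: "(\<Sum>f\<in>faces bc n. charge bc n m f) = (0::'a::comm_ring_1)"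
  using sum_charge[of "\<lambda>_. 1" bc n m] by simp

text \<open>The discrete Poincare lemma. In the free case the potential on the box is normalised at
  the origin. In the Dirichlet case it must also be single-valued at infinity, for which the form is
  extended by zero to a larger box.\<close>

lemma closed_imp_exact:
  fixes m :: "edge \<Rightarrow> 'a::comm_ring_1"
  assumes mf: "marked_face bc \<in> faces bc n"
    and closed: "\<And>f. f \<in> faces bc n - {marked_face bc} \<Longrightarrow> charge bc n m f = 0"
  shows "\<exists>k. (\<forall>v. v \<notin> free_sites bc n \<longrightarrow> k v = 0) \<and> (\<forall>e\<in>edges bc n. m e = site_grad bc n k e)"
proof (cases bc)
  case Free
  have cl: "\<forall>x\<in>{- int n..<int n}. \<forall>y\<in>{- int n..<int n}.
      on_edges Free n m (Horizontal (x, y)) + on_edges Free n m (Vertical (x + 1, y)) -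
      on_edges Free n m (Horizontal (x, y + 1)) - on_edges Free n m (Vertical (x, y)) = 0"
  proof (intro ballI)
    fix x y assume xy: "x \<in> {- int n..<int n}" "y \<in> {- int n..<int n}"
    have sq: "Square (x, y) \<in> faces Free n" unfolding square_in_faces_Free using xy by auto
    then have "charge Free n m (Square (x, y)) = 0" using closed[unfolded Free] by simp
    then show "on_edges Free n m (Horizontal (x, y)) + on_edges Free n m (Vertical (x + 1, y)) -
        on_edges Free n m (Horizontal (x, y + 1)) - on_edges Free n m (Vertical (x, y)) = 0"
      unfolding charge_Square[OF sq] .
  qed
  obtain k where k:
    "\<forall>x\<in>{- int n..<int n}. \<forall>y\<in>{- int n..int n}. on_edges Free n m (Horizontal (x, y)) = k (x + 1, y) - k (x, y)"
    "\<forall>x\<in>{- int n..int n}. \<forall>y\<in>{- int n..<int n}. on_edges Free n m (Vertical (x, y)) = k (x, y + 1) - k (x, y)"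
    using closed_imp_exact_box[of "int n" "on_edges Free n m", OF cl] by (elim exE conjE)
  define k' where "k' v = (if v \<in> free_sites bc n then k v - k (0, 0) else 0)" for v
  have k': "k' v = k v - k (0, 0)" if "v \<in> sites n" for v
    using that Free by (auto simp: k'_def)
  show ?thesis
  proof (intro exI[of _ k'] conjI allI impI ballI)
    show "k' v = 0" if "v \<notin> free_sites bc n" for v using that by (simp add: k'_def)
    fix e assume e: "e \<in> edges bc n"
    have "site_grad bc n k' e = k' (head_site e) - k' (tail_site e)"
      by (rule grad_incidence_supported) (auto simp: finite_free_sites k'_def)
    also have "\<dots> = k (head_site e) - k (tail_site e)"
      using e Free by (cases e rule: ends.cases) (auto simp: k')
    also have "\<dots> = m e"
      using e Free k by (cases e rule: ends.cases) (auto simp: on_edges_def in_graph simp del: edges.simps)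
    finally show "m e = site_grad bc n k' e" by simp
  qed
next
  case (Dirichlet s)
  \<comment> \<open>One extra layer of sites contains the outer endpoints of all edges to infinity,
    and the unit squares of the larger box are exactly the faces.\<close>
  let ?m = "on_edges bc n m" and ?N = "int n + 1"
  \<comment> \<open>The charges add up to 0, so closedness at all other faces implies it at the
    marked face.\<close>
  have "charge bc n m (marked_face bc) = 0"
    using sum_charge_faces[of bc n m] closed mf
    by (subst (asm) sum.remove[OF finite_faces mf]) (simp add: sum.neutral)
  then have all: "charge bc n m f = 0" if "f \<in> faces bc n" for f
    using closed[of f] that by (cases "f = marked_face bc") auto
  have cl: "\<forall>x\<in>{- ?N..<?N}. \<forall>y\<in>{- ?N..<?N}.
      ?m (Horizontal (x, y)) + ?m (Vertical (x + 1, y)) - ?m (Horizontal (x, y + 1)) - ?m (Vertical (x, y)) = 0"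
  proof (intro ballI)
    fix x y assume xy: "x \<in> {- ?N..<?N}" "y \<in> {- ?N..<?N}"
    have sq: "Square (x, y) \<in> faces bc n" unfolding Dirichlet square_in_faces_Dirichlet using xy by auto
    show "?m (Horizontal (x, y)) + ?m (Vertical (x + 1, y)) - ?m (Horizontal (x, y + 1)) - ?m (Vertical (x, y)) = 0"
      using all[OF sq] unfolding charge_Square[OF sq] .
  qed
  obtain k where k: "k (- ?N, - ?N) = 0"
    "\<forall>x\<in>{- ?N..<?N}. \<forall>y\<in>{- ?N..?N}. ?m (Horizontal (x, y)) = k (x + 1, y) - k (x, y)"
    "\<forall>x\<in>{- ?N..?N}. \<forall>y\<in>{- ?N..<?N}. ?m (Vertical (x, y)) = k (x, y + 1) - k (x, y)"
    using closed_imp_exact_box[of ?N ?m, OF cl] by (elim exE conjE)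
  \<comment> \<open>The sides of the larger box are not edges of the graph, so the potential is
    constant along the ring and descends to infinity.\<close>
  have H0: "?m (Horizontal (x, y)) = 0" if "y = - ?N \<or> y = ?N" for x y
    unfolding on_edges_def Dirichlet Horizontal_in_edges_Dirichlet using that by auto
  have V0: "?m (Vertical (x, y)) = 0" if "x = - ?N \<or> x = ?N" for x y
    unfolding on_edges_def Dirichlet Vertical_in_edges_Dirichlet using that by auto
  have row: "k (x, y) = k (- ?N, y)" if "y = - ?N \<or> y = ?N" "- ?N \<le> x" "x \<le> ?N" for x y
    using that(2,3)
  proof (induction x rule: int_ge_induct)
    case (step x)
    then show ?case using k(2)[rule_format, of x y] H0[OF that(1), of x] that(1) by auto
  qed simp
  have col: "k (x, y) = k (x, - ?N)" if "x = - ?N \<or> x = ?N" "- ?N \<le> y" "y \<le> ?N" for x y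
    using that(2,3)
  proof (induction y rule: int_ge_induct)
    case (step y)
    then show ?case using k(3)[rule_format, of x y] V0[OF that(1), of y] that(1) by auto
  qed simp
  have ring: "k (x, y) = 0" if "x \<in> {- ?N..?N}" "y \<in> {- ?N..?N}" "(x, y) \<notin> sites n" for x y
  proof -
    have "x = - ?N \<or> x = ?N \<or> y = - ?N \<or> y = ?N" using that by (auto simp: mem_sites)
    then show ?thesis
    proof (elim disjE)
      assume "x = - ?N" then show ?thesis using col[of x y] that k(1) by auto
    next
      assume "x = ?N" then show ?thesis using col[of x y] row[of "- ?N" x] that k(1) by auto
    next
      assume "y = - ?N" then show ?thesis using row[of y x] that k(1) by auto
    next
      assume "y = ?N" then show ?thesis using row[of y x] col[of "- ?N" y] that k(1) by auto
    qed
  qed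
  define k' where "k' v = (if v \<in> free_sites bc n then k v else 0)" for v
  have k': "k' (x, y) = k (x, y)" if "x \<in> {- ?N..?N}" "y \<in> {- ?N..?N}" for x y
    using that Dirichlet ring by (auto simp: k'_def)
  show ?thesis
  proof (intro exI[of _ k'] conjI allI impI ballI)
    show "k' v = 0" if "v \<notin> free_sites bc n" for v using that by (simp add: k'_def)
    fix e assume e: "e \<in> edges bc n"
    have "site_grad bc n k' e = k' (head_site e) - k' (tail_site e)"
      by (rule grad_incidence_supported) (auto simp: finite_free_sites k'_def)
    also have "\<dots> = ?m e"
      using e Dirichlet k(2,3) by (cases e rule: ends.cases) (auto simp: in_graph k' simp del: edges.simps)
    also have "\<dots> = m e" using e by (simp add: on_edges_def)
    finally show "m e = site_grad bc n k' e" by simp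
  qed
qed

text \<open>Every site is joined to a grounded vertex: along its row to infinity, or along rows and
  the left column to the origin. Used for uniqueness of integer potentials and for nondegeneracy in
  Foster's argument.\<close>

lemma site_grad_zero:
  fixes k :: "site \<Rightarrow> 'a::comm_ring_1"
  assumes supp: "\<And>v. v \<notin> free_sites bc n \<Longrightarrow> k v = 0"
    and g: "\<And>e. e \<in> edges bc n \<Longrightarrow> site_grad bc n k e = 0"
  shows "k v = 0"
proof -
  have eq: "k (head_site e) = k (tail_site e)" if "e \<in> edges bc n" for e
    using g[OF that] grad_incidence_supported[where V = "free_sites bc n" and e = e, OF finite_free_sites supp] by simp
  obtain x y where v: "v = (x, y)" by (cases v)
  show ?thesis
  proof (cases bc)
    case (Dirichlet s)
    have "k (x, y) = 0" if "y \<in> {- int n..int n}" "- int n - 1 \<le> x" "x \<le> int n" for x y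
      using that(2,3)
    proof (induction x rule: int_ge_induct)
      case base
      then show ?case using supp[of "(- int n - 1, y)"] Dirichlet by (simp add: mem_sites)
    next
      case (step x)
      then have "Horizontal (x, y) \<in> edges bc n"
        unfolding Dirichlet Horizontal_in_edges_Dirichlet using that(1) by auto
      from eq[OF this] step show ?case by simp
    qed
    then show ?thesis using supp[of v] Dirichlet unfolding v by (cases "(x, y) \<in> sites n") (auto simp: mem_sites)
  next
    case Free
    have H: "k (x, y) = k (- int n, y)" if "y \<in> {- int n..int n}" "- int n \<le> x" "x \<le> int n" for x y
      using that(2,3)
    proof (induction x rule: int_ge_induct)
      case (step x)
      then have "Horizontal (x, y) \<in> edges bc n"
        unfolding Free Horizontal_in_edges_Free using that(1) by auto
      from eq[OF this] step show ?case by simp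
    qed simp
    have V: "k (- int n, y) = k (- int n, - int n)" if "- int n \<le> y" "y \<le> int n" for y
      using that
    proof (induction y rule: int_ge_induct)
      case (step y)
      then have "Vertical (- int n, y) \<in> edges bc n"
        unfolding Free Vertical_in_edges_Free by auto
      from eq[OF this] step show ?case by simp
    qed simp
    have "k (0, 0) = 0" using supp[of "(0, 0)"] Free by simp
    then show ?thesis using supp[of v] H[of y x] V[of y] H[of 0 0] V[of 0] Free unfolding v
      by (cases "(x, y) \<in> sites n") (auto simp: mem_sites)
  qed
qed

text \<open>Lattice edges missing at a site can be added without effect: in the free graph both of
  their sides are the outer face, in the Dirichlet graph none is missing.\<close>

lemma two_form_sides_eq:
  fixes u :: "face \<Rightarrow> 'a::comm_ring_1"
  assumes u: "u \<in> two_forms bc n" and e: "e \<notin> edges bc n" "head_site e \<in> sites n \<or> tail_site e \<in> sites n"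
  shows "u (left_face bc n e) = u (right_face bc n e)"
proof (cases bc)
  case Free
  have "left_face bc n e = Outer" "right_face bc n e = Outer"
    using e(1) Free
    by (cases e rule: sides.cases;
        auto simp: left_face_def right_face_def face_at_def in_graph simp del: edges.simps faces.simps)+
  then show ?thesis by simp
next
  case (Dirichlet s)
  have "ends e = {head_site e, tail_site e}" by (cases e rule: ends.cases) auto
  then show ?thesis using e Dirichlet by auto
qed

text \<open>The four lattice edges at a site separate consecutive squares around it, so the jumps of
  \<open>u\<close> telescope.\<close>

lemma two_form_coclosed_at:
  fixes u :: "face \<Rightarrow> 'a::comm_ring_1"
  assumes u: "u \<in> two_forms bc n" and v: "v \<in> sites n"
  shows "(\<Sum>e\<in>edges bc n. of_int (incidence e v) * (u (left_face bc n e) - u (right_face bc n e))) = 0"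
proof -
  obtain x y where xy: "v = (x, y)" by (cases v)
  let ?j = "\<lambda>e. u (left_face bc n e) - u (right_face bc n e)"
  let ?S = "{Horizontal (x, y), Vertical (x, y), Horizontal (x - 1, y), Vertical (x, y - 1)}"
  have out: "incidence e v = 0" if "e \<notin> ?S" for e
    using that unfolding xy incidence_def by (cases e rule: ends.cases) auto
  have zero: "of_int (incidence e v) * ?j e = 0" if "e \<notin> edges bc n" for e
  proof (cases "incidence e v = 0")
    case False
    then have "head_site e \<in> sites n \<or> tail_site e \<in> sites n"
      using v by (auto simp: incidence_def split: if_splits)
    then show ?thesis using two_form_sides_eq[OF u that] by simp
  qed simp
  have "(\<Sum>e\<in>edges bc n. of_int (incidence e v) * ?j e) = (\<Sum>e\<in>edges bc n \<union> ?S. of_int (incidence e v) * ?j e)"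
    using finite_edges[of bc n] zero by (intro sum.mono_neutral_left) auto
  also have "\<dots> = (\<Sum>e\<in>?S. of_int (incidence e v) * ?j e)"
    using finite_edges[of bc n] out by (intro sum.mono_neutral_right) auto
  also have "\<dots> = 0"
    by (simp add: xy incidence_def left_face_def right_face_def)
  finally show ?thesis .
qed

lemma two_form_coclosed:
  fixes u :: "face \<Rightarrow> 'a::comm_ring_1"
  assumes u: "u \<in> two_forms bc n"
  shows "(\<Sum>e\<in>edges bc n. site_grad bc n \<phi> e * (u (left_face bc n e) - u (right_face bc n e))) = 0"
proof -
  have "(\<Sum>e\<in>edges bc n. site_grad bc n \<phi> e * (u (left_face bc n e) - u (right_face bc n e))) =
      (\<Sum>v\<in>free_sites bc n. \<phi> v * (\<Sum>e\<in>edges bc n. of_int (incidence e v) * (u (left_face bc n e) - u (right_face bc n e))))"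
    unfolding grad_def sum_distrib_right sum_distrib_left by (subst sum.swap) (simp add: mult_ac)
  also have "\<dots> = 0"
    using two_form_coclosed_at[OF u] free_sites_subset[of bc n] by (intro sum.neutral) auto
  finally show ?thesis .
qed

text \<open>Dual to \<open>two_form_coclosed\<close>, tested with the indicator of
  \<open>f\<close>.\<close>

lemma charge_site_grad:
  fixes k :: "site \<Rightarrow> 'a::comm_ring_1"
  assumes f: "f \<in> faces bc n - {marked_face bc}"
  shows "charge bc n (site_grad bc n k) f = 0"
proof -
  let ?u = "\<lambda>f'. if f' = f then 1 else (0::'a)"
  have u: "?u \<in> two_forms bc n" using f by (auto simp: two_forms_def)
  have "charge bc n (site_grad bc n k) f = (\<Sum>f'\<in>faces bc n. ?u f' * charge bc n (site_grad bc n k) f')"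
    using f finite_faces[of bc n] by (simp add: if_distrib[of "\<lambda>c. c * _"] cong: if_cong)
  then show ?thesis unfolding sum_charge using two_form_coclosed[OF u, of k] by (simp add: mult.commute)
qed

lemma charge_add: "charge bc n (\<lambda>e. m e + m' e) f = charge bc n m f + charge bc n m' f"
  by (simp add: charge_def sum.distrib)

lemma charge_diff: "charge bc n (\<lambda>e. m e - m' e) f = charge bc n m f - charge bc n m' f"
  by (simp add: charge_def sum_subtractf)

lemma charge_sum: "charge bc n (\<lambda>e. \<Sum>i\<in>I. m i e) f = (\<Sum>i\<in>I. charge bc n (m i) f)"
  by (induction I rule: infinite_finite_induct) (simp_all add: charge_add, simp_all add: charge_def)

lemma charge_mult: "charge bc n (\<lambda>e. c * m e) f = c * charge bc n m (f :: face) " for c :: "'a::comm_ring_1"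
  by (simp add: charge_def sum_distrib_left right_diff_distrib)

lemma charge_of_int: "charge bc n (\<lambda>e. real_of_int (m e)) f = real_of_int (charge bc n m f)"
  by (simp add: charge_def)

lemma charge_cong: "(\<And>e. e \<in> edges bc n \<Longrightarrow> m e = m' e) \<Longrightarrow> charge bc n m f = charge bc n m' f"
  unfolding charge_def by (intro arg_cong2[where f = "(-)"] sum.cong) auto

text \<open>
  The faces whose unit charge is the charge of an integer 1-form form a union of connected components
  of the dual graph containing the marked face; connectivity is \<open>zero_of_energy_zero\<close>.
\<close>

lemma charge_surj:
  assumes mf: "marked_face bc \<in> faces bc n"
  shows "\<exists>m :: edge \<Rightarrow> int. \<forall>f\<in>faces bc n - {marked_face bc}. charge bc n m f = q f"
proof -
  let ?F = "faces bc n - {marked_face bc}"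
  define S where "S = {g \<in> faces bc n. \<exists>m :: edge \<Rightarrow> int. \<forall>f\<in>?F. charge bc n m f = (if f = g then 1 else 0)}"
  define u :: "face \<Rightarrow> real" where "u f = (if f \<in> S \<or> f \<notin> faces bc n then 0 else 1)" for f
  have "charge bc n (\<lambda>_. 0 :: int) f = 0" for f by (simp add: charge_def)
  then have "marked_face bc \<in> S" unfolding S_def using mf by (auto intro!: exI[of _ "\<lambda>_. 0"])
  then have u: "u \<in> two_forms bc n" by (auto simp: two_forms_def u_def)
  have eq: "u (left_face bc n e) = u (right_face bc n e)" if e: "e \<in> edges bc n" for e
  proof -
    \<comment> \<open>The unit form on \<open>e\<close> has charge 1 on the left and -1 on the
      right, so it transports a unit charge across \<open>e\<close>.\<close>
    define \<delta> :: "edge \<Rightarrow> int" where "\<delta> = (\<lambda>e'. if e' = e then 1 else 0)"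
    have sum: "(\<Sum>e' | e' \<in> edges bc n \<and> h e' = f. \<delta> e') = (if f = h e then 1 else 0)" for h :: "edge \<Rightarrow> face" and f
      using e finite_edges[of bc n] unfolding \<delta>_def by (subst sum.delta) auto
    have \<delta>: "charge bc n \<delta> f = (if f = left_face bc n e then 1 else 0) - (if f = right_face bc n e then 1 else 0)" for f
      unfolding charge_def sum ..
    have "left_face bc n e \<in> S \<longleftrightarrow> right_face bc n e \<in> S"
    proof
      assume "left_face bc n e \<in> S"
      then obtain m :: "edge \<Rightarrow> int" where "\<forall>f\<in>?F. charge bc n m f = (if f = left_face bc n e then 1 else 0)"
        unfolding S_def by blast
      then show "right_face bc n e \<in> S" unfolding S_def using sides_in_faces[OF e]
        by (auto intro!: exI[of _ "\<lambda>e. m e - \<delta> e"] simp: charge_diff \<delta>)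
    next
      assume "right_face bc n e \<in> S"
      then obtain m :: "edge \<Rightarrow> int" where "\<forall>f\<in>?F. charge bc n m f = (if f = right_face bc n e then 1 else 0)"
        unfolding S_def by blast
      then show "left_face bc n e \<in> S" unfolding S_def using sides_in_faces[OF e]
        by (auto intro!: exI[of _ "\<lambda>e. m e + \<delta> e"] simp: charge_add \<delta>)
    qed
    then show ?thesis using sides_in_faces[OF e] by (simp add: u_def)
  qed
  have "g \<in> S" if "g \<in> faces bc n" for g
    using zero_of_energy_zero[OF u mf eq, of g] that by (auto simp: u_def split: if_splits)
  then have "\<exists>m :: edge \<Rightarrow> int. \<forall>f\<in>?F. charge bc n m f = (if f = g then 1 else 0)" if "g \<in> ?F" for g
    using that unfolding S_def by blast
  then obtain m where m: "charge bc n (m g) f = (if f = g then 1 else (0::int))" if "g \<in> ?F" "f \<in> ?F" for g f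
    by metis
  have "charge bc n (\<lambda>e. \<Sum>g\<in>?F. q g * m g e) f = q f" if "f \<in> ?F" for f
    using that finite_faces[of bc n] unfolding charge_sum charge_mult
    by (simp add: m if_distrib[of "\<lambda>c. _ * c"] cong: if_cong)
  then show ?thesis by blast
qed

section \<open>The variance of the Coulomb gas\<close>

abbreviation side_diff :: "boundary \<Rightarrow> nat \<Rightarrow> (face \<Rightarrow> real) \<Rightarrow> edge \<Rightarrow> real" where
  "side_diff bc n u e \<equiv> u (left_face bc n e) - u (right_face bc n e)"

lemma charge_side_diff:
  assumes "f \<in> faces bc n - {marked_face bc}"
  shows "charge bc n (side_diff bc n u) f = - laplacian bc n u f"
proof -
  have "(\<Sum>e | e \<in> edges bc n \<and> left_face bc n e = f. side_diff bc n u e) =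
      - (\<Sum>e | e \<in> edges bc n \<and> left_face bc n e = f. u (right_face bc n e) - u f)"
    unfolding sum_negf[symmetric] by (intro sum.cong) auto
  moreover have "(\<Sum>e | e \<in> edges bc n \<and> right_face bc n e = f. side_diff bc n u e) =
      (\<Sum>e | e \<in> edges bc n \<and> right_face bc n e = f. u (left_face bc n e) - u f)"
    by (intro sum.cong) auto
  ultimately show ?thesis using assms by (simp add: charge_def laplacian_def to_form_def)
qed

text \<open>Pairing with \<open>h\<close> can be computed from any 1-form whose charge is
  \<open>h\<close>; the marked face drops out since \<open>v\<close> vanishes there.\<close>

lemma form_inner_two_form:
  assumes v: "v \<in> two_forms bc n" and m: "\<And>f. f \<in> faces bc n - {marked_face bc} \<Longrightarrow> charge bc n m f = h f"
  shows "form_inner bc n v h = (\<Sum>e\<in>edges bc n. side_diff bc n v e * m e)"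
proof -
  have "v f * h f = v f * charge bc n m f" if "f \<in> faces bc n" for f
    using that v m[of f] by (cases "f = marked_face bc") (simp_all add: two_forms_def)
  then have "form_inner bc n v h = (\<Sum>f\<in>faces bc n. v f * charge bc n m f)"
    unfolding form_inner_def by (intro sum.cong) auto
  then show ?thesis by (simp add: sum_charge)
qed

lemma charge_inv_neg_laplacian:
  assumes mf: "marked_face bc \<in> faces bc n" and f: "f \<in> faces bc n - {marked_face bc}"
  shows "charge bc n (side_diff bc n (inv_neg_laplacian bc n g)) f = g f"
  using f charge_side_diff[OF f] inv_neg_laplacian_works(2)[OF mf, of g f] by (simp add: to_form_def)

lemma green_form_energy:
  assumes mf: "marked_face bc \<in> faces bc n"
  shows "green_form bc n g = (\<Sum>e\<in>edges bc n. (side_diff bc n (inv_neg_laplacian bc n g) e)\<^sup>2)"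
proof -
  let ?u = "inv_neg_laplacian bc n g"
  have "green_form bc n g = form_inner bc n ?u (to_form bc n g)"
    by (simp add: green_form_def form_inner_def mult.commute)
  also have "\<dots> = (\<Sum>e\<in>edges bc n. side_diff bc n ?u e * side_diff bc n ?u e)"
    by (rule form_inner_two_form[OF inv_neg_laplacian_works(1)[OF mf]])
       (simp add: charge_inv_neg_laplacian[OF mf] to_form_def)
  finally show ?thesis by (simp add: power2_eq_square)
qed

lemma inv_laplacian_works:
  assumes mf: "marked_face bc \<in> faces bc n"
  shows "inv_laplacian bc n g \<in> two_forms bc n" "laplacian bc n (inv_laplacian bc n g) = to_form bc n g"
proof -
  have g: "to_form bc n g \<in> two_forms bc n" by (simp add: two_forms_def to_form_def)
  note b = laplacian_bij[OF mf]
  show "inv_laplacian bc n g \<in> two_forms bc n"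
    unfolding inv_laplacian_def using bij_betw_apply[OF bij_betw_the_inv_into[OF b] g] .
  show "laplacian bc n (inv_laplacian bc n g) = to_form bc n g"
    unfolding inv_laplacian_def using f_the_inv_into_f_bij_betw[OF b, of "to_form bc n g"] g by blast
qed

text \<open>The freedom in \<open>m\<close> is essential: the integer representative makes the
  observable a linear statistic of the Villain form, and the gradient of the potential of
  \<open>q\<close> gives the Cauchy-Schwarz bound for its second moment.\<close>

lemma form_inner_inv_laplacian:
  assumes mf: "marked_face bc \<in> faces bc n"
    and m: "\<And>f. f \<in> faces bc n - {marked_face bc} \<Longrightarrow> charge bc n m f = q f"
  shows "form_inner bc n (inv_laplacian bc n q) g =
    (\<Sum>e\<in>edges bc n. - side_diff bc n (inv_neg_laplacian bc n g) e * m e)"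
proof -
  let ?z = "inv_laplacian bc n q" and ?u = "inv_neg_laplacian bc n g"
  have z: "charge bc n (side_diff bc n ?z) f = - q f" if "f \<in> faces bc n - {marked_face bc}" for f
    using that charge_side_diff[OF that, of ?z] inv_laplacian_works(2)[OF mf, of q] by (simp add: to_form_def)
  have "form_inner bc n ?z g = (\<Sum>e\<in>edges bc n. side_diff bc n ?z e * side_diff bc n ?u e)"
    by (intro form_inner_two_form inv_laplacian_works(1)[OF mf] charge_inv_neg_laplacian[OF mf])
  also have "\<dots> = (\<Sum>e\<in>edges bc n. side_diff bc n ?u e * side_diff bc n ?z e)" by (simp add: mult.commute)
  also have "\<dots> = form_inner bc n ?u (\<lambda>f. - q f)"
    by (rule form_inner_two_form[symmetric, OF inv_neg_laplacian_works(1)[OF mf] z])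
  also have "\<dots> = - form_inner bc n ?u q" by (simp add: form_inner_def sum_negf)
  also have "form_inner bc n ?u q = (\<Sum>e\<in>edges bc n. side_diff bc n ?u e * m e)"
    by (rule form_inner_two_form[OF inv_neg_laplacian_works(1)[OF mf] m])
  finally show ?thesis by (simp only: sum_negf[symmetric] mult_minus_left)
qed

text \<open>Hodge decomposition: \<open>rep q\<close> and the gradient of the potential of
  \<open>q\<close> have the same charge, so their difference is closed and hence exact over the
  reals. Exactness over the integers gives the bijection.\<close>

lemma coulomb_charges:
  assumes mf: "marked_face bc \<in> faces bc n" and b: "b > 0"
  shows "\<exists>rep \<alpha>. charges (free_sites bc n) (edges bc n) incidence b (two_forms bc n) rep \<alpha>
      (\<lambda>q. side_diff bc n (inv_neg_laplacian bc n (\<lambda>f. real_of_int (q f)))) \<and>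
    (\<forall>q. \<forall>f\<in>faces bc n - {marked_face bc}. charge bc n (rep q) f = q f)"
proof -
  let ?E = "edges bc n" and ?F = "faces bc n - {marked_face bc}"
  let ?j = "\<lambda>q :: face \<Rightarrow> int. side_diff bc n (inv_neg_laplacian bc n (\<lambda>f. real_of_int (q f)))"
  define rep where "rep q = (SOME m :: edge \<Rightarrow> int. \<forall>f\<in>?F. charge bc n m f = q f)" for q
  have rep: "charge bc n (rep q) f = q f" if "f \<in> ?F" for q f
    using someI_ex[OF charge_surj[OF mf, of q]] that unfolding rep_def by blast
  have "\<exists>a. \<forall>e\<in>?E. real_of_int (rep q e) - ?j q e = site_grad bc n a e" for q
  proof -
    have "charge bc n (\<lambda>e. real_of_int (rep q e) - ?j q e) f = 0" if "f \<in> ?F" for f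
    proof -
      have "charge bc n (\<lambda>e. real_of_int (rep q e) - ?j q e) f =
          charge bc n (\<lambda>e. real_of_int (rep q e)) f - charge bc n (?j q) f"
        by (rule charge_diff)
      then show ?thesis
        using that by (simp only: charge_of_int rep charge_inv_neg_laplacian[OF mf] diff_self)
    qed
    from closed_imp_exact[OF mf this] show ?thesis by blast
  qed
  then have "\<exists>\<alpha>. \<forall>q. \<forall>e\<in>?E. real_of_int (rep q e) - ?j q e = site_grad bc n (\<alpha> q) e"
    by (intro choice allI)
  then obtain \<alpha> where \<alpha>: "\<forall>q. \<forall>e\<in>?E. real_of_int (rep q e) - ?j q e = site_grad bc n (\<alpha> q) e" ..
  let ?Z = "{k. \<forall>v. v \<notin> free_sites bc n \<longrightarrow> k v = (0::int)}"
  let ?f = "\<lambda>(q, k) e. if e \<in> ?E then rep q e + site_grad bc n k e else 0"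
  have ch: "charge bc n (?f (q, k)) f = q f" if "f \<in> ?F" for q k f
  proof -
    have "charge bc n (?f (q, k)) f = charge bc n (\<lambda>e. rep q e + site_grad bc n k e) f"
      by (rule charge_cong) simp
    then show ?thesis using that by (simp only: charge_add rep charge_site_grad add_0_right)
  qed
  have "bij_betw ?f (two_forms bc n \<times> ?Z) {m. \<forall>e. e \<notin> ?E \<longrightarrow> m e = 0}"
    unfolding bij_betw_def
  proof
    show "inj_on ?f (two_forms bc n \<times> ?Z)"
    proof (rule inj_onI, clarify)
      fix q k q' k'
      assume q: "q \<in> two_forms bc n" "q' \<in> two_forms bc n"
        and k: "\<forall>v. v \<notin> free_sites bc n \<longrightarrow> k v = 0" "\<forall>v. v \<notin> free_sites bc n \<longrightarrow> k' v = 0"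
        and eq: "(\<lambda>e. if e \<in> ?E then rep q e + site_grad bc n k e else 0) =
          (\<lambda>e. if e \<in> ?E then rep q' e + site_grad bc n k' e else 0)"
      have "q f = q' f" if "f \<in> ?F" for f
        using ch[OF that, of q k] ch[OF that, of q' k'] eq by simp
      moreover have "q f = q' f" if "f \<notin> ?F" for f
        using that q unfolding two_forms_def by (cases "f = marked_face bc") auto
      ultimately have qq: "q = q'" by (intro ext) blast
      have "site_grad bc n (\<lambda>v. k v + - k' v) e = 0" if "e \<in> ?E" for e
        using fun_cong[OF eq, of e] that unfolding qq grad_add grad_uminus by simp
      moreover have "k v + - k' v = 0" if "v \<notin> free_sites bc n" for v
        using k(1)[rule_format, OF that] k(2)[rule_format, OF that] by simp
      ultimately have "k v + - k' v = 0" for v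
        by (intro site_grad_zero[of bc n "\<lambda>v. k v + - k' v" v])
      then show "q = q' \<and> k = k'" using qq by (auto simp: fun_eq_iff)
    qed
    show "?f ` (two_forms bc n \<times> ?Z) = {m. \<forall>e. e \<notin> ?E \<longrightarrow> m e = 0}"
    proof (intro equalityI subsetI)
      fix m assume m: "m \<in> {m. \<forall>e. e \<notin> ?E \<longrightarrow> m e = (0::int)}"
      define q where "q f = (if f \<in> ?F then charge bc n m f else 0)" for f
      have q: "q \<in> two_forms bc n" by (auto simp: two_forms_def q_def)
      have "charge bc n (\<lambda>e. m e - rep q e) f = 0" if "f \<in> ?F" for f
        using that rep[OF that, of q] by (simp add: charge_diff q_def)
      from closed_imp_exact[OF mf this] obtain k where
        k: "k \<in> ?Z" "\<forall>e\<in>?E. m e - rep q e = site_grad bc n k e" by blast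
      have "m = ?f (q, k)"
        using m k(2) by (auto simp: fun_eq_iff algebra_simps)
      then show "m \<in> ?f ` (two_forms bc n \<times> ?Z)" using q k(1) by blast
    qed auto
  qed
  moreover have "real_of_int (rep q e) = site_grad bc n (\<alpha> q) e + ?j q e" if "e \<in> ?E" for q e
    using \<alpha>[rule_format, OF that, of q] by simp
  moreover have "(\<Sum>e\<in>?E. site_grad bc n \<phi> e * ?j q e) = 0" for \<phi> q
    by (rule two_form_coclosed[OF inv_neg_laplacian_works(1)[OF mf]])
  ultimately have "charges (free_sites bc n) ?E incidence b (two_forms bc n) rep \<alpha> ?j"
    using b by unfold_locales (auto simp: finite_free_sites finite_edges)
  then show ?thesis using rep by blast
qed

section \<open>Second moments and the variance bound for the gas\<close>

lemma coulomb_weight_pos: "q \<in> two_forms bc n \<Longrightarrow> coulomb_weight bc n \<beta> q > 0"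
  by (simp add: coulomb_weight_def)

lemma coulomb_weight_nonneg: "coulomb_weight bc n \<beta> q \<ge> 0"
  by (simp add: coulomb_weight_def)

text \<open>By Cauchy-Schwarz the square is at most the product of the Green energies of
  \<open>g\<close> and of \<open>q\<close>; halving \<open>\<beta>\<close> absorbs the
  latter.\<close>

lemma integrable_square_coulomb:
  assumes mf: "marked_face bc \<in> faces bc n" and \<beta>: "\<beta> > 0"
  shows "integrable (measure_pmf (coulomb bc n \<beta>))
    (\<lambda>q. (form_inner bc n (inv_laplacian bc n (\<lambda>f. real_of_int (q f))) g)\<^sup>2)"
proof (rule integrable_measure_pmf_if_summable)
  let ?F = "\<lambda>q. form_inner bc n (inv_laplacian bc n (\<lambda>f. real_of_int (q f))) g"
  let ?Z = "\<Sum>\<^sub>\<infinity>p. coulomb_weight bc n \<beta> p"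
  define b where "b = (2 * pi)\<^sup>2 * \<beta> / 2"
  define G where "G = green_form bc n g"
  have b: "b > 0" using \<beta> by (simp add: b_def)
  have G: "G \<ge> 0" unfolding G_def green_form_energy[OF mf] by (intro sum_nonneg) auto
  have sm: "(\<lambda>q. G * (2 / b) / ?Z * coulomb_weight bc n (\<beta> / 2) q) summable_on UNIV"
    using summable_coulomb_weight[OF mf, of "\<beta> / 2"] \<beta> by (intro summable_on_cmult_right) auto
  have Z: "?Z \<ge> 0" by (intro infsum_nonneg coulomb_weight_nonneg)
  show "(\<lambda>q. pmf (coulomb bc n \<beta>) q * \<bar>(?F q)\<^sup>2\<bar>) summable_on UNIV"
  proof (rule summable_on_comparison_test[OF sm])
    fix q :: "face \<Rightarrow> int"
    show "pmf (coulomb bc n \<beta>) q * \<bar>(?F q)\<^sup>2\<bar> \<le> G * (2 / b) / ?Z * coulomb_weight bc n (\<beta> / 2) q"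
    proof (cases "q \<in> two_forms bc n")
      case True
      define y where "y = green_form bc n (\<lambda>f. real_of_int (q f))"
      have "?F q = (\<Sum>e\<in>edges bc n. - side_diff bc n (inv_neg_laplacian bc n g) e *
          side_diff bc n (inv_neg_laplacian bc n (\<lambda>f. real_of_int (q f))) e)"
        by (rule form_inner_inv_laplacian[OF mf charge_inv_neg_laplacian[OF mf]])
      then have "(?F q)\<^sup>2 \<le> (\<Sum>e\<in>edges bc n. (- side_diff bc n (inv_neg_laplacian bc n g) e)\<^sup>2) *
          (\<Sum>e\<in>edges bc n. (side_diff bc n (inv_neg_laplacian bc n (\<lambda>f. real_of_int (q f))) e)\<^sup>2)"
        by (simp only: Cauchy_Schwarz_ineq_sum)
      also have "\<dots> = G * y"
        unfolding G_def y_def green_form_energy[OF mf] power2_minus ..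
      also have "\<dots> \<le> G * (2 / b * exp (b * y / 2))"
        using le_two_exp_half[of "b * y"] b G by (intro mult_left_mono) (auto simp: field_simps)
      finally have "exp (- b * y) * (?F q)\<^sup>2 \<le> exp (- b * y) * (G * (2 / b * exp (b * y / 2)))"
        by (intro mult_left_mono) auto
      also have "\<dots> = G * (2 / b) * (exp (- b * y) * exp (b * y / 2))" by simp
      also have "exp (- b * y) * exp (b * y / 2) = exp (- (b / 2) * y)" by (simp flip: exp_add)
      finally have "exp (- b * y) * (?F q)\<^sup>2 / ?Z \<le> G * (2 / b) * exp (- (b / 2) * y) / ?Z"
        using Z by (rule divide_right_mono)
      moreover have "coulomb_weight bc n \<beta> q = exp (- b * y)" "coulomb_weight bc n (\<beta> / 2) q = exp (- (b / 2) * y)"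
        using True by (simp_all add: coulomb_weight_def y_def b_def)
      ultimately show ?thesis unfolding pmf_coulomb[OF mf \<beta>] by simp
    next
      case False
      then show ?thesis unfolding pmf_coulomb[OF mf \<beta>] by (simp add: coulomb_weight_def)
    qed
  qed auto
qed

text \<open>\<open>variance_lower_bound\<close> normalised to the law of the gas. Finiteness of the
  Gaussian mass is available only inside \<open>charges\<close>, so it is offered as a premise in
  the hypothesis on \<open>L\<close>.\<close>

lemma coulomb_variance_ge:
  fixes g :: "face \<Rightarrow> real" and L :: "edge \<Rightarrow> real"
  assumes mf: "marked_face bc \<in> faces bc n" and \<beta>: "\<beta> > 0"
  defines "b \<equiv> (2 * pi)\<^sup>2 * \<beta>"
  assumes vf: "vf \<in> borel_measurable borel" "\<And>x. 0 \<le> vf x" "\<And>x. vf x \<le> Var_IG x b"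
      "\<And>x k. vf (x + real_of_int k) = vf x"
    and L: "\<And>e. e \<in> edges bc n \<Longrightarrow> 0 \<le> L e"
      "\<And>e t. e \<in> edges bc n \<Longrightarrow> gaussian_field.gauss (free_sites bc n) (edges bc n) incidence b (\<lambda>_. 1) < \<infinity> \<Longrightarrow>
        ennreal (L e) * gaussian_field.gauss (free_sites bc n) (edges bc n) incidence b (\<lambda>_. 1) \<le>
        gaussian_field.gauss (free_sites bc n) (edges bc n) incidence b (\<lambda>\<phi>. ennreal (vf (t - site_grad bc n \<phi> e)))"
  shows "(\<Sum>e\<in>edges bc n. (side_diff bc n (inv_neg_laplacian bc n g) e)\<^sup>2 * L e) \<le> coulomb_variance bc n \<beta> g"
proof -
  have b: "b > 0" using \<beta> by (simp add: b_def)
  obtain rep \<alpha> where ch: "charges (free_sites bc n) (edges bc n) incidence b (two_forms bc n) rep \<alpha>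
      (\<lambda>q. side_diff bc n (inv_neg_laplacian bc n (\<lambda>f. real_of_int (q f))))"
    and rep: "\<forall>q. \<forall>f\<in>faces bc n - {marked_face bc}. charge bc n (rep q) f = q f"
    using coulomb_charges[OF mf b] by (elim exE conjE)
  interpret charges "free_sites bc n" "edges bc n" incidence b "two_forms bc n" rep \<alpha>
    "\<lambda>q. side_diff bc n (inv_neg_laplacian bc n (\<lambda>f. real_of_int (q f)))" by (rule ch)
  define c where "c e = - side_diff bc n (inv_neg_laplacian bc n g) e" for e
  let ?F = "\<lambda>q :: face \<Rightarrow> int. form_inner bc n (inv_laplacian bc n (\<lambda>f. real_of_int (q f))) g"
  let ?p = "coulomb bc n \<beta>" and ?Z = "\<Sum>\<^sub>\<infinity>p. coulomb_weight bc n \<beta> p"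
  define \<mu> where "\<mu> = measure_pmf.expectation ?p ?F"
  have F: "?F q = (\<Sum>e\<in>edges bc n. c e * real_of_int (rep q e))" for q
    unfolding c_def by (rule form_inner_inv_laplacian[OF mf]) (simp add: charge_of_int rep)
  have w: "weight q = ennreal (coulomb_weight bc n \<beta> q)" if "q \<in> two_forms bc n" for q
    using that unfolding weight_def coulomb_weight_def green_form_energy[OF mf] unfolding b_def by simp
  have coc: "(\<Sum>e\<in>edges bc n. c e * site_grad bc n \<phi> e) = 0" for \<phi> :: "site \<Rightarrow> real"
  proof -
    have "(\<Sum>e\<in>edges bc n. c e * site_grad bc n \<phi> e) =
        - (\<Sum>e\<in>edges bc n. site_grad bc n \<phi> e * side_diff bc n (inv_neg_laplacian bc n g) e)"
      unfolding sum_negf[symmetric] by (intro sum.cong) (simp_all add: c_def algebra_simps)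
    then show ?thesis
      using two_form_coclosed[OF inv_neg_laplacian_works(1)[OF mf], where \<phi> = \<phi>] by simp
  qed
  have main: "ennreal (\<Sum>e\<in>edges bc n. (c e)\<^sup>2 * L e) * (\<integral>\<^sup>+q. weight q \<partial>count_space (two_forms bc n)) \<le>
    (\<integral>\<^sup>+q. ennreal ((?F q - \<mu>)\<^sup>2) * weight q \<partial>count_space (two_forms bc n))"
    unfolding F by (rule variance_lower_bound[OF coc vf L(1) L(2)[OF _ gauss_one_finite]])
  have Z: "?Z > 0"
  proof -
    have "0 < coulomb_weight bc n \<beta> (\<lambda>_. 0)" by (rule coulomb_weight_pos) (simp add: two_forms_def)
    also have "\<dots> = (\<Sum>\<^sub>\<infinity>p\<in>{\<lambda>_. 0}. coulomb_weight bc n \<beta> p)" by simp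
    also have "\<dots> \<le> ?Z"
      by (rule infsum_mono_neutral)
         (use summable_coulomb_weight[OF mf \<beta>] coulomb_weight_nonneg in auto)
    finally show ?thesis .
  qed
  have pm: "(\<integral>\<^sup>+q. H q * weight q \<partial>count_space (two_forms bc n)) = ennreal ?Z * (\<integral>\<^sup>+q. H q \<partial>measure_pmf ?p)" for H
  proof -
    have "(\<integral>\<^sup>+q. H q * weight q \<partial>count_space (two_forms bc n)) =
        (\<integral>\<^sup>+q. H q * ennreal (coulomb_weight bc n \<beta> q) \<partial>count_space (two_forms bc n))"
      by (intro nn_integral_cong) (simp add: w)
    also have "\<dots> = (\<integral>\<^sup>+q. H q * ennreal (coulomb_weight bc n \<beta> q) \<partial>count_space UNIV)"
      by (intro nn_integral_count_space_eq) (auto simp: coulomb_weight_def)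
    also have "\<dots> = (\<integral>\<^sup>+q. ennreal ?Z * (ennreal (pmf ?p q) * H q) \<partial>count_space UNIV)"
    proof (intro nn_integral_cong)
      fix q
      have "coulomb_weight bc n \<beta> q = ?Z * pmf ?p q"
        using Z by (simp add: pmf_coulomb[OF mf \<beta>])
      then show "H q * ennreal (coulomb_weight bc n \<beta> q) = ennreal ?Z * (ennreal (pmf ?p q) * H q)"
        using Z by (simp add: ennreal_mult mult_ac)
    qed
    also have "\<dots> = ennreal ?Z * (\<integral>\<^sup>+q. H q \<partial>measure_pmf ?p)"
      by (simp add: nn_integral_cmult nn_integral_measure_pmf)
    finally show ?thesis .
  qed
  have "ennreal ?Z * ennreal (\<Sum>e\<in>edges bc n. (c e)\<^sup>2 * L e) \<le> ennreal ?Z * (\<integral>\<^sup>+q. ennreal ((?F q - \<mu>)\<^sup>2) \<partial>measure_pmf ?p)"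
    using main pm[of "\<lambda>_. 1"] pm[of "\<lambda>q. ennreal ((?F q - \<mu>)\<^sup>2)"]
    by (simp add: measure_pmf.emeasure_space_1 mult.commute)
  then have "ennreal (\<Sum>e\<in>edges bc n. (c e)\<^sup>2 * L e) \<le> (\<integral>\<^sup>+q. ennreal ((?F q - \<mu>)\<^sup>2) \<partial>measure_pmf ?p)"
    using Z by (subst (asm) ennreal_mult_le_mult_iff) auto
  \<comment> \<open>\<open>\<mu>\<close> is the mean of the observable, so the squared bias is
    zero.\<close>
  also have "\<dots> = ennreal (coulomb_variance bc n \<beta> g)"
    using nn_integral_square_affine[OF integrable_square_coulomb[OF mf \<beta>], of 0 1 g \<mu>]
    by (simp add: coulomb_variance_def \<mu>_def)
  finally have "(\<Sum>e\<in>edges bc n. (c e)\<^sup>2 * L e) \<le> coulomb_variance bc n \<beta> g"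
    by (subst (asm) ennreal_le_iff) (simp_all add: coulomb_variance_def measure_pmf.variance_positive)
  then show ?thesis unfolding c_def power2_minus .
qed

text \<open>A constant is a periodic minorant, and the Gaussian expectation required of
  \<open>L\<close> is then an equality at every edge.\<close>

lemma coulomb_variance_ge_M:
  assumes mf: "marked_face bc \<in> faces bc n" and \<beta>: "\<beta> > 0"
  shows "M \<beta> / ((2 * pi)\<^sup>2 * \<beta>) * green_form bc n g \<le> coulomb_variance bc n \<beta> g"
proof -
  let ?b = "(2 * pi)\<^sup>2 * \<beta>"
  define I where "I = (INF a\<in>{0..1/2}. Var_IG a ?b)"
  have b: "?b > 0" using \<beta> by simp
  have I0: "I \<ge> 0" unfolding I_def by (intro cINF_greatest) (auto simp: Var_IG_nonneg)
  interpret gaussian_field "free_sites bc n" "edges bc n" incidence ?b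
    using b by unfold_locales (auto simp: finite_free_sites finite_edges)
  have "(\<Sum>e\<in>edges bc n. (side_diff bc n (inv_neg_laplacian bc n g) e)\<^sup>2 * I) \<le> coulomb_variance bc n \<beta> g"
  proof (rule coulomb_variance_ge[OF mf \<beta>, where vf = "\<lambda>_. I"])
    show "I \<le> Var_IG x ?b" for x unfolding I_def by (rule Var_IG_ge_INF[OF b])
    show "ennreal I * gauss (\<lambda>_. 1) \<le> gauss (\<lambda>\<phi>. ennreal I)"
      using gauss_cmult[of "\<lambda>_. 1" "ennreal I"] by simp
  qed (use I0 in auto)
  moreover have "M \<beta> / ?b = I"
    unfolding M_def I_def by (rule nonzero_mult_div_cancel_left) (use b in auto)
  ultimately show ?thesis by (simp add: green_form_energy[OF mf] sum_distrib_left mult.commute)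
qed

section \<open>Test functions for the effective resistance\<close>

text \<open>
  Foster's theorem: the energies \<open>R e\<close> of the optimal potentials, that is the effective resistances,
  add up to the number of vertices, so some edge has at least the average resistance.
\<close>

lemma foster_test_function:
  fixes D :: "'e \<Rightarrow> 'v \<Rightarrow> int"
  assumes V: "finite V" "V \<noteq> {}" and E: "finite E"
    and inj: "\<And>u :: 'v \<Rightarrow> real. (\<And>v. v \<notin> V \<Longrightarrow> u v = 0) \<Longrightarrow> (\<And>e. e \<in> E \<Longrightarrow> grad D V u e = 0) \<Longrightarrow> u = (\<lambda>_. 0)"
  shows "\<exists>e\<in>E. \<exists>h :: 'v \<Rightarrow> real. (\<forall>v. v \<notin> V \<longrightarrow> h v = 0) \<and> grad D V h e = 1 \<and>
    (\<Sum>e\<in>E. (grad D V h e)\<^sup>2) \<le> real (card E) / real (card V)"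
proof -
  define L :: "('v \<Rightarrow> real) \<Rightarrow> 'v \<Rightarrow> real" where "L u v = (\<Sum>e\<in>E. real_of_int (D e v) * grad D V u e)" for u v
  have pair: "(\<Sum>v\<in>V. \<phi> v * L u v) = (\<Sum>e\<in>E. grad D V \<phi> e * grad D V u e)" for \<phi> u
    unfolding L_def grad_def[of D V \<phi>] sum_distrib_left sum_distrib_right
    by (subst sum.swap) (simp add: mult_ac)
  have "\<exists>u. (\<forall>a. a \<notin> V \<longrightarrow> u a = 0) \<and> (\<forall>a\<in>V. L u a = h a)" for h
  proof (rule positive_definite_solvable[OF V(1)])
    show "L (\<lambda>x. u x + c * v x) a = L u a + c * L v a" for u v c a
      by (simp add: L_def grad_add grad_mult sum_distrib_left algebra_simps flip: sum.distrib)
    fix u assume u: "\<And>a. a \<notin> V \<Longrightarrow> u a = 0" "(\<Sum>a\<in>V. u a * L u a) = 0"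
    have "\<forall>e\<in>E. grad D V u e * grad D V u e = 0"
      using u(2) unfolding pair by (subst (asm) sum_nonneg_eq_0_iff) (auto simp: E)
    then show "u = (\<lambda>_. 0)" using u(1) by (intro inj) auto
  qed
  then obtain G where G: "\<And>h a. a \<notin> V \<Longrightarrow> G h a = 0" "\<And>h a. a \<in> V \<Longrightarrow> L (G h) a = h a"
    by metis
  define g where "g x = G (\<lambda>v. if v = x then 1 else 0)" for x
  have g: "(\<Sum>e\<in>E. grad D V \<phi> e * grad D V (g x) e) = \<phi> x" if "x \<in> V" for \<phi> x
  proof -
    have "(\<Sum>e\<in>E. grad D V \<phi> e * grad D V (g x) e) = (\<Sum>v\<in>V. \<phi> v * L (g x) v)" by (rule pair[symmetric])
    also have "\<dots> = (\<Sum>v\<in>V. if v = x then \<phi> v else 0)"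
      by (intro sum.cong) (auto simp: g_def G(2))
    finally show ?thesis using that V by simp
  qed
  \<comment> \<open>\<open>h e\<close> represents the functional \<open>grad D V \<phi> e\<close> of
    \<open>\<phi>\<close> in the energy inner product: the potential of a unit current sent through
    \<open>e\<close>.\<close>
  define h where "h e v = (\<Sum>x\<in>V. real_of_int (D e x) * g x v)" for e v
  have grad_h: "grad D V (h e) e' = (\<Sum>x\<in>V. real_of_int (D e x) * grad D V (g x) e')" for e e'
    unfolding h_def grad_def sum_distrib_left by (subst sum.swap) (simp add: mult_ac)
  have rep: "(\<Sum>e'\<in>E. grad D V \<phi> e' * grad D V (h e) e') = grad D V \<phi> e" for \<phi> e
  proof -
    have "(\<Sum>e'\<in>E. grad D V \<phi> e' * grad D V (h e) e') =
        (\<Sum>x\<in>V. real_of_int (D e x) * (\<Sum>e'\<in>E. grad D V \<phi> e' * grad D V (g x) e'))"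
      unfolding grad_h sum_distrib_left by (subst sum.swap) (simp add: mult_ac)
    also have "\<dots> = grad D V \<phi> e" using g by (simp add: grad_def)
    finally show ?thesis .
  qed
  define R where "R e = grad D V (h e) e" for e
  \<comment> \<open>The \<open>R e\<close> are the diagonal entries of the orthogonal projection
    onto gradients, whose trace is its rank.\<close>
  have "(\<Sum>e\<in>E. R e) = (\<Sum>x\<in>V. L (g x) x)"
    unfolding R_def grad_h L_def by (rule sum.swap)
  also have "\<dots> = (\<Sum>x\<in>V. 1)" by (intro sum.cong) (auto simp: g_def G(2))
  finally have total: "(\<Sum>e\<in>E. R e) = real (card V)" by simp
  have cV: "card V > 0" using V by (simp add: card_gt_0_iff)
  have cE: "card E > 0"
    using total cV E by (cases "E = {}") (auto simp: card_gt_0_iff)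
  have "\<exists>e\<in>E. real (card V) / real (card E) \<le> R e"
  proof (rule ccontr)
    assume "\<not> ?thesis"
    then have "(\<Sum>e\<in>E. R e) < (\<Sum>e\<in>E. real (card V) / real (card E))"
      using cE E by (intro sum_strict_mono) (auto simp: not_le card_gt_0_iff)
    then show False using cE total by simp
  qed
  then obtain e where e: "e \<in> E" "real (card V) / real (card E) \<le> R e" by blast
  have R: "R e > 0" using e(2) cV cE by (meson divide_pos_pos less_le_trans of_nat_0_less_iff)
  \<comment> \<open>Rescaling to unit gradient at \<open>e\<close> turns the energy
    \<open>R e\<close> into its inverse.\<close>
  let ?h = "\<lambda>v. (1 / R e) * h e v"
  have "(\<Sum>e'\<in>E. (grad D V ?h e')\<^sup>2) = (1 / R e)\<^sup>2 * (\<Sum>e'\<in>E. grad D V (h e) e' * grad D V (h e) e')"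
    unfolding grad_mult by (simp add: power_mult_distrib sum_distrib_left power2_eq_square)
  also have "\<dots> = 1 / R e" unfolding rep using R by (simp add: R_def power2_eq_square)
  also have "\<dots> \<le> 1 / (real (card V) / real (card E))"
    using e(2) cV cE R by (intro divide_left_mono) auto
  finally have "(\<Sum>e'\<in>E. (grad D V ?h e')\<^sup>2) \<le> real (card E) / real (card V)" by simp
  moreover have "grad D V ?h e = 1" unfolding grad_mult using R by (simp add: R_def)
  moreover have "\<forall>v. v \<notin> V \<longrightarrow> ?h v = 0" by (simp add: h_def g_def G(1))
  ultimately show ?thesis using e(1) by (intro bexI[of _ e] exI[of _ ?h]) auto
qed

section \<open>Test functions on the square lattice and on the graphs\<close>

abbreviation lattice_grad :: "(site \<Rightarrow> real) \<Rightarrow> edge \<Rightarrow> real" where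
  "lattice_grad h e \<equiv> h (head_site e) - h (tail_site e)"

lemma lattice_grad_outside:
  assumes "\<And>v. v \<notin> sites n \<Longrightarrow> h v = 0" "e \<notin> edges (Dirichlet s) n"
  shows "lattice_grad h e = 0"
proof -
  have "ends e = {head_site e, tail_site e}" by (cases e rule: ends.cases) auto
  then show ?thesis using assms by auto
qed

lemma card_edges_Dirichlet_le: "card (edges (Dirichlet s) n) \<le> 2 * ((2 * n + 1) * (2 * n + 2))"
proof -
  let ?A = "{- int n - 1..int n} \<times> {- int n..int n}" and ?B = "{- int n..int n} \<times> {- int n - 1..int n}"
  have sub: "edges (Dirichlet s) n \<subseteq> Horizontal ` ?A \<union> Vertical ` ?B"
  proof
    fix e assume "e \<in> edges (Dirichlet s) n"
    then show "e \<in> Horizontal ` ?A \<union> Vertical ` ?B"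
      by (cases e rule: ends.cases) (auto simp: in_graph simp del: edges.simps)
  qed
  have "card (edges (Dirichlet s) n) \<le> card (Horizontal ` ?A \<union> Vertical ` ?B)"
    by (rule card_mono[OF _ sub]) simp
  also have "\<dots> \<le> card (Horizontal ` ?A) + card (Vertical ` ?B)" by (rule card_Un_le)
  also have "\<dots> \<le> card ?A + card ?B" by (intro add_mono card_image_le) auto
  also have "\<dots> = 2 * ((2 * n + 1) * (2 * n + 2))"
  proof -
    have "card {- int n..int n} = 2 * n + 1" "card {- int n - 1..int n} = 2 * n + 2"
      by (simp_all add: nat_eq_iff)
    then show ?thesis by (simp only: card_cartesian_product mult.commute mult_2)
  qed
  finally show ?thesis .
qed

lemma card_sites: "card (sites n) = (2 * n + 1)\<^sup>2"
proof -
  have "card {- int n..int n} = 2 * n + 1" by (simp add: nat_eq_iff)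
  then show ?thesis by (simp only: sites_def card_cartesian_product power2_eq_square)
qed

text \<open>The bound is an upper bound for the number of edges per site of the box. Foster's
  averaging does not tell where the edge \<open>e\<close> lies. Any finite \<open>A\<close> is
  allowed because the gradient vanishes off the box.\<close>

lemma box_test_function:
  "\<exists>e h. e \<in> edges (Dirichlet s) N \<and> (\<forall>v. v \<notin> sites N \<longrightarrow> h v = 0) \<and> lattice_grad h e = 1 \<and>
    (\<forall>A. finite A \<longrightarrow> (\<Sum>e\<in>A. (lattice_grad h e)\<^sup>2) \<le> 2 + 2 / (2 * real N + 1))"
proof -
  let ?E = "edges (Dirichlet s) N"
  have "\<exists>e\<in>?E. \<exists>h :: site \<Rightarrow> real. (\<forall>v. v \<notin> sites N \<longrightarrow> h v = 0) \<and> grad incidence (sites N) h e = 1 \<and>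
    (\<Sum>e\<in>?E. (grad incidence (sites N) h e)\<^sup>2) \<le> real (card ?E) / real (card (sites N))"
  proof (rule foster_test_function)
    have "(0, 0) \<in> sites N" by (simp add: mem_sites)
    then show "sites N \<noteq> {}" by blast
    fix u :: "site \<Rightarrow> real"
    assume u: "\<And>v. v \<notin> sites N \<Longrightarrow> u v = 0" "\<And>e. e \<in> ?E \<Longrightarrow> grad incidence (sites N) u e = 0"
    show "u = (\<lambda>_. 0)"
      by (rule ext, rule site_grad_zero[of "Dirichlet s" N u]) (use u in \<open>simp_all del: edges.simps\<close>)
  qed (rule finite_sites finite_edges)+
  then obtain e and h :: "site \<Rightarrow> real" where e: "e \<in> ?E" and h: "\<forall>v. v \<notin> sites N \<longrightarrow> h v = 0"
    and he: "grad incidence (sites N) h e = 1"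
    and en: "(\<Sum>e\<in>?E. (grad incidence (sites N) h e)\<^sup>2) \<le> real (card ?E) / real (card (sites N))" by blast
  have gr: "grad incidence (sites N) h e = lattice_grad h e" for e
    using h by (intro grad_incidence_supported finite_sites) auto
  have "real (card ?E) / real (card (sites N)) \<le> real (2 * ((2 * N + 1) * (2 * N + 2))) / real ((2 * N + 1)\<^sup>2)"
    unfolding card_sites using card_edges_Dirichlet_le[of s N]
    by (intro divide_right_mono) (simp_all only: of_nat_le_iff of_nat_0_le_iff)
  also have "\<dots> = 2 + 2 / (2 * real N + 1)"
  proof -
    define r where "r = 2 * real N + 1"
    have "r > 0" by (simp add: r_def)
    have "real (2 * ((2 * N + 1) * (2 * N + 2))) = 2 * (r * (r + 1))" "real ((2 * N + 1)\<^sup>2) = r * r"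
      by (simp_all add: r_def power2_eq_square algebra_simps)
    then have "real (2 * ((2 * N + 1) * (2 * N + 2))) / real ((2 * N + 1)\<^sup>2) = 2 * (r * (r + 1)) / (r * r)"
      by (simp only:)
    also have "\<dots> = 2 + 2 / r" using \<open>r > 0\<close> by (simp add: field_simps)
    finally show ?thesis by (simp only: r_def)
  qed
  finally have en': "(\<Sum>e\<in>?E. (lattice_grad h e)\<^sup>2) \<le> 2 + 2 / (2 * real N + 1)" using en unfolding gr by linarith
  have "(\<Sum>e\<in>A. (lattice_grad h e)\<^sup>2) \<le> 2 + 2 / (2 * real N + 1)" if A: "finite A" for A
  proof -
    have "(\<Sum>e\<in>A. (lattice_grad h e)\<^sup>2) = (\<Sum>e\<in>A \<inter> ?E. (lattice_grad h e)\<^sup>2)"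
      using A lattice_grad_outside[of N h _ s] h by (intro sum.mono_neutral_right) auto
    also have "\<dots> \<le> (\<Sum>e\<in>?E. (lattice_grad h e)\<^sup>2)"
      by (intro sum_mono2 finite_edges) auto
    finally show ?thesis using en' by linarith
  qed
  then show ?thesis using e h he unfolding gr by blast
qed

text \<open>Translations and the diagonal reflection act transitively on lattice edges, so the edge
  found by averaging can be moved to a prescribed one. That edge may start one step outside the box
  of radius \<open>N\<close>, whence the support radius \<open>2 * N + 1\<close>.\<close>

lemma lattice_test_function:
  "\<exists>h. lattice_grad h e = 1 \<and>
    (\<forall>A. finite A \<longrightarrow> (\<Sum>e\<in>A. (lattice_grad h e)\<^sup>2) \<le> 2 + 2 / (2 * real N + 1)) \<and>
    (\<forall>x y. h (x, y) \<noteq> 0 \<longrightarrow> \<bar>x - fst (tail_site e)\<bar> \<le> 2 * int N + 1 \<and> \<bar>y - snd (tail_site e)\<bar> \<le> 2 * int N + 1)"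
proof -
  obtain e0 and h :: "site \<Rightarrow> real" where e0: "e0 \<in> edges (Dirichlet (0, 0)) N" and h: "\<forall>v. v \<notin> sites N \<longrightarrow> h v = 0"
    and h1: "lattice_grad h e0 = 1"
    and en: "\<forall>A. finite A \<longrightarrow> (\<Sum>e\<in>A. (lattice_grad h e)\<^sup>2) \<le> 2 + 2 / (2 * real N + 1)"
    using box_test_function[of "(0, 0)" N] by blast
  have tail: "tail_site e0 \<in> {- int N - 1..int N} \<times> {- int N - 1..int N}"
    using e0 by (cases e0 rule: ends.cases) (auto simp: in_graph simp del: edges.simps)
  have pull: ?thesis
    if T: "inj T" "\<And>e. head_site (T e) = \<tau> (head_site e)" "\<And>e. tail_site (T e) = \<tau> (tail_site e)" "T e = e0"
      and \<tau>: "\<And>x y. \<tau> (x, y) \<in> sites N \<Longrightarrow>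
        \<bar>x - fst (tail_site e)\<bar> \<le> 2 * int N + 1 \<and> \<bar>y - snd (tail_site e)\<bar> \<le> 2 * int N + 1"
    for T :: "edge \<Rightarrow> edge" and \<tau> :: "site \<Rightarrow> site"
  proof (intro exI[of _ "\<lambda>v. h (\<tau> v)"] conjI allI impI)
    have gr: "lattice_grad (\<lambda>v. h (\<tau> v)) e' = lattice_grad h (T e')" for e' using T by simp
    show "lattice_grad (\<lambda>v. h (\<tau> v)) e = 1" unfolding gr T(4) by (rule h1)
    show "(\<Sum>e'\<in>A. (lattice_grad (\<lambda>v. h (\<tau> v)) e')\<^sup>2) \<le> 2 + 2 / (2 * real N + 1)" if A: "finite A" for A
    proof -
      have "(\<Sum>e'\<in>A. (lattice_grad (\<lambda>v. h (\<tau> v)) e')\<^sup>2) = (\<Sum>e'\<in>T ` A. (lattice_grad h e')\<^sup>2)"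
        unfolding gr using T(1) by (subst sum.reindex) (auto intro: inj_on_subset)
      then show ?thesis using en A by simp
    qed
    fix x y assume "h (\<tau> (x, y)) \<noteq> 0"
    then have "\<tau> (x, y) \<in> sites N" using h by blast
    from \<tau>[OF this] show "\<bar>x - fst (tail_site e)\<bar> \<le> 2 * int N + 1" "\<bar>y - snd (tail_site e)\<bar> \<le> 2 * int N + 1" by auto
  qed
  define shift :: "site \<Rightarrow> edge \<Rightarrow> edge" where
    "shift = (\<lambda>(a, c) e. case e of Horizontal (x, y) \<Rightarrow> Horizontal (x + a, y + c) | Vertical (x, y) \<Rightarrow> Vertical (x + a, y + c))"
  \<comment> \<open>The diagonal reflection exchanges right and up, so it respects the orientation
    of the edges.\<close>
  define flip :: "site \<Rightarrow> edge \<Rightarrow> edge" where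
    "flip = (\<lambda>(a, c) e. case e of Horizontal (x, y) \<Rightarrow> Vertical (y + a, x + c) | Vertical (x, y) \<Rightarrow> Horizontal (y + a, x + c))"
  obtain x y where t: "tail_site e = (x, y)" by (cases "tail_site e")
  obtain x0 y0 where t0: "tail_site e0 = (x0, y0)" by (cases "tail_site e0")
  have b0: "- int N - 1 \<le> x0" "x0 \<le> int N" "- int N - 1 \<le> y0" "y0 \<le> int N" using tail t0 by auto
  consider "(\<exists>v. e = Horizontal v) = (\<exists>v. e0 = Horizontal v)" | "(\<exists>v. e = Horizontal v) \<noteq> (\<exists>v. e0 = Horizontal v)" by blast
  then show ?thesis
  proof cases
    case 1
    show ?thesis
    proof (rule pull[of "shift (x0 - x, y0 - y)" "\<lambda>(a, c). (a + (x0 - x), c + (y0 - y))"])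
      show "inj (shift (x0 - x, y0 - y))"
        by (rule injI) (auto simp: shift_def split: edge.splits prod.splits)
      show "shift (x0 - x, y0 - y) e = e0"
        using 1 t t0 by (cases e; cases e0) (auto simp: shift_def)
    qed (use b0 t in \<open>auto simp: shift_def mem_sites split: edge.splits prod.splits\<close>)
  next
    case 2
    show ?thesis
    proof (rule pull[of "flip (x0 - y, y0 - x)" "\<lambda>(a, c). (c + (x0 - y), a + (y0 - x))"])
      show "inj (flip (x0 - y, y0 - x))"
        by (rule injI) (auto simp: flip_def split: edge.splits prod.splits)
      show "flip (x0 - y, y0 - x) e = e0"
        using 2 t t0 by (cases e; cases e0) (auto simp: flip_def)
    qed (use b0 t in \<open>auto simp: flip_def mem_sites split: edge.splits prod.splits\<close>)
  qed
qed

text \<open>In the free graph, restricting to the box only discards energy and a constant can be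
  subtracted to ground the origin, so every edge qualifies. With Dirichlet conditions the support
  has to fit into the box, which requires a margin of \<open>2 * N + 1\<close>.\<close>

lemma graph_test_function:
  assumes e: "e \<in> edges bc n"
    and inner: "bc = Free \<or> tail_site e \<in> {- (int n - 2 * int N - 1)..int n - 2 * int N - 1} \<times> {- (int n - 2 * int N - 1)..int n - 2 * int N - 1}"
  shows "\<exists>h :: site \<Rightarrow> real. site_grad bc n h e = 1 \<and>
    (\<Sum>e\<in>edges bc n. (site_grad bc n h e)\<^sup>2) \<le> 2 + 2 / (2 * real N + 1)"
proof -
  obtain h :: "site \<Rightarrow> real" where h1: "lattice_grad h e = 1"
    and en: "\<forall>A. finite A \<longrightarrow> (\<Sum>e\<in>A. (lattice_grad h e)\<^sup>2) \<le> 2 + 2 / (2 * real N + 1)"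
    and supp: "\<forall>x y. h (x, y) \<noteq> 0 \<longrightarrow> \<bar>x - fst (tail_site e)\<bar> \<le> 2 * int N + 1 \<and> \<bar>y - snd (tail_site e)\<bar> \<le> 2 * int N + 1"
    using lattice_test_function[of e N] by blast
  define c where "c = (if bc = Free then h (0, 0) else 0)"
  define h' where "h' v = (if v \<in> free_sites bc n then h v - c else 0)" for v
  have gr: "site_grad bc n h' e' = lattice_grad h e'" if e': "e' \<in> edges bc n" for e'
  proof -
    have "site_grad bc n h' e' = lattice_grad h' e'"
      by (intro grad_incidence_supported finite_free_sites) (simp add: h'_def)
    also have "\<dots> = lattice_grad h e'"
    proof (cases bc)
      case Free
      have "h' v = h v - h (0, 0)" if "v \<in> sites n" for v using that Free by (auto simp: h'_def c_def)
      then show ?thesis using e' Free by (cases e' rule: ends.cases) auto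
    next
      case (Dirichlet s)
      have "h v = 0" if v: "v \<notin> sites n" for v
      proof (rule ccontr)
        assume "h v \<noteq> 0"
        then show False using supp[rule_format, of "fst v" "snd v"] inner v Dirichlet
          by (cases v; cases "tail_site e") (auto simp: mem_sites)
      qed
      then have "h' = h" using Dirichlet by (auto simp: h'_def c_def)
      then show ?thesis by simp
    qed
    finally show ?thesis .
  qed
  have "(\<Sum>e\<in>edges bc n. (site_grad bc n h' e)\<^sup>2) = (\<Sum>e\<in>edges bc n. (lattice_grad h e)\<^sup>2)"
    by (intro sum.cong) (simp_all add: gr)
  then show ?thesis using en finite_edges[of bc n] gr[OF e] h1 by (intro exI[of _ h']) auto
qed

section \<open>Concentration of the energy\<close>

lemma left_face_Dirichlet:
  assumes "e \<in> edges (Dirichlet s) n"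
  shows "left_face (Dirichlet s) n e = Square (fst (sides e))" "right_face (Dirichlet s) n e = Square (snd (sides e))"
  using sides_in_faces[OF assms]
  by (auto simp: left_face_def right_face_def face_at_def split: if_splits)

lemma green_form_eq_form_inner:
  assumes mf: "marked_face bc \<in> faces bc n"
  shows "form_inner bc n (inv_neg_laplacian bc n g) g = green_form bc n g"
proof -
  have "form_inner bc n (inv_neg_laplacian bc n g) g =
      (\<Sum>e\<in>edges bc n. side_diff bc n (inv_neg_laplacian bc n g) e * side_diff bc n (inv_neg_laplacian bc n g) e)"
    by (rule form_inner_two_form[OF inv_neg_laplacian_works(1)[OF mf] charge_inv_neg_laplacian[OF mf]])
  then show ?thesis by (simp add: green_form_energy[OF mf] power2_eq_square)
qed

lemma green_form_nonneg:
  assumes mf: "marked_face bc \<in> faces bc n"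
  shows "green_form bc n g \<ge> 0"
  unfolding green_form_energy[OF mf] by (intro sum_nonneg) auto

text \<open>
  The gradient of the potential on the smaller box is a competitor in Thomson's principle on the larger
  box; comparing the two energies bounds the energy outside the smaller box.
\<close>

lemma green_form_inner_energy:
  fixes g :: "face \<Rightarrow> real"

  assumes mf: "\<And>n. Square s \<in> faces (Dirichlet s) n" and kn: "k \<le> n"
    and supp: "\<And>f. f \<notin> faces (Dirichlet s) k \<Longrightarrow> g f = 0"
  shows "2 * green_form (Dirichlet s) n g - green_form (Dirichlet s) k g \<le>
    (\<Sum>e\<in>edges (Dirichlet s) k. (side_diff (Dirichlet s) n (inv_neg_laplacian (Dirichlet s) n g) e)\<^sup>2)"
proof -
  let ?bc = "Dirichlet s"
  let ?u = "\<lambda>n. inv_neg_laplacian ?bc n g"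
  have mf': "marked_face ?bc \<in> faces ?bc n" for n using mf[of n] by simp
  have sub: "edges ?bc k \<subseteq> edges ?bc n"
  proof
    fix e assume "e \<in> edges ?bc k"
    then show "e \<in> edges ?bc n"
      using kn by (cases e rule: ends.cases) (auto simp: in_graph simp del: edges.simps)
  qed
  have subF: "faces ?bc k \<subseteq> faces ?bc n"
  proof
    fix f assume f: "f \<in> faces ?bc k"
    then obtain x y where "f = Square (x, y)" by auto
    then show "f \<in> faces ?bc n" using f kn by (auto simp: in_graph simp del: faces.simps)
  qed
  \<comment> \<open>Both sides of an edge of the small graph are faces of it, so cutting off the
    large potential keeps its gradient there. As \<open>g\<close> lives on the small graph, the
    cross term below is the full energy of the large box.\<close>
  define v where "v f = (if f \<in> faces ?bc k then ?u n f else 0)" for f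
  have v: "v \<in> two_forms ?bc k"
    using inv_neg_laplacian_works(1)[OF mf', of n g] by (simp add: v_def two_forms_def)
  have sd: "side_diff ?bc k v e = side_diff ?bc n (?u n) e" if e: "e \<in> edges ?bc k" for e
    using sides_in_faces[OF e] left_face_Dirichlet[OF e] left_face_Dirichlet[OF subsetD[OF sub e]]
    by (simp add: v_def)
  have "(\<Sum>e\<in>edges ?bc k. side_diff ?bc n (?u n) e * side_diff ?bc k (?u k) e) =
      (\<Sum>e\<in>edges ?bc k. side_diff ?bc k v e * side_diff ?bc k (?u k) e)"
    by (intro sum.cong) (simp_all only: sd)
  also have "\<dots> = form_inner ?bc k v g"
    by (rule form_inner_two_form[symmetric, OF v charge_inv_neg_laplacian[OF mf']])
  also have "\<dots> = form_inner ?bc n (?u n) g"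
    unfolding form_inner_def using subF finite_faces[of ?bc n] supp
    by (intro sum.mono_neutral_cong_left) (auto simp: v_def)
  also have "\<dots> = green_form ?bc n g" by (rule green_form_eq_form_inner[OF mf'])
  finally have cross: "(\<Sum>e\<in>edges ?bc k. side_diff ?bc n (?u n) e * side_diff ?bc k (?u k) e) = green_form ?bc n g" .
  have "0 \<le> (\<Sum>e\<in>edges ?bc k. (side_diff ?bc n (?u n) e - side_diff ?bc k (?u k) e)\<^sup>2)"
    by (intro sum_nonneg) auto
  also have "\<dots> = (\<Sum>e\<in>edges ?bc k. (side_diff ?bc n (?u n) e)\<^sup>2) -
      2 * (\<Sum>e\<in>edges ?bc k. side_diff ?bc n (?u n) e * side_diff ?bc k (?u k) e) +
      (\<Sum>e\<in>edges ?bc k. (side_diff ?bc k (?u k) e)\<^sup>2)"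
    unfolding power2_diff sum.distrib sum_subtractf sum_distrib_left mult.assoc by simp
  finally show ?thesis unfolding cross green_form_energy[OF mf', of k] by simp
qed

text \<open>Testing with the indicator of one face, whose gradient has energy at most 4, bounds the
  energy below independently of \<open>n\<close>.\<close>

lemma green_form_lower:
  assumes mf: "marked_face bc \<in> faces bc n" and f: "Square t \<in> faces bc n - {marked_face bc}"
  shows "(g (Square t))\<^sup>2 \<le> 4 * green_form bc n g"
proof -
  obtain x y where t: "t = (x, y)" by (cases t)
  let ?S = "{Horizontal (x, y), Vertical (x + 1, y), Horizontal (x, y + 1), Vertical (x, y)}"
  let ?j = "side_diff bc n (inv_neg_laplacian bc n g)"
  define v :: "face \<Rightarrow> real" where "v f = (if f = Square t then 1 else 0)" for f
  have v: "v \<in> two_forms bc n" using f by (auto simp: two_forms_def v_def)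
  have F: "Square t \<in> faces bc n" using f by simp
  have out: "side_diff bc n v e = 0" if "e \<notin> ?S" for e
    using that unfolding v_def t by (simp add: side_eq_Square[OF F[unfolded t]])
  have le: "(side_diff bc n v e)\<^sup>2 \<le> 1" for e by (simp add: v_def)
  have "(\<Sum>e\<in>edges bc n. (side_diff bc n v e)\<^sup>2) = (\<Sum>e\<in>edges bc n \<inter> ?S. (side_diff bc n v e)\<^sup>2)"
    using finite_edges[of bc n] out by (intro sum.mono_neutral_right) auto
  also have "\<dots> \<le> (\<Sum>e\<in>edges bc n \<inter> ?S. 1)" by (intro sum_mono le)
  also have "\<dots> = real (card (edges bc n \<inter> ?S))" by simp
  also have "\<dots> \<le> real (card ?S)" by (intro of_nat_mono card_mono) auto
  also have "\<dots> \<le> 4" by simp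
  finally have v4: "(\<Sum>e\<in>edges bc n. (side_diff bc n v e)\<^sup>2) \<le> 4" .
  have "g (Square t) = (\<Sum>f\<in>faces bc n. if f = Square t then g f else 0)"
    using F finite_faces[of bc n] by simp
  also have "\<dots> = form_inner bc n v g"
    unfolding form_inner_def v_def by (intro sum.cong) auto
  also have "\<dots> = (\<Sum>e\<in>edges bc n. side_diff bc n v e * ?j e)"
    by (rule form_inner_two_form[OF v charge_inv_neg_laplacian[OF mf]])
  finally have "(g (Square t))\<^sup>2 \<le> (\<Sum>e\<in>edges bc n. (side_diff bc n v e)\<^sup>2) * (\<Sum>e\<in>edges bc n. (?j e)\<^sup>2)"
    by (simp only: Cauchy_Schwarz_ineq_sum)
  also have "\<dots> \<le> 4 * green_form bc n g"
    unfolding green_form_energy[OF mf] using v4 by (intro mult_right_mono sum_nonneg) auto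
  finally show ?thesis .
qed

lemma green_form_eq_zero:
  assumes mf: "marked_face bc \<in> faces bc n" and "\<And>f. f \<in> faces bc n - {marked_face bc} \<Longrightarrow> g f = 0"
  shows "green_form bc n g = 0"
proof -
  have "to_form bc n g = (\<lambda>_. 0)" using assms(2) by (auto simp: to_form_def fun_eq_iff)
  then show ?thesis by (simp add: green_form_def form_inner_def)
qed

text \<open>The energies decrease in \<open>n\<close> and converge, so over a fixed number of layers
  they eventually change by less than half of their positive lower bound. The case split isolates a
  \<open>g\<close> that vanishes off the marked face and has zero energy.\<close>

lemma energy_concentrates:
  fixes g :: "square \<Rightarrow> real" and \<Delta> :: nat
  assumes fin: "finite {t. g t \<noteq> 0}" and mf: "\<And>n. Square s \<in> faces (Dirichlet s) n"
  shows "\<exists>n\<^sub>0. \<forall>n\<ge>n\<^sub>0. green_form (Dirichlet s) n (on_faces g) / 2 \<le>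
    (\<Sum>e\<in>edges (Dirichlet s) (n - \<Delta>).
       (side_diff (Dirichlet s) n (inv_neg_laplacian (Dirichlet s) n (on_faces g)) e)\<^sup>2)"
proof (cases "\<exists>t. t \<noteq> s \<and> g t \<noteq> 0")
  case False
  have "green_form (Dirichlet s) n (on_faces g) = 0" for n
  proof (rule green_form_eq_zero)
    show "marked_face (Dirichlet s) \<in> faces (Dirichlet s) n" using mf[of n] by simp
    fix f assume "f \<in> faces (Dirichlet s) n - {marked_face (Dirichlet s)}"
    then show "on_faces g f = 0" using False by (cases f) auto
  qed
  then show ?thesis by (auto intro!: sum_nonneg)
next
  case True
  then obtain t where t: "t \<noteq> s" "g t \<noteq> 0" by blast
  define G where "G n = green_form (Dirichlet s) n (on_faces g)" for n
  have mf': "marked_face (Dirichlet s) \<in> faces (Dirichlet s) n" for n using mf[of n] by simp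
  obtain n1 :: nat where n1: "\<And>x y. g (x, y) \<noteq> 0 \<Longrightarrow> x \<in> {- int n1..int n1} \<and> y \<in> {- int n1..int n1}"
  proof -
    let ?S = "(\<lambda>(x, y). nat \<bar>x\<bar> + nat \<bar>y\<bar>) ` {t. g t \<noteq> 0}"
    have "nat \<bar>x\<bar> + nat \<bar>y\<bar> \<le> Max (insert 0 ?S)" if "g (x, y) \<noteq> 0" for x y
      using fin that by (intro Max_ge) (auto intro!: image_eqI[of _ _ "(x, y)"])
    then have "x \<in> {- int (Max (insert 0 ?S))..int (Max (insert 0 ?S))} \<and>
        y \<in> {- int (Max (insert 0 ?S))..int (Max (insert 0 ?S))}" if "g (x, y) \<noteq> 0" for x y
      using that by force
    then show thesis by (rule that)
  qed
  have supp: "on_faces g f = 0" if "f \<notin> faces (Dirichlet s) k" "k \<ge> n1" for f k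
  proof (cases f)
    case (Square t)
    obtain x y where xy: "t = (x, y)" by (cases t)
    have "g (x, y) = 0"
    proof (rule ccontr)
      assume "g (x, y) \<noteq> 0"
      from n1[OF this] that(2) have "Square (x, y) \<in> faces (Dirichlet s) k"
        unfolding square_in_faces_Dirichlet by auto
      then show False using that(1) Square xy by simp
    qed
    then show ?thesis using Square xy by simp
  qed simp
  have key: "2 * G n - G k \<le> (\<Sum>e\<in>edges (Dirichlet s) k.
       (side_diff (Dirichlet s) n (inv_neg_laplacian (Dirichlet s) n (on_faces g)) e)\<^sup>2)"
    if "n1 \<le> k" "k \<le> n" for k n
    unfolding G_def by (rule green_form_inner_energy[OF mf that(2) supp[OF _ that(1)]])
  \<comment> \<open>The energy on the inner edges is at most \<open>G n\<close>, so
    \<open>key\<close> itself yields monotonicity.\<close>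
  have anti: "G n \<le> G k" if "n1 \<le> k" "k \<le> n" for k n
  proof -
    have "edges (Dirichlet s) k \<subseteq> edges (Dirichlet s) n"
    proof
      fix e assume "e \<in> edges (Dirichlet s) k"
      then show "e \<in> edges (Dirichlet s) n"
        using that(2) by (cases e rule: ends.cases) (auto simp: in_graph simp del: edges.simps)
    qed
    then have "(\<Sum>e\<in>edges (Dirichlet s) k.
       (side_diff (Dirichlet s) n (inv_neg_laplacian (Dirichlet s) n (on_faces g)) e)\<^sup>2) \<le> G n"
      unfolding G_def green_form_energy[OF mf'] by (intro sum_mono2 finite_edges) auto
    then show ?thesis using key[OF that] by linarith
  qed
  define c where "c = (g t)\<^sup>2 / 4"
  have c: "c > 0" using t by (simp add: c_def)
  have low: "c \<le> G n" if n: "n1 \<le> n" for n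
  proof -
    have "Square t \<in> faces (Dirichlet s) n" using supp[of "Square t" n] n t(2) by auto
    then have "(on_faces g (Square t))\<^sup>2 \<le> 4 * G n"
      unfolding G_def using t(1) by (intro green_form_lower[OF mf']) simp
    then show ?thesis by (simp add: c_def)
  qed
  have "decseq (\<lambda>i. G (n1 + i))" by (rule decseq_SucI) (auto intro: anti)
  moreover have "0 \<le> G (n1 + i)" for i unfolding G_def by (rule green_form_nonneg[OF mf'])
  ultimately obtain l where l: "(\<lambda>i. G (n1 + i)) \<longlonglongrightarrow> l"
    using decseq_convergent[of "\<lambda>i. G (n1 + i)" 0] by blast
  then have "(\<lambda>i. G (n1 + (i + \<Delta>))) \<longlonglongrightarrow> l" using LIMSEQ_ignore_initial_segment[OF l, of \<Delta>] by simp
  then have "(\<lambda>i. G (n1 + i) - G (n1 + (i + \<Delta>))) \<longlonglongrightarrow> l - l" by (intro tendsto_diff l)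
  then have "\<forall>\<^sub>F i in sequentially. G (n1 + i) - G (n1 + (i + \<Delta>)) < c / 2"
    using c by (intro order_tendstoD(2)) auto
  then obtain i0 where i0: "\<And>i. i \<ge> i0 \<Longrightarrow> G (n1 + i) - G (n1 + (i + \<Delta>)) < c / 2"
    unfolding eventually_sequentially by blast
  show ?thesis
  proof (intro exI[of _ "n1 + i0 + \<Delta>"] allI impI)
    fix n assume n: "n \<ge> n1 + i0 + \<Delta>"
    define i where "i = n - \<Delta> - n1"
    have i: "n - \<Delta> = n1 + i" "n = n1 + (i + \<Delta>)" "i \<ge> i0" using n by (auto simp: i_def)
    have "G (n - \<Delta>) - G n < c / 2" using i0[OF i(3)] i(1,2) by simp
    moreover have "c \<le> G n" using n by (intro low) auto
    moreover have "2 * G n - G (n - \<Delta>) \<le> (\<Sum>e\<in>edges (Dirichlet s) (n - \<Delta>).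
       (side_diff (Dirichlet s) n (inv_neg_laplacian (Dirichlet s) n (on_faces g)) e)\<^sup>2)"
      using n by (intro key) auto
    ultimately show "green_form (Dirichlet s) n (on_faces g) / 2 \<le>
      (\<Sum>e\<in>edges (Dirichlet s) (n - \<Delta>).
       (side_diff (Dirichlet s) n (inv_neg_laplacian (Dirichlet s) n (on_faces g)) e)\<^sup>2)"
      unfolding G_def[symmetric] by linarith
  qed
qed

section \<open>The bound for local functions\<close>

lemma coulomb_variance_ge_test:
  fixes g :: "face \<Rightarrow> real" and vf :: "real \<Rightarrow> real"
  assumes mf: "marked_face bc \<in> faces bc n" and \<beta>: "\<beta> > 0"
  defines "b \<equiv> (2 * pi)\<^sup>2 * \<beta>"
  assumes vf: "vf \<in> borel_measurable borel" "\<And>x. 0 \<le> vf x" "\<And>x. vf x \<le> Var_IG x b"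
      "\<And>x k. vf (x + real_of_int k) = vf x"
    and w: "w \<ge> 0" "\<And>y. ennreal w \<le> (\<integral>\<^sup>+x. indicator {- 1/2..1/2} x * ennreal (vf (y - x)) \<partial>lborel)"
    and I: "I \<subseteq> edges bc n" and s: "s \<le> 3"
    and h: "\<And>e. e \<in> I \<Longrightarrow> \<exists>h :: site \<Rightarrow> real. site_grad bc n h e = 1 \<and> (\<Sum>e\<in>edges bc n. (site_grad bc n h e)\<^sup>2) \<le> s"
  shows "exp (- sqrt (3 * b)) / 2 * exp (- b * s / 8) * w *
    (\<Sum>e\<in>I. (side_diff bc n (inv_neg_laplacian bc n g) e)\<^sup>2) \<le> coulomb_variance bc n \<beta> g"
proof -
  have b: "b > 0" using \<beta> by (simp add: b_def)
  define C where "C = exp (- sqrt (3 * b)) / 2 * exp (- b * s / 8) * w"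
  have C: "C \<ge> 0" using w(1) by (simp add: C_def)
  \<comment> \<open>Edges outside \<open>I\<close>, for which no test function is supplied, are
    simply given up.\<close>
  define L where "L e = (if e \<in> I then C else 0)" for e
  let ?j = "side_diff bc n (inv_neg_laplacian bc n g)"
  interpret gaussian_field "free_sites bc n" "edges bc n" incidence b
    using b by unfold_locales (auto simp: finite_free_sites finite_edges)
  have "(\<Sum>e\<in>edges bc n. (?j e)\<^sup>2 * L e) \<le> coulomb_variance bc n \<beta> g"
  proof (rule coulomb_variance_ge[OF mf \<beta> vf(1,2) vf(3,4)[unfolded b_def], folded b_def])
    fix e t assume fin: "gauss (\<lambda>_. 1) < \<infinity>"
    show "ennreal (L e) * gauss (\<lambda>_. 1) \<le> gauss (\<lambda>\<phi>. ennreal (vf (t - site_grad bc n \<phi> e)))"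
    proof (cases "e \<in> I")
      case True
      from h[OF this] obtain h :: "site \<Rightarrow> real" where
        "site_grad bc n h e = 1" "(\<Sum>e\<in>edges bc n. (site_grad bc n h e)\<^sup>2) \<le> s" by blast
      from gauss_periodic_ge[OF fin this s vf(1) w] True show ?thesis by (simp add: L_def C_def)
    qed (simp add: L_def)
  qed (use C in \<open>auto simp: L_def\<close>)
  moreover have "(\<Sum>e\<in>edges bc n. (?j e)\<^sup>2 * L e) = (\<Sum>e\<in>I. (?j e)\<^sup>2 * C)"
    using I finite_edges[of bc n] by (intro sum.mono_neutral_cong_right) (auto simp: L_def)
  ultimately show ?thesis unfolding C_def[symmetric] by (simp add: sum_distrib_left mult.commute)
qed

lemma smallo_error_exponent:
  fixes c k p :: real
  assumes "c > 0" "p > 0"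
  shows "(\<lambda>\<beta>. ln (c / \<beta>) - sqrt (p * \<beta>) - k) \<in> o[at_top](\<lambda>\<beta>. \<beta>)"
  using assms by real_asymp

lemma coulomb_variance_ge_local:
  assumes s0: "(0, 0) \<in> corners s\<^sub>0"
  shows "\<exists>r :: real \<Rightarrow> real. r \<in> o[at_top](\<lambda>\<beta>. \<beta>) \<and>
        (\<forall>\<^sub>F \<beta> in at_top. \<forall>g :: square \<Rightarrow> real. finite {t. g t \<noteq> 0} \<longrightarrow>
          (\<exists>n\<^sub>0. \<forall>n \<ge> n\<^sub>0. \<forall>bc \<in> {Free, Dirichlet s\<^sub>0}.
             coulomb_variance bc n \<beta> (on_faces g) \<ge>
               exp (- pi\<^sup>2 * \<beta> + r \<beta>) * green_form bc n (on_faces g)))"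
proof -
  have mf: "marked_face bc \<in> faces bc n" if "bc \<in> {Free, Dirichlet s\<^sub>0}" for bc n
    using that s0 by (rule marked_face_in_faces)
  have mfD: "Square s\<^sub>0 \<in> faces (Dirichlet s\<^sub>0) n" for n using mf[of "Dirichlet s\<^sub>0" n] by simp
  obtain \<kappa> where \<kappa>: "\<kappa> > 0" and bump: "\<forall>b\<ge>4. \<exists>vf. vf \<in> borel_measurable borel \<and> (\<forall>x. 0 \<le> vf x \<and> vf x \<le> Var_IG x b) \<and>
     (\<forall>x k. vf (x + real_of_int k) = vf x) \<and>
     (\<forall>y. ennreal (\<kappa> / b) \<le> (\<integral>\<^sup>+x. indicator {- 1/2..1/2} x * ennreal (vf (y - x)) \<partial>lborel))"
    using IG_bump by blast
  \<comment> \<open>\<open>\<kappa> / b\<close> with two factors 1/2: one from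
    \<open>gauss_exp_abs\<close>, one from the concentration of the energy.\<close>
  define c where "c = \<kappa> / (16 * pi\<^sup>2)"
  have c: "c > 0" using \<kappa> by (simp add: c_def)
  define r where "r \<beta> = ln (c / \<beta>) - sqrt (12 * pi\<^sup>2 * \<beta>) - pi\<^sup>2 / 2" for \<beta>
  have r: "r \<in> o[at_top](\<lambda>\<beta>. \<beta>)" unfolding r_def using c by (intro smallo_error_exponent) auto
  have main: "\<exists>n\<^sub>0. \<forall>n \<ge> n\<^sub>0. \<forall>bc \<in> {Free, Dirichlet s\<^sub>0}.
      coulomb_variance bc n \<beta> (on_faces g) \<ge> exp (- pi\<^sup>2 * \<beta> + r \<beta>) * green_form bc n (on_faces g)"
    if \<beta>: "\<beta> \<ge> 1" and fin: "finite {t. g t \<noteq> 0}" for \<beta> and g :: "square \<Rightarrow> real"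
  proof -
    define b where "b = (2 * pi)\<^sup>2 * \<beta>"
    \<comment> \<open>With \<open>N\<close> at least \<open>\<beta>\<close> the excess energy
      \<open>1 / \<beta>\<close> costs only the constant factor exp(-pi^2/2) in the bound.\<close>
    define N where "N = nat \<lceil>\<beta>\<rceil>"
    define s where "s = 2 + 1 / \<beta>"
    have "pi\<^sup>2 \<ge> 1" using pi_ge_two by (simp add: one_le_power)
    then have "pi\<^sup>2 * \<beta> \<ge> 1 * 1" using \<beta> by (intro mult_mono) auto
    then have b: "b \<ge> 4" by (simp add: b_def power_mult_distrib)
    have "\<beta> \<le> real N" unfolding N_def using real_nat_ceiling_ge by blast
    then have "2 / (2 * real N + 1) \<le> 2 / (2 * \<beta>)" using \<beta> by (intro divide_left_mono) auto
    then have Ns: "2 + 2 / (2 * real N + 1) \<le> s" by (simp add: s_def)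
    have s3: "s \<le> 3" using \<beta> by (simp add: s_def)
    obtain vf where vf: "vf \<in> borel_measurable borel" "\<forall>x. 0 \<le> vf x \<and> vf x \<le> Var_IG x b"
      "\<forall>x k. vf (x + real_of_int k) = vf x"
      "\<forall>y. ennreal (\<kappa> / b) \<le> (\<integral>\<^sup>+x. indicator {- 1/2..1/2} x * ennreal (vf (y - x)) \<partial>lborel)"
      using bump[rule_format, OF b] by blast
    define C where "C = exp (- sqrt (3 * b)) / 2 * exp (- b * s / 8) * (\<kappa> / b)"
    have CC: "exp (- pi\<^sup>2 * \<beta> + r \<beta>) = C / 2"
    proof -
      have "3 * b = 12 * pi\<^sup>2 * \<beta>" by (simp add: b_def power_mult_distrib)
      moreover have "- b * s / 8 = - pi\<^sup>2 * \<beta> - pi\<^sup>2 / 2"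
        using \<beta> by (simp add: b_def s_def power_mult_distrib field_simps)
      moreover have "\<kappa> / b = 4 * (c / \<beta>)" by (simp add: b_def c_def power_mult_distrib)
      moreover have "exp (- pi\<^sup>2 * \<beta> + r \<beta>) = exp (- sqrt (12 * pi\<^sup>2 * \<beta>)) * exp (- pi\<^sup>2 * \<beta> - pi\<^sup>2 / 2) * exp (ln (c / \<beta>))"
        unfolding exp_add[symmetric] by (simp add: r_def)
      moreover have "exp (ln (c / \<beta>)) = c / \<beta>" using c \<beta> by simp
      ultimately show ?thesis unfolding C_def by simp
    qed
    have var: "C * (\<Sum>e\<in>I. (side_diff bc n (inv_neg_laplacian bc n (on_faces g)) e)\<^sup>2) \<le> coulomb_variance bc n \<beta> (on_faces g)"
      if bc: "bc \<in> {Free, Dirichlet s\<^sub>0}" and I: "I \<subseteq> edges bc n"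
        and inner: "\<And>e. e \<in> I \<Longrightarrow> bc = Free \<or> tail_site e \<in> {- (int n - 2 * int N - 1)..int n - 2 * int N - 1} \<times> {- (int n - 2 * int N - 1)..int n - 2 * int N - 1}"
      for bc n I
      unfolding C_def
    proof (rule coulomb_variance_ge_test[where \<beta> = \<beta> and vf = vf, folded b_def, OF mf[OF bc]])
      fix e assume e: "e \<in> I"
      obtain h :: "site \<Rightarrow> real" where "site_grad bc n h e = 1"
        "(\<Sum>e\<in>edges bc n. (site_grad bc n h e)\<^sup>2) \<le> 2 + 2 / (2 * real N + 1)"
        using graph_test_function[OF subsetD[OF I e] inner[OF e]] by blast
      then show "\<exists>h :: site \<Rightarrow> real. site_grad bc n h e = 1 \<and> (\<Sum>e\<in>edges bc n. (site_grad bc n h e)\<^sup>2) \<le> s"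
        using Ns by (intro exI[of _ h]) auto
    qed (use vf \<beta> \<kappa> b I s3 in auto)
    have C0: "C \<ge> 0" using \<kappa> b by (simp add: C_def)
    \<comment> \<open>One layer more than the margin \<open>2 * N + 1\<close>, because an edge of a
      Dirichlet box may start one step outside that box.\<close>
    obtain n0 where n0: "\<forall>n\<ge>n0. green_form (Dirichlet s\<^sub>0) n (on_faces g) / 2 \<le>
        (\<Sum>e\<in>edges (Dirichlet s\<^sub>0) (n - (2 * N + 2)).
           (side_diff (Dirichlet s\<^sub>0) n (inv_neg_laplacian (Dirichlet s\<^sub>0) n (on_faces g)) e)\<^sup>2)"
      using energy_concentrates[OF fin mfD, of "2 * N + 2"] by blast
    show ?thesis
    proof (intro exI[of _ "n0 + (2 * N + 2)"] allI impI ballI)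
      fix n bc assume n: "n \<ge> n0 + (2 * N + 2)" and bc: "bc \<in> {Free, Dirichlet s\<^sub>0}"
      let ?G = "green_form bc n (on_faces g)"
      have "C * (?G / 2) \<le> coulomb_variance bc n \<beta> (on_faces g)"
      proof (cases bc)
        case Free
        \<comment> \<open>All edges are usable here; the factor 1/2 is given away so that one
          \<open>r\<close> serves both boundary conditions.\<close>
        have "?G / 2 \<le> ?G" using green_form_nonneg[OF mf[OF bc]] by simp
        then have "C * (?G / 2) \<le> C * ?G" using C0 by (rule mult_left_mono)
        also have "\<dots> \<le> coulomb_variance bc n \<beta> (on_faces g)"
          unfolding green_form_energy[OF mf[OF bc]] by (rule var[OF bc]) (use Free in auto)
        finally show ?thesis .
      next
        case (Dirichlet s)
        then have D: "bc = Dirichlet s\<^sub>0" using bc by auto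
        let ?I = "edges (Dirichlet s\<^sub>0) (n - (2 * N + 2))"
        have "C * (?G / 2) \<le> C * (\<Sum>e\<in>?I. (side_diff bc n (inv_neg_laplacian bc n (on_faces g)) e)\<^sup>2)"
          unfolding D using n0 n C0 by (intro mult_left_mono) auto
        also have "\<dots> \<le> coulomb_variance bc n \<beta> (on_faces g)"
        proof (rule var[OF bc])
          have "int (n - (2 * N + 2)) = int n - 2 * int N - 2" using n by simp
          then have m: "(e \<in> edges bc n \<and> tail_site e \<in> {- (int n - 2 * int N - 1)..int n - 2 * int N - 1} \<times> {- (int n - 2 * int N - 1)..int n - 2 * int N - 1})"
            if "e \<in> ?I" for e
            using that unfolding D
            by (cases e rule: ends.cases) (auto simp: in_graph simp del: edges.simps)
          show "?I \<subseteq> edges bc n" using m by blast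
          show "bc = Free \<or> tail_site e \<in> {- (int n - 2 * int N - 1)..int n - 2 * int N - 1} \<times> {- (int n - 2 * int N - 1)..int n - 2 * int N - 1}"
            if "e \<in> ?I" for e using m[OF that] by blast
        qed
        finally show ?thesis .
      qed
      then show "exp (- pi\<^sup>2 * \<beta> + r \<beta>) * ?G \<le> coulomb_variance bc n \<beta> (on_faces g)"
        unfolding CC by simp
    qed
  qed
  show ?thesis
    using r main by (intro exI[of _ r] conjI eventually_at_top_linorderI[of 1]) auto
qed

theorem theorem1p1:
  fixes s\<^sub>0 :: square
  assumes "(0, 0) \<in> corners s\<^sub>0"
  shows
    "(\<forall>\<beta> > 0. \<forall>n \<ge> 1. \<forall>bc \<in> {Free, Dirichlet s\<^sub>0}. \<forall>g :: face \<Rightarrow> real.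
        coulomb_variance bc n \<beta> g \<ge> M \<beta> / ((2 * pi)\<^sup>2 * \<beta>) * green_form bc n g)
     \<and>
     (\<exists>r :: real \<Rightarrow> real. r \<in> o[at_top](\<lambda>\<beta>. \<beta>) \<and>
        (\<forall>\<^sub>F \<beta> in at_top. \<forall>g :: square \<Rightarrow> real. finite {t. g t \<noteq> 0} \<longrightarrow>
          (\<exists>n\<^sub>0. \<forall>n \<ge> n\<^sub>0. \<forall>bc \<in> {Free, Dirichlet s\<^sub>0}.
             coulomb_variance bc n \<beta> (on_faces g) \<ge>
               exp (- pi\<^sup>2 * \<beta> + r \<beta>) * green_form bc n (on_faces g))))"
proof
  show "\<forall>\<beta> > 0. \<forall>n \<ge> 1. \<forall>bc \<in> {Free, Dirichlet s\<^sub>0}. \<forall>g :: face \<Rightarrow> real.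
        coulomb_variance bc n \<beta> g \<ge> M \<beta> / ((2 * pi)\<^sup>2 * \<beta>) * green_form bc n g"
    using assms by (intro allI impI ballI coulomb_variance_ge_M marked_face_in_faces)
qed (rule coulomb_variance_ge_local[OF assms])

end
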